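(* Let $n\ge1$ and let $\mathscr A$ be an arrangement of $d\geq\binom{n+2}{2}$ hyperplanes in the complex projective space $\mathbb P^n$, in general position with respect to hyperplanes and to quadrics. Let $m\geq 2n+2$ be an integer. Then the Fermat cover $Y$ associated to $\mathscr A$ with ramification $m$ is Kobayashi-hyperbolic.
   Context: Everything is over $\mathbb C$. General position: each hyperplane of $\mathbb P^n$ is viewed as a point of the dual projective space. The arrangement is in general position with respect to hyperplanes if no $n+1$ of the corresponding $d$ points lie in a single hyperplane of the dual space; it is in general position with respect to quadrics if no $\binom{n+2}{2}$ of these points lie in a single quadric hypersurface of the dual space. Fermat cover: write $d=n+1+k$ and $N=n+k$, and label the hyperplanes $H_0,\dots,H_{N}$. Choose homogeneous coordinates $Z_0,\dots,Z_n$ on $\mathbb P^n$ such that $H_i=(Z_i=0)$ for $0\le i\le n$ and $H_{n+j}=(a_0^jZ_0+\dots+a_n^jZ_n=0)$ for $1\le j\le k$, with $a_i^j\in\mathbb C$. Identify $\mathbb P^n$ with the linear subspace of $\mathbb P^{N}$ (homogeneous coordinates $Z_0,\dots,Z_N$) cut out by the $k$ equations $Z_{n+j}=a_0^jZ_0+\dots+a_n^jZ_n$. The Fermat cover is the complete intersection $Y\subset\mathbb P^{N}$ of the $k$ Fermat hypersurfaces $Z_{n+j}^m=a_0^jZ_0^m+\dots+a_n^jZ_n^m$ ($1\le j\le k$), with the map $\pi\colon Y\to\mathbb P^n$, $[Z_i]\mapsto[Z_i^m]$, which ramifies exactly over the $H_i$, with multiplicity $m$. *)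

theory Defs
  imports "HOL-Complex_Analysis.Complex_Analysis" "HOL-Library.Extended_Nonnegative_Real"
begin

(* avoids ambiguity with vector components *)
no_notation fps_nth (infixl "$" 75)

text \<open>A point of the projective space with homogeneous coordinates indexed by \<open>'i\<close>
  (of dimension \<open>CARD('i) - 1\<close>) is a complex line through the origin of \<open>complex ^ 'i\<close>.\<close>

definition proj_pt :: "complex ^ 'i::finite \<Rightarrow> (complex ^ 'i) set" where
  "proj_pt z = vec.span {z}"

definition lin_form :: "complex ^ 'i::finite \<Rightarrow> complex ^ 'i \<Rightarrow> complex" where
  "lin_form \<xi> z = (\<Sum>i\<in>UNIV. \<xi> $ i * z $ i)"

definition quad_form :: "complex ^ 'i ^ 'i::finite \<Rightarrow> complex ^ 'i \<Rightarrow> complex" where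
  "quad_form Q z = (\<Sum>i\<in>UNIV. \<Sum>j\<in>UNIV. Q $ i $ j * z $ i * z $ j)"

definition hyperplane :: "complex ^ 'i::finite \<Rightarrow> (complex ^ 'i) set set" where
  "hyperplane \<xi> = {proj_pt z | z. z \<noteq> 0 \<and> lin_form \<xi> z = 0}"

definition quadric :: "complex ^ 'i ^ 'i::finite \<Rightarrow> (complex ^ 'i) set set" where
  "quadric Q = {proj_pt z | z. z \<noteq> 0 \<and> quad_form Q z = 0}"

definition hyperplane_arrangement :: "(complex ^ 'i::finite) set set set \<Rightarrow> bool" where
  "hyperplane_arrangement A \<longleftrightarrow> finite A \<and> (\<forall>L\<in>A. \<exists>\<xi>. \<xi> \<noteq> 0 \<and> L = hyperplane \<xi>)"

text \<open>The dual projective space is coordinatised by the coefficients of linear forms, so that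
  it is again modelled on \<open>complex ^ 'i\<close>. The point of it that corresponds to a hyperplane is
  the line of all linear forms vanishing on that hyperplane, see \<open>dual_pt_hyperplane\<close> below.\<close>

definition dual_pt :: "(complex ^ 'i::finite) set set \<Rightarrow> (complex ^ 'i) set" where
  "dual_pt L = {\<xi>. \<forall>z. proj_pt z \<in> L \<longrightarrow> lin_form \<xi> z = 0}"

definition general_position_hyperplanes :: "(complex ^ 'i::finite) set set set \<Rightarrow> bool" where
  "general_position_hyperplanes A \<longleftrightarrow>
     (\<forall>S\<subseteq>A. card S = CARD('i) \<longrightarrow> \<not> (\<exists>\<eta>. \<eta> \<noteq> 0 \<and> dual_pt ` S \<subseteq> hyperplane \<eta>))"

text \<open>With \<open>CARD('i) = n + 1\<close>, the binomial coefficient below is \<open>(n + 2) choose 2\<close>.\<close>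

definition general_position_quadrics :: "(complex ^ 'i::finite) set set set \<Rightarrow> bool" where
  "general_position_quadrics A \<longleftrightarrow>
     (\<forall>S\<subseteq>A. card S = (CARD('i) + 1) choose 2 \<longrightarrow>
        \<not> (\<exists>Q. Q \<noteq> 0 \<and> transpose Q = Q \<and> dual_pt ` S \<subseteq> quadric Q))"

text \<open>In the index type \<open>'n + 'k\<close>, \<open>Inl\<close> labels the first \<open>n + 1\<close> homogeneous
  coordinates (and hyperplanes) and \<open>Inr\<close> the remaining \<open>k\<close> ones; \<open>a j $ i\<close> is the
  coefficient of the \<open>i\<close>-th coordinate in the \<open>j\<close>-th equation.\<close>

definition fermat_complete_intersection ::
  "nat \<Rightarrow> ('k::finite \<Rightarrow> complex ^ 'n::finite) \<Rightarrow> (complex ^ ('n + 'k)) set set" where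
  "fermat_complete_intersection m a =
     {proj_pt Z | Z. Z \<noteq> 0 \<and> (\<forall>j. (Z $ Inr j) ^ m = (\<Sum>i\<in>UNIV. a j $ i * (Z $ Inl i) ^ m))}"

text \<open>The cover depends on a labelling \<open>H\<close> of the hyperplanes and on a choice of homogeneous
  coordinates, given by the rows of an invertible matrix \<open>B\<close>: the \<open>i\<close>-th coordinate is
  \<open>lin_form (B $ i)\<close>. All admissible choices are allowed. The bijection \<open>H\<close> forces
  \<open>card A = CARD('n) + CARD('k)\<close>.\<close>

definition is_fermat_cover ::
  "(complex ^ 'n::finite) set set set \<Rightarrow> nat \<Rightarrow> (complex ^ ('n + 'k::finite)) set set \<Rightarrow> bool" where
  "is_fermat_cover A m Y \<longleftrightarrow>
     (\<exists>(H :: 'n + 'k \<Rightarrow> (complex ^ 'n) set set) (B :: complex ^ 'n ^ 'n) (a :: 'k \<Rightarrow> complex ^ 'n).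
        bij_betw H UNIV A \<and> invertible B \<and>
        (\<forall>i. H (Inl i) = hyperplane (B $ i)) \<and>
        (\<forall>j. H (Inr j) = hyperplane (\<Sum>i\<in>UNIV. a j $ i *s B $ i)) \<and>
        Y = fermat_complete_intersection m a)"

text \<open>A map into projective space is holomorphic iff locally it is given by holomorphic
  homogeneous coordinates without common zeros.\<close>

definition proj_holomorphic_on :: "(complex \<Rightarrow> (complex ^ 'i::finite) set) \<Rightarrow> complex set \<Rightarrow> bool" where
  "proj_holomorphic_on f U \<longleftrightarrow>
     (\<forall>z\<in>U. \<exists>W F. open W \<and> z \<in> W \<and> W \<subseteq> U \<and> (\<forall>i. (\<lambda>w. F w $ i) holomorphic_on W) \<and>
        (\<forall>w\<in>W. F w \<noteq> 0 \<and> f w = proj_pt (F w)))"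

definition holomorphic_disc :: "(complex ^ 'i::finite) set set \<Rightarrow> (complex \<Rightarrow> (complex ^ 'i) set) \<Rightarrow> bool" where
  "holomorphic_disc Y f \<longleftrightarrow> proj_holomorphic_on f (ball 0 1) \<and> f ` ball 0 1 \<subseteq> Y"

text \<open>The distance of the Poincare metric of curvature \<open>-1\<close> on the unit disc.\<close>

definition poincare_dist :: "complex \<Rightarrow> complex \<Rightarrow> real" where
  "poincare_dist a b = 2 * artanh (cmod ((a - b) / (1 - cnj a * b)))"

definition disc_chain ::
  "(complex ^ 'i::finite) set set \<Rightarrow> (complex ^ 'i) set \<Rightarrow> (complex ^ 'i) set \<Rightarrow>
   nat \<Rightarrow> (nat \<Rightarrow> complex \<Rightarrow> (complex ^ 'i) set) \<Rightarrow> (nat \<Rightarrow> complex) \<Rightarrow> (nat \<Rightarrow> complex) \<Rightarrow> bool" where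
  "disc_chain Y p q l f a b \<longleftrightarrow>
     (\<exists>x. x 0 = p \<and> x l = q \<and>
        (\<forall>i<l. holomorphic_disc Y (f i) \<and> a i \<in> ball 0 1 \<and> b i \<in> ball 0 1 \<and>
           f i (a i) = x i \<and> f i (b i) = x (Suc i)))"

text \<open>The infimum is \<open>\<infinity>\<close> if \<open>p\<close> and \<open>q\<close> are not joined by any chain of discs.\<close>

definition kobayashi_dist ::
  "(complex ^ 'i::finite) set set \<Rightarrow> (complex ^ 'i) set \<Rightarrow> (complex ^ 'i) set \<Rightarrow> ennreal" where
  "kobayashi_dist Y p q =
     Inf {(\<Sum>i<l. ennreal (poincare_dist (a i) (b i))) | l f a b. disc_chain Y p q l f a b}"

text \<open>\<open>kobayashi_dist Y\<close> always is a pseudodistance, so it is a distance iff it separates points.\<close>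

definition kobayashi_hyperbolic :: "(complex ^ 'i::finite) set set \<Rightarrow> bool" where
  "kobayashi_hyperbolic Y \<longleftrightarrow> (\<forall>p\<in>Y. \<forall>q\<in>Y. p \<noteq> q \<longrightarrow> kobayashi_dist Y p q > 0)"

lemma mem_proj_pt: "w \<in> proj_pt z \<longleftrightarrow> (\<exists>c. w = c *s z)"
  unfolding proj_pt_def by (auto simp: vec.span_singleton)

lemma lin_form_scale: "lin_form \<xi> (c *s z) = c * lin_form \<xi> z" "lin_form (c *s \<xi>) z = c * lin_form \<xi> z"
  unfolding lin_form_def sum_distrib_left by (auto intro!: sum.cong)

lemma lin_form_axis: "lin_form \<xi> (axis i c) = \<xi> $ i * c"
proof -
  have "lin_form \<xi> (axis i c) = (\<Sum>j\<in>UNIV. if j = i then \<xi> $ i * c else 0)"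
    unfolding lin_form_def axis_def by (intro sum.cong) auto
  then show ?thesis by simp
qed

lemma lin_form_diff: "lin_form \<xi> (x - y) = lin_form \<xi> x - lin_form \<xi> y"
  by (simp add: lin_form_def algebra_simps sum_subtractf)

lemma proj_pt_in_hyperplane: "proj_pt z \<in> hyperplane \<xi> \<longleftrightarrow> z \<noteq> 0 \<and> lin_form \<xi> z = 0"
proof
  assume "proj_pt z \<in> hyperplane \<xi>"
  then obtain w where w: "w \<noteq> 0" "lin_form \<xi> w = 0" "proj_pt z = proj_pt w"
    by (auto simp: hyperplane_def)
  have "w \<in> proj_pt z" unfolding w(3) mem_proj_pt by (intro exI[of _ 1]) simp
  then obtain c where c: "w = c *s z" by (auto simp: mem_proj_pt)
  with w(1,2) show "z \<noteq> 0 \<and> lin_form \<xi> z = 0" by (auto simp: lin_form_scale)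
qed (auto simp: hyperplane_def)

lemma dual_pt_hyperplane:
  assumes "\<xi> \<noteq> 0"
  shows "dual_pt (hyperplane \<xi>) = proj_pt \<xi>"
proof (intro set_eqI iffI)
  fix \<eta> assume "\<eta> \<in> dual_pt (hyperplane \<xi>)"
  then have h: "lin_form \<eta> z = 0" if "lin_form \<xi> z = 0" for z
  proof (cases "z = 0")
    case True
    then show ?thesis by (simp add: lin_form_def)
  next
    case False
    with that \<open>\<eta> \<in> dual_pt (hyperplane \<xi>)\<close> show ?thesis
      by (simp add: dual_pt_def proj_pt_in_hyperplane)
  qed
  from assms obtain i where i: "\<xi> $ i \<noteq> 0" by (auto simp: vec_eq_iff)
  have *: "\<eta> $ j = \<eta> $ i / \<xi> $ i * \<xi> $ j" for j
    using h[of "axis j (\<xi> $ i) - axis i (\<xi> $ j)"] i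
    by (simp add: lin_form_diff lin_form_axis field_simps)
  have "\<eta> = (\<eta> $ i / \<xi> $ i) *s \<xi>"
    unfolding vec_eq_iff vector_smult_component using * by blast
  then show "\<eta> \<in> proj_pt \<xi>" unfolding mem_proj_pt by blast
next
  fix \<eta> assume "\<eta> \<in> proj_pt \<xi>"
  then show "\<eta> \<in> dual_pt (hyperplane \<xi>)"
    by (auto simp: mem_proj_pt dual_pt_def proj_pt_in_hyperplane lin_form_scale)
qed

end

theory Submission
  imports Defs "Jordan_Normal_Form.Determinant"
begin

text \<open>If the discs in \<open>Y\<close> do not satisfy a uniform derivative bound at \<open>0\<close>, Brody's rescaling produces a
  nonconstant holomorphic curve \<open>Z\<close> from the plane to \<open>Y\<close> with bounded derivative. Let \<open>s\<close> of its
  coordinates vanish identically, let \<open>r = k + 1\<close> be the dimension of the span of the functions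
  \<open>Z\<^sub>\<alpha>\<^sup>m\<close>, and let \<open>W\<close> be the Wronskian of a basis of this span. The power \<open>W\<^sup>p\<close> with
  \<open>p = n + 2 - r - s\<close> is divisible by the product of \<open>Z\<^sub>\<alpha>\<^bsup>m - k\<^esup>\<close> over all coordinates that do not
  vanish identically: by general position those of them that are small at a given point are among
  the elements of a basis and \<open>p - 1\<close> further coordinates, and \<open>W\<close> is divisible by \<open>Z\<^sub>\<alpha>\<^bsup>m - k\<^esup>\<close> for each of the
  latter. The quotient has negative degree \<open>p r m - (d - s) (m - k)\<close> in \<open>Z\<close>, so its products
  with monomials of the opposite degree are functions on the plane. They are bounded since the
  curve has bounded derivative, hence constant by Liouville's theorem, and so all quotients
  \<open>Z\<^sub>\<alpha> / Z\<^sub>\<beta>\<close> are constant. This contradicts the choice of the curve.\<close>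

section \<open>Wronskians\<close>

no_notation Matrix.vec_index (infixl "$" 100)

text \<open>A curve in projective space carries no preferred lift, so every quantity must be
  homogeneous in the lift. Replacing \<open>Z\<close> by \<open>g Z\<close> multiplies the Wronskian
  of \<open>r\<close> of the powers by \<open>g^(m r)\<close>, the derivatives of \<open>g\<close>
  dropping out; this is what gives degrees a meaning. Its substitute is an inequality at the centre
  of a unit ball: Cauchy's inequality bounds the derivatives of \<open>Z_\<alpha>^m\<close> of order
  at most \<open>k\<close> by a constant times \<open>|Z_\<alpha>|^(m - k)\<close>, and the constant
  is the same at all centres because the lifts are normalised on balls of equal radius. Smallness is
  quantitative as well: any \<open>n + 1\<close> powers span all others with constant coefficients,
  so at most \<open>n\<close> coordinates fall below a fixed threshold. The product
  \<open>p r\<close> is largest near \<open>r = (n - s + 2) / 2\<close>, and the lower bounds on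
  \<open>d\<close> and \<open>m\<close> outweigh the degree \<open>p r m\<close> even there.\<close>

definition wronsk :: "nat \<Rightarrow> (nat \<Rightarrow> complex \<Rightarrow> complex) \<Rightarrow> complex \<Rightarrow> complex" where
  "wronsk r x w = Determinant.det (Matrix.mat r r (\<lambda>(i, j). (deriv ^^ j) (x i) w))"

lemma permutes_atLeast0LessThan:
  "p permutes {0..<r} \<Longrightarrow> i < r \<Longrightarrow> p i < r" for r :: nat
  using permutes_in_image[of p "{0..<r}" i] by simp

lemma wronsk_cong:
  assumes "open U" "w \<in> U" "\<And>i v. i < r \<Longrightarrow> v \<in> U \<Longrightarrow> x i v = y i v"
  shows "wronsk r x w = wronsk r y w"
proof -
  have "(deriv ^^ j) (x i) w = (deriv ^^ j) (y i) w" if "i < r" for i j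
    by (rule higher_deriv_cong_ev) (use assms that in \<open>auto simp: eventually_nhds\<close>)
  then show ?thesis
    unfolding wronsk_def by (intro arg_cong[of _ _ Determinant.det] eq_matI) auto
qed

lemma holomorphic_wronsk:
  assumes "open U" "\<And>i. i < r \<Longrightarrow> x i holomorphic_on U"
  shows "wronsk r x holomorphic_on U"
proof -
  have "(\<lambda>w. \<Sum>p | p permutes {0..<r}. of_int (sign p) * (\<Prod>i = 0..<r. (deriv ^^ p i) (x i) w))
      holomorphic_on U"
    by (intro holomorphic_intros holomorphic_higher_deriv assms) auto
  moreover have "wronsk r x = (\<lambda>w. \<Sum>p | p permutes {0..<r}.
      of_int (sign p) * (\<Prod>i = 0..<r. (deriv ^^ p i) (x i) w))"
    unfolding wronsk_def Determinant.det_def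
    by (auto intro!: sum.cong prod.cong simp: permutes_atLeast0LessThan fun_eq_iff)
  ultimately show ?thesis by simp
qed

text \<open>Each term of the determinant takes one entry from every row, and the row bound
  \<open>C * e i\<close> does not depend on the order of the derivative. So the product of all
  \<open>e i\<close> comes out of every term: divisibility in the form of an inequality.\<close>

lemma norm_wronsk_le:
  assumes "\<And>i j. i < r \<Longrightarrow> j < r \<Longrightarrow> norm ((deriv ^^ j) (x i) w) \<le> C * e i"
  shows "norm (wronsk r x w) \<le> fact r * C ^ r * (\<Prod>i<r. e i)"
proof -
  have "norm (wronsk r x w) = norm (\<Sum>p | p permutes {0..<r}.
      of_int (sign p) * (\<Prod>i = 0..<r. (deriv ^^ p i) (x i) w))"
    unfolding wronsk_def Determinant.det_def
    by (auto intro!: sum.cong prod.cong arg_cong[of _ _ norm] simp: permutes_atLeast0LessThan)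
  also have "\<dots> \<le> (\<Sum>p | p permutes {0..<r}. \<Prod>i = 0..<r. C * e i)"
  proof (rule sum_norm_le)
    fix p assume "p \<in> {p. p permutes {0..<r}}"
    then have p: "p permutes {0..<r}" by simp
    have "norm (of_int (sign p) * (\<Prod>i = 0..<r. (deriv ^^ p i) (x i) w))
        = (\<Prod>i = 0..<r. norm ((deriv ^^ p i) (x i) w))"
      by (auto simp: norm_mult prod_norm sign_def)
    also have "\<dots> \<le> (\<Prod>i = 0..<r. C * e i)"
      by (intro prod_mono) (use assms p in \<open>auto simp: permutes_atLeast0LessThan\<close>)
    finally show "norm (of_int (sign p) * (\<Prod>i = 0..<r. (deriv ^^ p i) (x i) w))
        \<le> (\<Prod>i = 0..<r. C * e i)" .
  qed
  also have "\<dots> = fact r * C ^ r * (\<Prod>i<r. e i)"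
    by (simp add: card_permutations prod.distrib lessThan_atLeast0)
  finally show ?thesis .
qed

lemma higher_deriv_sum':
  assumes "open U" "w \<in> U" "\<And>l. l \<in> L \<Longrightarrow> y l holomorphic_on U" "finite L"
  shows "(deriv ^^ j) (\<lambda>v. \<Sum>l\<in>L. A l * y l v) w = (\<Sum>l\<in>L. A l * (deriv ^^ j) (y l) w)"
  using assms(4,3)
proof (induction L rule: finite_induct)
  case empty
  show ?case by simp
next
  case (insert l L)
  have "(deriv ^^ j) (\<lambda>v. A l * y l v + (\<Sum>l\<in>L. A l * y l v)) w
      = (deriv ^^ j) (\<lambda>v. A l * y l v) w + (deriv ^^ j) (\<lambda>v. \<Sum>l\<in>L. A l * y l v) w"
    by (rule higher_deriv_add[of _ U])
      (use insert assms(1,2) in \<open>auto intro!: holomorphic_intros\<close>)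
  also have "(deriv ^^ j) (\<lambda>v. A l * y l v) w = A l * (deriv ^^ j) (y l) w"
    by (rule higher_deriv_cmult[of _ U]) (use insert assms(1,2) in auto)
  finally show ?case using insert by simp
qed

text \<open>Constant coefficients commute with \<open>deriv\<close>, so the derivative matrix
  factors.\<close>

lemma wronsk_linear_comb:
  assumes "open U" "w \<in> U" "\<And>l. l < r \<Longrightarrow> y l holomorphic_on U"
    and "\<And>i v. i < r \<Longrightarrow> v \<in> U \<Longrightarrow> x i v = (\<Sum>l<r. A i l * y l v)"
  shows "wronsk r x w = Determinant.det (Matrix.mat r r (\<lambda>(i, l). A i l)) * wronsk r y w"
proof -
  let ?A = "Matrix.mat r r (\<lambda>(i, l). A i l)"
  let ?Y = "Matrix.mat r r (\<lambda>(i, j). (deriv ^^ j) (y i) w)"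
  have "wronsk r x w = wronsk r (\<lambda>i v. \<Sum>l<r. A i l * y l v) w"
    by (rule wronsk_cong[of U]) (use assms in auto)
  also have "\<dots> = Determinant.det (?A * ?Y)"
    unfolding wronsk_def
  proof (intro arg_cong[of _ _ Determinant.det] eq_matI)
    fix i j assume "i < dim_row (?A * ?Y)" "j < dim_col (?A * ?Y)"
    then show "Matrix.mat r r (\<lambda>(i, j). (deriv ^^ j) (\<lambda>v. \<Sum>l<r. A i l * y l v) w) $$ (i, j)
        = (?A * ?Y) $$ (i, j)"
      using higher_deriv_sum'[of U w "{..<r}" y j "A i"] assms(1-3)
      by (simp add: scalar_prod_def lessThan_atLeast0)
  qed auto
  also have "\<dots> = Determinant.det ?A * wronsk r y w"
    unfolding wronsk_def by (rule det_mult[of _ r]) auto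
  finally show ?thesis .
qed

text \<open>By Leibniz' rule the derivative matrix of the products is that of \<open>x\<close> times
  an upper triangular matrix with \<open>g w\<close> along the diagonal. Derivatives of
  \<open>g\<close> occur only above the diagonal and do not reach the determinant.\<close>

lemma wronsk_scale:
  assumes U: "open U" "w \<in> U" "g holomorphic_on U" "\<And>i. i < r \<Longrightarrow> x i holomorphic_on U"
  shows "wronsk r (\<lambda>i v. g v * x i v) w = g w ^ r * wronsk r x w"
proof -
  let ?T = "Matrix.mat r r (\<lambda>(s, j). if s \<le> j then of_nat (j choose s) * (deriv ^^ (j - s)) g w else 0)"
  let ?X = "Matrix.mat r r (\<lambda>(i, j). (deriv ^^ j) (x i) w)"
  have "wronsk r (\<lambda>i v. g v * x i v) w = Determinant.det (?X * ?T)"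
    unfolding wronsk_def
  proof (intro arg_cong[of _ _ Determinant.det] eq_matI)
    fix i j assume "i < dim_row (?X * ?T)" "j < dim_col (?X * ?T)"
    then have ij: "i < r" "j < r" by auto
    have "(deriv ^^ j) (\<lambda>v. x i v * g v) w =
        (\<Sum>s = 0..j. of_nat (j choose s) * (deriv ^^ s) (x i) w * (deriv ^^ (j - s)) g w)"
      by (rule higher_deriv_mult[of _ U]) (use U ij in auto)
    also have "\<dots> = (\<Sum>s = 0..<r. (deriv ^^ s) (x i) w *
        (if s \<le> j then of_nat (j choose s) * (deriv ^^ (j - s)) g w else 0))"
      by (rule sum.mono_neutral_cong_left) (use ij in auto)
    finally show "Matrix.mat r r (\<lambda>(i, j). (deriv ^^ j) (\<lambda>v. g v * x i v) w) $$ (i, j)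
        = (?X * ?T) $$ (i, j)"
      using ij by (simp add: scalar_prod_def mult.commute)
  qed auto
  also have "\<dots> = wronsk r x w * Determinant.det ?T"
    unfolding wronsk_def by (rule det_mult[of _ r]) auto
  also have "Determinant.det ?T = prod_list (diag_mat ?T)"
    by (rule det_upper_triangular[of _ r]) (auto simp: upper_triangular_def)
  also have "diag_mat ?T = map (\<lambda>_. g w) [0..<r]"
    by (auto simp: diag_mat_def)
  also have "prod_list (map (\<lambda>_. g w) [0..<r]) = g w ^ r"
    by (simp add: map_replicate_const)
  finally show ?thesis by (simp add: mult.commute)
qed

lemma wronsk_Suc_one:
  "wronsk (Suc r) (\<lambda>i. case i of 0 \<Rightarrow> (\<lambda>_. 1) | Suc i \<Rightarrow> z i) w = wronsk r (\<lambda>i. deriv (z i)) w"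
proof -
  let ?M = "Matrix.mat (Suc r) (Suc r) 
    (\<lambda>(i, j). (deriv ^^ j) (case i of 0 \<Rightarrow> (\<lambda>_. 1) | Suc i \<Rightarrow> z i) w)"
  have 0: "?M $$ (0, j) = (if j = 0 then 1 else 0)" if "j < Suc r" for j
    using that by (cases j) (auto simp: funpow_Suc_right simp del: funpow.simps)
  have "Determinant.det ?M = (\<Sum>j<Suc r. ?M $$ (0, j) * cofactor ?M 0 j)"
    by (rule laplace_expansion_row) auto
  also have "\<dots> = (\<Sum>j<Suc r. if j = 0 then cofactor ?M 0 0 else 0)"
    by (intro sum.cong refl) (subst 0, auto)
  also have "\<dots> = cofactor ?M 0 0"
    by simp
  also have "\<dots> = Determinant.det (mat_delete ?M 0 0)"
    by (simp add: cofactor_def)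
  also have "mat_delete ?M 0 0 = Matrix.mat r r (\<lambda>(i, j). (deriv ^^ j) (deriv (z i)) w)"
    by (intro eq_matI) (auto simp: mat_delete_def funpow_Suc_right simp del: funpow.simps)
  finally show ?thesis unfolding wronsk_def .
qed

text \<open>Reduction of order. Near a point where \<open>x 0\<close> does not vanish, dividing by
  it turns the first function into \<open>1\<close>, and \<open>wronsk_Suc_one\<close> leaves the
  Wronskian of the \<open>r\<close> derivatives of the quotients. These are independent, since a
  relation among them integrates to one among the \<open>x i\<close>, which the identity theorem
  extends to \<open>U\<close>.\<close>

lemma wronsk_nonzero:
  assumes "open U" "connected U" "U \<noteq> {}" "\<And>i. i < r \<Longrightarrow> x i holomorphic_on U"
    and "\<And>q. (\<And>w. w \<in> U \<Longrightarrow> (\<Sum>i<r. q i * x i w) = 0) \<Longrightarrow> \<forall>i<r. q i = 0"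
  shows "\<exists>w\<in>U. wronsk r x w \<noteq> 0"
  using assms
proof (induction r arbitrary: U x)
  case 0
  then show ?case by (auto simp: wronsk_def)
next
  case (Suc r)
  have "\<exists>w0\<in>U. x 0 w0 \<noteq> 0"
  proof (rule ccontr)
    assume "\<not> ?thesis"
    then have "\<And>w. w \<in> U \<Longrightarrow> (\<Sum>i<Suc r. (if i = 0 then 1 else 0) * x i w) = 0"
      by (auto simp: if_distrib if_distribR cong: if_cong)
    from Suc.prems(5)[OF this] show False by auto
  qed
  then obtain w0 where w0: "w0 \<in> U" "x 0 w0 \<noteq> 0" by blast
  have "continuous_on U (x 0)"
    using Suc.prems(4)[of 0] holomorphic_on_imp_continuous_on by blast
  then have "open (U \<inter> x 0 -` (- {0}))"
    using Suc.prems(1) by (intro continuous_open_preimage) auto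
  then obtain d where d: "d > 0" "ball w0 d \<subseteq> U \<inter> x 0 -` (- {0})"
    using w0 openE[of "U \<inter> x 0 -` (- {0})" w0] by blast
  define V where "V = ball w0 d"
  have V: "open V" "connected V" "V \<noteq> {}" "convex V" "V \<subseteq> U" "\<And>w. w \<in> V \<Longrightarrow> x 0 w \<noteq> 0" "w0 \<in> V"
    using d by (auto simp: V_def)
  define z where "z i w = x (Suc i) w / x 0 w" for i w
  have holx: "x i holomorphic_on V" if "i < Suc r" for i
    using Suc.prems(4)[OF that] V(5) holomorphic_on_subset by blast
  have holz: "z i holomorphic_on V" if "i < r" for i
    unfolding z_def[abs_def] using V that by (intro holomorphic_intros holx) auto
  have "\<exists>w\<in>V. wronsk r (\<lambda>i. deriv (z i)) w \<noteq> 0"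
  proof (rule Suc.IH)
    show "deriv (z i) holomorphic_on V" if "i < r" for i
      using holz[OF that] V(1) by (rule holomorphic_deriv)
    fix q assume q: "\<And>w. w \<in> V \<Longrightarrow> (\<Sum>i<r. q i * deriv (z i) w) = 0"
    have "\<exists>c. \<forall>w\<in>V. (\<Sum>i<r. q i * z i w) = c"
    proof (rule has_field_derivative_zero_constant[OF V(4)])
      fix w assume w: "w \<in> V"
      have "((\<lambda>w. \<Sum>i<r. q i * z i w) has_field_derivative (\<Sum>i<r. q i * deriv (z i) w)) (at w)"
        using holz w V(1) by (intro derivative_intros DERIV_cmult) (auto intro: holomorphic_derivI)
      then show "((\<lambda>w. \<Sum>i<r. q i * z i w) has_field_derivative 0) (at w within V)"
        using q[OF w] has_field_derivative_at_within by auto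
    qed
    then obtain c where c: "\<And>w. w \<in> V \<Longrightarrow> (\<Sum>i<r. q i * z i w) = c" by blast
    \<comment> \<open>The constant of integration becomes the coefficient of
      \<open>x 0\<close>.\<close>
    define q' where "q' i = (case i of 0 \<Rightarrow> - c | Suc i \<Rightarrow> q i)" for i
    have rel: "(\<Sum>i<Suc r. q' i * x i w) = 0" if "w \<in> V" for w
    proof -
      have "(\<Sum>i<Suc r. q' i * x i w) = - c * x 0 w + (\<Sum>i<r. q i * x (Suc i) w)"
        by (subst sum.lessThan_Suc_shift) (simp add: q'_def)
      also have "(\<Sum>i<r. q i * x (Suc i) w) = (\<Sum>i<r. q i * z i w) * x 0 w"
        unfolding sum_distrib_right z_def using V(6)[OF that] by (intro sum.cong) auto
      finally show ?thesis using c[OF that] by simp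
    qed
    have "(\<Sum>i<Suc r. q' i * x i w) = 0" if w: "w \<in> U" for w
      by (rule analytic_continuation_open[of V U "\<lambda>w. \<Sum>i<Suc r. q' i * x i w" "\<lambda>_. 0"])
        (use V Suc.prems rel w in \<open>auto intro!: holomorphic_intros simp del: sum.lessThan_Suc\<close>)
    from Suc.prems(5)[OF this] have *: "q' i = 0" if "i < Suc r" for i using that by blast
    show "\<forall>i<r. q i = 0"
    proof (intro allI impI)
      fix i assume "i < r"
      then show "q i = 0" using *[of "Suc i"] by (simp add: q'_def)
    qed
  qed (use V in auto)
  then obtain w where w: "w \<in> V" "wronsk r (\<lambda>i. deriv (z i)) w \<noteq> 0" by blast
  let ?y = "\<lambda>i. case i of 0 \<Rightarrow> (\<lambda>_. 1) | Suc i \<Rightarrow> z i"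
  have "wronsk (Suc r) x w = wronsk (Suc r) (\<lambda>i v. x 0 v * ?y i v) w"
    by (rule wronsk_cong[of V]) (use V w in \<open>auto simp: z_def split: nat.split\<close>)
  also have "\<dots> = x 0 w ^ Suc r * wronsk (Suc r) ?y w"
    by (rule wronsk_scale[of V]) (use V w holx holz in \<open>auto split: nat.split\<close>)
  also have "\<dots> \<noteq> 0"
    unfolding wronsk_Suc_one using V w by auto
  finally show ?case using w V by blast
qed

section \<open>Holomorphic functions\<close>

text \<open>A disc of radius \<open>R / 4\<close> around a point of the half ball stays inside the
  ball, so Cauchy's inequality bounds the derivative by \<open>4 * M / R\<close>; the half ball is
  convex.\<close>

lemma holomorphic_bounded_lipschitz:
  assumes f: "f holomorphic_on ball c R" "\<And>w. w \<in> ball c R \<Longrightarrow> norm (f w) \<le> M"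
    and R: "R > 0" and zw: "z \<in> cball c (R / 2)" "w \<in> cball c (R / 2)"
  shows "norm (f w - f z) \<le> 4 * M / R * norm (w - z)"
proof (rule field_differentiable_bound[of "cball c (R / 2)" f "deriv f"])
  fix v assume v: "v \<in> cball c (R / 2)"
  have sub: "cball v (R / 4) \<subseteq> ball c R"
  proof
    fix u assume "u \<in> cball v (R / 4)"
    with v R show "u \<in> ball c R" using dist_triangle[of c u v] by auto
  qed
  then have "v \<in> ball c R" using R centre_in_cball[of v "R / 4"] by (meson divide_nonneg_pos less_imp_le subsetD zero_less_numeral)
  then show "(f has_field_derivative deriv f v) (at v within cball c (R / 2))"
    using f(1) by (auto intro: holomorphic_derivI has_field_derivative_at_within)
  have "norm ((deriv ^^ 1) f v) \<le> fact 1 * M / (R / 4) ^ 1"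
  proof (rule Cauchy_inequality)
    show "f holomorphic_on ball v (R / 4)" "continuous_on (cball v (R / 4)) f"
      using sub ball_subset_cball f(1) holomorphic_on_imp_continuous_on holomorphic_on_subset
      by blast+
    fix x assume "norm (v - x) = R / 4"
    then show "norm (f x) \<le> M" using sub by (intro f) (auto simp: dist_norm)
  qed (use R in auto)
  then show "norm (deriv f v) \<le> 4 * M / R" by (simp add: field_simps)
qed (use zw in auto)

text \<open>A quantitative form of the fact that derivatives of order at most \<open>k\<close> of an
  \<open>m\<close>-th power retain the factor to the power \<open>m - k\<close>. The constant
  depends neither on \<open>f\<close> nor on \<open>c\<close>. The circle in Cauchy's inequality has
  radius proportional to \<open>norm (f c)\<close>, so that \<open>f\<close> is at most three times
  as large on it.\<close>

lemma norm_higher_deriv_power_le: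
  fixes f :: "complex \<Rightarrow> complex"
  assumes f: "f holomorphic_on ball c 1" "\<And>w. w \<in> ball c 1 \<Longrightarrow> norm (f w) \<le> 2"
    and jk: "j \<le> k" "k < m"
  shows "norm ((deriv ^^ j) (\<lambda>w. f w ^ m) c) \<le> fact k * 3 ^ m * 8 ^ k * norm (f c) ^ (m - k)"
proof -
  \<comment> \<open>Here \<open>8\<close> is the Lipschitz constant \<open>4 * 2 / 1\<close> on the
    half ball of a function bounded by \<open>2\<close> on the unit ball, whence also the
    restriction on \<open>\<rho>\<close>.\<close>
  have est: "norm ((deriv ^^ j) (\<lambda>w. f w ^ m) c) \<le> fact j * (norm (f c) + 8 * \<rho>) ^ m / \<rho> ^ j"
    if \<rho>: "0 < \<rho>" "\<rho> \<le> 1 / 2" for \<rho>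
  proof (rule Cauchy_inequality)
    have sub: "cball c \<rho> \<subseteq> ball c 1" using \<rho> by auto
    then show "(\<lambda>w. f w ^ m) holomorphic_on ball c \<rho>" 
      using holomorphic_on_subset[OF f(1), of "ball c \<rho>"] ball_subset_cball[of c \<rho>]
      by (intro holomorphic_intros) blast
    have "continuous_on (cball c \<rho>) f"
      using sub f(1) holomorphic_on_imp_continuous_on holomorphic_on_subset by blast
    then show "continuous_on (cball c \<rho>) (\<lambda>w. f w ^ m)"
      by (intro continuous_intros)
    fix x assume x: "norm (c - x) = \<rho>"
    then have "norm (f x - f c) \<le> 4 * 2 / 1 * norm (x - c)"
      using \<rho> by (intro holomorphic_bounded_lipschitz[of f c 1 2]) (auto intro: f simp: dist_norm)
    then have "norm (f x) \<le> norm (f c) + 8 * \<rho>"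
      using x norm_triangle_ineq2[of "f x" "f c"] by (simp add: norm_minus_commute)
    then show "norm (f x ^ m) \<le> (norm (f c) + 8 * \<rho>) ^ m"
      by (simp add: norm_power power_mono)
  qed (use \<rho> in auto)
  show ?thesis
  proof (cases "f c = 0")
    case False
    define t where "t = norm (f c)"
    have t: "0 < t" "t \<le> 2" using False f(2)[of c] by (auto simp: t_def)
    \<comment> \<open>The radius \<open>t / 4\<close> is admissible since \<open>t \<le> 2\<close>.
      The surplus power \<open>t ^ (k - j)\<close> is absorbed below as \<open>2 ^ k\<close>, which
      turns \<open>4 ^ k\<close> into \<open>8 ^ k\<close>.\<close>
    have "norm ((deriv ^^ j) (\<lambda>w. f w ^ m) c) \<le> fact j * (t + 8 * (t / 4)) ^ m / (t / 4) ^ j"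
      using est[of "t / 4"] t by (simp add: t_def)
    also have "\<dots> = fact j * 3 ^ m * 4 ^ j * (t ^ m / t ^ j)"
    proof -
      have "t + 8 * (t / 4) = 3 * t" by simp
      then show ?thesis by (simp add: power_divide power_mult_distrib)
    qed
    also have "t ^ m / t ^ j = t ^ (m - k) * t ^ (k - j)"
      using jk t by (simp add: power_diff[symmetric] power_add[symmetric])
    also have "fact j * 3 ^ m * 4 ^ j * (t ^ (m - k) * t ^ (k - j))
        \<le> fact k * 3 ^ m * 4 ^ k * (t ^ (m - k) * 2 ^ k)"
    proof (intro mult_mono)
      have "t ^ (k - j) \<le> 2 ^ (k - j)" using t by (intro power_mono) auto
      also have "\<dots> \<le> 2 ^ k" by (intro power_increasing) auto
      finally show "t ^ (k - j) \<le> 2 ^ k" .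
    qed (use jk t in \<open>auto intro: fact_mono power_increasing\<close>)
    also have "\<dots> = fact k * 3 ^ m * (4 ^ k * 2 ^ k) * t ^ (m - k)" by simp
    also have "(4 :: real) ^ k * 2 ^ k = 8 ^ k" by (simp add: power_mult_distrib[symmetric])
    finally show ?thesis by (simp add: t_def)
  next
    case True
    \<comment> \<open>At a zero of \<open>f\<close> there is no natural radius; since
      \<open>j < m\<close>, the estimate is at most \<open>K * \<rho>\<close> and
      \<open>\<rho>\<close> may tend to \<open>0\<close>.\<close>
    have "norm ((deriv ^^ j) (\<lambda>w. f w ^ m) c) \<le> 0 + e" if "e > 0" for e
    proof -
      define K :: real where "K = fact j * 8 ^ m"
      have K: "K > 0" by (simp add: K_def)
      define \<rho> where "\<rho> = min (1 / 2) (e / K)"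
      have \<rho>: "0 < \<rho>" using K that by (simp add: \<rho>_def)
      have \<rho>1: "\<rho> \<le> 1 / 2" unfolding \<rho>_def by (rule min.cobounded1)
      have \<rho>2: "\<rho> \<le> e / K" unfolding \<rho>_def by (rule min.cobounded2)
      have "norm ((deriv ^^ j) (\<lambda>w. f w ^ m) c) \<le> K * (\<rho> ^ m / \<rho> ^ j)"
        using est[OF \<rho> \<rho>1] True by (simp add: K_def power_mult_distrib)
      also have "\<rho> ^ m / \<rho> ^ j = \<rho> ^ (m - j)"
        using \<rho> jk by (simp add: power_diff)
      also have "\<rho> ^ (m - j) \<le> \<rho> ^ 1"
        using \<rho> \<rho>1 jk by (intro power_decreasing) auto
      finally have "norm ((deriv ^^ j) (\<lambda>w. f w ^ m) c) \<le> K * \<rho>" using K by simp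
      also have "\<dots> \<le> e" using \<rho>2 K by (simp add: field_simps)
      finally show ?thesis by simp
    qed
    then have "norm ((deriv ^^ j) (\<lambda>w. f w ^ m) c) \<le> 0" by (rule field_le_epsilon)
    then show ?thesis using True jk by simp
  qed
qed

text \<open>Liouville's theorem for quotients of locally defined holomorphic functions: the bound makes
  the zeros of the denominators removable.\<close>

lemma bounded_quotient_constant:
  fixes h :: "complex \<Rightarrow> complex"
  assumes hol: "\<And>c. a c holomorphic_on ball c 1" "\<And>c. b c holomorphic_on ball c 1"
    and nz: "\<And>c. \<exists>w\<in>ball c 1. b c w \<noteq> 0"
    and bd: "\<And>c w. w \<in> ball c 1 \<Longrightarrow> norm (a c w) \<le> C * norm (b c w)"
    and h: "\<And>c w. w \<in> ball c 1 \<Longrightarrow> b c w \<noteq> 0 \<Longrightarrow> h w = a c w / b c w"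
  shows "\<exists>K. \<forall>c. \<forall>w\<in>ball c 1. a c w = K * b c w"
proof -
  have loc: "\<exists>e r. 0 < r \<and> r \<le> 1 \<and> e holomorphic_on ball c r \<and>
      (\<forall>w\<in>ball c r - {c}. b c w \<noteq> 0 \<and> e w = h w)" for c
  proof -
    have "\<exists>r>0. \<forall>w\<in>ball c r - {c}. b c w \<noteq> 0"
    proof (cases "b c c = 0")
      case True
      obtain v where v: "v \<in> ball c 1" "b c v \<noteq> 0" using nz by blast
      have "c \<in> ball c 1" by simp
      from isolated_zeros[OF hol(2) open_ball connected_ball this True v]
      obtain r where "0 < r" "\<And>z. z \<in> ball c r - {c} \<Longrightarrow> b c z \<noteq> 0" by metis
      then show ?thesis by blast
    next
      case False
      have "continuous_on (ball c 1) (b c)" using hol(2) holomorphic_on_imp_continuous_on by blast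
      then have "open (ball c 1 \<inter> b c -` (- {0}))" by (intro continuous_open_preimage) auto
      then obtain r where "r > 0" "ball c r \<subseteq> ball c 1 \<inter> b c -` (- {0})"
        using openE[of "ball c 1 \<inter> b c -` (- {0})" c] False by auto
      then show ?thesis by (intro exI[of _ r]) auto
    qed
    then obtain r0 where r0: "r0 > 0" "\<And>w. w \<in> ball c r0 - {c} \<Longrightarrow> b c w \<noteq> 0" by blast
    define r where "r = min r0 1"
    have r: "0 < r" "r \<le> 1" "\<And>w. w \<in> ball c r - {c} \<Longrightarrow> b c w \<noteq> 0"
      using r0 by (auto simp: r_def)
    have sub: "ball c r \<subseteq> ball c 1" using r by (simp add: subset_ball)
    have hh: "h w = a c w / b c w" if "w \<in> ball c r - {c}" for w
      using that sub r by (intro h) auto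
    have holq: "(\<lambda>w. a c w / b c w) holomorphic_on ball c r - {c}"
      using sub r(3) by (intro holomorphic_intros holomorphic_on_subset[OF hol(1)]
        holomorphic_on_subset[OF hol(2)]) auto
    have "\<exists>e. e holomorphic_on ball c r \<and> (\<forall>z\<in>ball c r - {c}. e z = h z)"
    proof (rule iffD2[OF holomorphic_on_extend_bounded[of h "ball c r" c]])
      show "h holomorphic_on ball c r - {c}"
        by (rule holomorphic_transform[OF holq]) (use hh in auto)
      have "norm (h z) \<le> C" if "z \<in> ball c r - {c}" for z
        using that hh[OF that] bd[of z c] r(3)[OF that] sub
        by (auto simp: norm_divide divide_le_eq)
      then have "eventually (\<lambda>z. norm (h z) \<le> C) (at c)"
        unfolding eventually_at using r(1) by (intro exI[of _ r]) (auto simp: dist_commute)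
      then show "\<exists>B. \<forall>\<^sub>F z in at c. norm (h z) \<le> B" by blast
    qed (use r in auto)
    then show ?thesis using r by blast
  qed
  then obtain e r where er: "\<And>c. 0 < r c" "\<And>c. r c \<le> 1" "\<And>c. e c holomorphic_on ball c (r c)"
    "\<And>c w. w \<in> ball c (r c) - {c} \<Longrightarrow> b c w \<noteq> 0 \<and> e c w = h w"
    by metis
  \<comment> \<open>Each local extension is read off only at its own centre. That this agrees with
    the neighbouring extensions (\<open>ge\<close>) holds because two of them coincide with
    \<open>h\<close> on a punctured neighbourhood of \<open>w\<close> and are continuous
    there.\<close>
  define g where "g w = e w w" for w
  have ge: "g w = e c w" if w: "w \<in> ball c (r c)" for c w
  proof (cases "w = c")
    case False
    have bw: "b c w \<noteq> 0" using er(4) w False by blast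
    have w1: "w \<in> ball c 1" using w er(2)[of c] by auto
    have op: "open (ball c (r c) \<inter> ball w (r w) - {c})" by (intro open_Diff open_Int) auto
    have win: "w \<in> ball c (r c) \<inter> ball w (r w) - {c}" using w False er(1) by auto
    have lim1: "(e w \<longlongrightarrow> e w w) (at w)"
      using er(3)[of w] er(1)[of w] by (metis holomorphic_on_imp_continuous_on centre_in_ball
        continuous_on_eq_continuous_at open_ball isCont_def)
    have lim2: "(e c \<longlongrightarrow> e c w) (at w)"
      using er(3)[of c] w by (metis holomorphic_on_imp_continuous_on
        continuous_on_eq_continuous_at open_ball isCont_def)
    have "eventually (\<lambda>z. e w z = e c z) (at w)"
    proof -
      have "eventually (\<lambda>z. z \<in> ball c (r c) \<inter> ball w (r w) - {c}) (at w)"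
        using op win by (rule eventually_at_in_open')
      moreover have "eventually (\<lambda>z. z \<noteq> w) (at w)" by (simp add: eventually_at_filter)
      ultimately show ?thesis
        by eventually_elim (use er(4) in \<open>metis DiffI DiffD1 DiffD2 IntD1 IntD2 singletonD\<close>)
    qed
    then have "(e c \<longlongrightarrow> e w w) (at w)" using lim1 by (simp cong: tendsto_cong)
    then show ?thesis using lim2 unfolding g_def
      by (metis LIM_unique)
  qed (simp add: g_def)
  have g_ab: "a c w = g w * b c w" if w: "w \<in> ball c 1" for c w
  proof (cases "b c w = 0")
    case True
    then show ?thesis using bd[OF w] by simp
  next
    case False
    have cont: "isCont (a c) w" "isCont (b c) w"
      using hol w by (metis holomorphic_on_imp_continuous_on continuous_on_eq_continuous_at open_ball)+
    have op: "open (ball c 1 \<inter> ball w (r w))" by auto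
    have "eventually (\<lambda>z. z \<in> ball c 1 \<inter> ball w (r w)) (at w)"
      using op by (rule eventually_at_in_open') (use w er(1) in auto)
    moreover have "eventually (\<lambda>z. z \<noteq> w) (at w)" by (simp add: eventually_at_filter)
    moreover have "eventually (\<lambda>z. b c z \<noteq> 0) (at w)"
      using cont(2) False by (metis isCont_def tendsto_imp_eventually_ne)
    ultimately have "eventually (\<lambda>z. e w z * b c z = a c z) (at w)"
      by eventually_elim (use er(4)[of _ w] h[of _ c] in auto)
    moreover have "((\<lambda>z. e w z * b c z) \<longlongrightarrow> e w w * b c w) (at w)"
      using cont(2) er(3)[of w] er(1)[of w]
      by (intro tendsto_mult) (metis holomorphic_on_imp_continuous_on centre_in_ball
        continuous_on_eq_continuous_at open_ball isCont_def, simp add: isCont_def)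
    ultimately have "(a c \<longlongrightarrow> e w w * b c w) (at w)" by (simp cong: tendsto_cong)
    then show ?thesis using cont(1) unfolding isCont_def g_def
      by (metis LIM_unique)
  qed
  have "g holomorphic_on UNIV"
    unfolding holomorphic_on_def
  proof safe
    fix c :: complex
    have "e c field_differentiable at c"
      using er(3)[of c] er(1)[of c] by (meson centre_in_ball holomorphic_on_imp_differentiable_at open_ball)
    moreover have "eventually (\<lambda>w. e c w = g w) (nhds c)"
      using ge[of _ c] er(1)[of c] by (auto simp: eventually_nhds intro!: exI[of _ "ball c (r c)"])
    ultimately show "g field_differentiable at c"
      using DERIV_cong_ev[OF refl _ refl] unfolding field_differentiable_def by blast
  qed
  moreover have "bounded (range g)"
  proof -
    have "norm (g c) \<le> C" for c
    proof -
      have "norm (e c w) \<le> C" if "w \<in> ball c (r c) - {c}" for w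
      proof -
        have w: "w \<in> ball c 1" using that er(2)[of c] by auto
        have bw: "b c w \<noteq> 0" "e c w = h w" using er(4)[OF that] by blast+
        have "norm (e c w) = norm (a c w) / norm (b c w)"
          unfolding bw(2) h[OF w bw(1)] by (rule norm_divide)
        then show ?thesis using bd[OF w] bw(1) by (simp add: pos_divide_le_eq)
      qed
      then have "eventually (\<lambda>w. norm (e c w) \<le> C) (at c)"
        unfolding eventually_at using er(1)[of c] by (intro exI[of _ "r c"]) (auto simp: dist_commute)
      moreover have "((\<lambda>w. norm (e c w)) \<longlongrightarrow> norm (e c c)) (at c)"
        using er(3)[of c] er(1)[of c] by (metis holomorphic_on_imp_continuous_on centre_in_ball
          continuous_on_eq_continuous_at open_ball isCont_def tendsto_norm)
      ultimately show ?thesis unfolding g_def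
        by (intro tendsto_upperbound[of "\<lambda>w. norm (e c w)"]) (auto simp: trivial_limit_at)
    qed
    then show ?thesis unfolding bounded_iff by blast
  qed
  ultimately obtain K where "\<And>w. g w = K"
    using Liouville_theorem[of g] by (auto simp: constant_on_def)
  then show ?thesis using g_ab by (intro exI[of _ K]) simp
qed

section \<open>Normal families along filters\<close>

text \<open>The \<open>f n\<close> are points of a product of copies of \<open>K\<close>, compact by
  Tychonoff's theorem. As the index type may be uncountable, a cluster point \<open>g\<close> need
  not be the limit of a subsequence; the neighbourhoods of \<open>g\<close>, pulled back along
  \<open>f\<close>, give a filter that serves instead.\<close>

lemma tychonoff_filter:
  fixes f :: "nat \<Rightarrow> 'a \<Rightarrow> 'b::t2_space"
  assumes K: "compact K" and f: "\<And>n x. f n x \<in> K"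
  obtains F g where "F \<noteq> bot" "F \<le> sequentially" "\<And>x. ((\<lambda>n. f n x) \<longlongrightarrow> g x) F"
proof -
  have "compactin (product_topology (\<lambda>_::'a. euclidean :: 'b topology) UNIV) (PiE UNIV (\<lambda>_. K))"
    by (subst compactin_PiE) (use K in auto)
  then have "compact (PiE UNIV (\<lambda>_. K) :: ('a \<Rightarrow> 'b) set)"
    by (simp add: euclidean_product_topology)
  moreover have "filtermap f sequentially \<noteq> bot" by (simp add: filtermap_bot_iff)
  moreover have "eventually (\<lambda>x. x \<in> PiE UNIV (\<lambda>_. K)) (filtermap f sequentially)"
    using f by (auto simp: eventually_filtermap PiE_UNIV_domain)
  ultimately obtain g where g: "inf (nhds g) (filtermap f sequentially) \<noteq> bot"
    unfolding compact_filter by meson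
  define F where "F = inf (filtercomap f (nhds g)) sequentially"
  have "F \<noteq> bot"
  proof
    assume "F = bot"
    then have "eventually (\<lambda>_. False) F" by simp
    then obtain P Q where PQ: "eventually P (filtercomap f (nhds g))" "eventually Q sequentially"
      "\<And>n. P n \<Longrightarrow> Q n \<Longrightarrow> False"
      unfolding F_def eventually_inf by blast
    then obtain P' where P': "eventually P' (nhds g)" "\<And>n. P' (f n) \<Longrightarrow> P n"
      unfolding eventually_filtercomap by blast
    have "eventually (\<lambda>h. \<not> P' h) (filtermap f sequentially)"
      unfolding eventually_filtermap using PQ(2) by eventually_elim (use PQ(3) P'(2) in blast)
    with P'(1) have "eventually (\<lambda>_. False) (inf (nhds g) (filtermap f sequentially))"
      unfolding eventually_inf by blast
    with g show False by (simp add: trivial_limit_def)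
  qed
  moreover have "F \<le> sequentially" by (simp add: F_def)
  moreover have "((\<lambda>n. f n x) \<longlongrightarrow> g x) F" for x
  proof -
    have "filterlim f (nhds g) F"
      unfolding F_def by (rule filterlim_mono[OF filterlim_filtercomap]) auto
    show ?thesis
    proof (rule topological_tendstoI)
      fix S :: "'b set" assume S: "open S" "g x \<in> S"
      have "open ((\<lambda>h::'a \<Rightarrow> 'b. h x) -` S)"
        using S(1) continuous_on_product_coordinates[of x] by (intro open_vimage) auto
      with S(2) have "eventually (\<lambda>h. h \<in> (\<lambda>h. h x) -` S) (nhds g)"
        by (auto simp: eventually_nhds)
      then show "eventually (\<lambda>n. f n x \<in> S) F"
        using \<open>filterlim f (nhds g) F\<close> by (auto simp: filterlim_iff)
    qed
  qed
  ultimately show ?thesis using that by blast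
qed

text \<open>The common bound makes the functions equi-Lipschitz on the half ball, so convergence on
  a finite net controls all of it. The argument works along any nontrivial filter.\<close>

lemma uniform_limit_cball_of_pointwise:
  fixes f :: "'i \<Rightarrow> complex \<Rightarrow> complex"
  assumes F: "F \<noteq> bot" and R: "R > 0"
    and f: "eventually (\<lambda>n. f n holomorphic_on ball c R \<and> (\<forall>w\<in>ball c R. norm (f n w) \<le> M)) F"
    and lim: "\<And>w. w \<in> ball c R \<Longrightarrow> ((\<lambda>n. f n w) \<longlongrightarrow> g w) F"
  shows "uniform_limit (cball c (R / 2)) f g F"
proof (rule uniform_limitI)
  fix e :: real assume e: "e > 0"
  define L where "L = 4 * \<bar>M\<bar> / R"
  have L: "L \<ge> 0" using R by (simp add: L_def)
  have lip: "eventually (\<lambda>n. norm (f n w - f n z) \<le> L * norm (w - z)) F" 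
    if "z \<in> cball c (R / 2)" "w \<in> cball c (R / 2)" for w z
    using f
  proof eventually_elim
    case (elim n)
    have "norm (f n w - f n z) \<le> 4 * \<bar>M\<bar> / R * norm (w - z)"
      using elim that R by (intro holomorphic_bounded_lipschitz) force+
    then show ?case by (simp add: L_def)
  qed
  have lip': "eventually (\<lambda>n. \<forall>z\<in>cball c (R / 2). \<forall>w\<in>cball c (R / 2). 
      norm (f n w - f n z) \<le> L * norm (w - z)) F"
    using f
  proof eventually_elim
    case (elim n)
    then show ?case using R unfolding L_def
      by (intro ballI holomorphic_bounded_lipschitz) force+
  qed
  have sub: "cball c (R / 2) \<subseteq> ball c R" using R by auto
  have lipg: "norm (g w - g z) \<le> L * norm (w - z)"
    if "z \<in> cball c (R / 2)" "w \<in> cball c (R / 2)" for w z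
    using F by (intro tendsto_upperbound[OF tendsto_norm[OF tendsto_diff[OF lim lim]] lip[OF that]])
      (use that sub in auto)
  define \<delta> where "\<delta> = e / (4 * (L + 1))"
  have \<delta>: "\<delta> > 0" "L * \<delta> \<le> e / 4" using e L by (auto simp: \<delta>_def field_simps)
  obtain N where N: "finite N" "N \<subseteq> cball c (R / 2)" "cball c (R / 2) \<subseteq> (\<Union>x\<in>N. ball x \<delta>)"
    using compact_imp_seq_compact[OF compact_cball, THEN seq_compact_imp_totally_bounded,
      rule_format, OF \<delta>(1)] by metis
  have "eventually (\<lambda>n. \<forall>v\<in>N. dist (f n v) (g v) < e / 4) F"
    using N e sub by (intro eventually_ball_finite ballI tendstoD[OF lim]) auto
  with lip' show "eventually (\<lambda>n. \<forall>w\<in>cball c (R / 2). dist (f n w) (g w) < e) F"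
  proof eventually_elim
    case (elim n)
    show ?case
    proof
      fix w assume w: "w \<in> cball c (R / 2)"
      then obtain v where v: "v \<in> N" "dist v w < \<delta>" using N by auto
      then have v': "v \<in> cball c (R / 2)" using N by auto
      have 1: "norm (f n w - f n v) \<le> L * norm (w - v)" using elim w v' by blast
      have 2: "norm (g w - g v) \<le> L * norm (w - v)" using lipg w v' by blast
      have "L * norm (w - v) \<le> L * \<delta>" using v L
        by (intro mult_left_mono) (auto simp: dist_norm norm_minus_commute)
      with 1 2 \<delta>(2) have "dist (f n w) (f n v) \<le> e / 4" "dist (g v) (g w) \<le> e / 4"
        by (auto simp: dist_norm norm_minus_commute)
      moreover have "dist (f n v) (g v) < e / 4" using elim v by blast
      moreover have "dist (f n w) (g w) \<le> dist (f n w) (f n v) + dist (f n v) (g v) + dist (g v) (g w)"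
        by metric
      ultimately show "dist (f n w) (g w) < e" using e by linarith
    qed
  qed
qed

lemma holomorphic_pointwise_limit:
  fixes f :: "'i \<Rightarrow> complex \<Rightarrow> complex"
  assumes F: "F \<noteq> bot" 
    and f: "eventually (\<lambda>n. f n holomorphic_on ball c R \<and> (\<forall>w\<in>ball c R. norm (f n w) \<le> M)) F"
    and lim: "\<And>w. w \<in> ball c R \<Longrightarrow> ((\<lambda>n. f n w) \<longlongrightarrow> g w) F"
  shows "g holomorphic_on ball c R"
  unfolding holomorphic_on_open[OF open_ball]
proof
  fix z assume "z \<in> ball c R"
  then obtain r where r: "r > 0" "ball z r \<subseteq> ball c R" using openE[OF open_ball] by metis
  have f': "eventually (\<lambda>n. f n holomorphic_on ball z r \<and> (\<forall>w\<in>ball z r. norm (f n w) \<le> M)) F"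
    using f by eventually_elim (use r in \<open>auto intro: holomorphic_on_subset\<close>)
  have "uniform_limit (cball z (r / 2)) f g F"
    using r by (intro uniform_limit_cball_of_pointwise[OF F r(1) f'] lim) auto
  moreover have "eventually (\<lambda>n. continuous_on (cball z (r / 2)) (f n) \<and> f n holomorphic_on ball z (r / 2)) F"
    using f'
  proof eventually_elim
    case (elim n)
    have "cball z (r / 2) \<subseteq> ball z r" "ball z (r / 2) \<subseteq> ball z r" using r(1) by auto
    then show ?case using elim holomorphic_on_subset holomorphic_on_imp_continuous_on by blast
  qed
  ultimately have "g holomorphic_on ball z (r / 2)"
    using holomorphic_uniform_limit F by blast
  then show "\<exists>g'. (g has_field_derivative g') (at z)"
    using r(1) holomorphic_on_open[of "ball z (r / 2)" g] by auto
qed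

text \<open>Hofer's lemma. Otherwise one could iterate and find points at which \<open>P\<close> fails on ever smaller
  balls, accumulating at a point that contradicts \<open>ex\<close>.\<close>

lemma hofer_selection:
  fixes P :: "complex \<Rightarrow> real \<Rightarrow> bool"
  assumes mono: "\<And>x y r s. P x r \<Longrightarrow> 0 < s \<Longrightarrow> ball y s \<subseteq> ball x r \<Longrightarrow> P y s"
    and ex: "\<And>x. x \<in> ball 0 1 \<Longrightarrow> \<exists>r>0. P x r"
    and r0: "r0 > 0" "R > 0" "2 * R * r0 < 1" "\<not> P 0 r0"
  shows "\<exists>x r. 0 < r \<and> r \<le> r0 \<and> norm x + R * r \<le> 2 * R * r0 \<and> \<not> P x r \<and>
    (\<forall>y\<in>ball x (R * r). P y (r / 2))"
proof (rule ccontr)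
  assume found: "\<not> ?thesis"
  have neg: "\<exists>y\<in>ball x (R * r). \<not> P y (r / 2)"
    if "0 < r" "r \<le> r0" "norm x + R * r \<le> 2 * R * r0" "\<not> P x r" for x r
    using that found by blast
  \<comment> \<open>The radius is halved at each step and the \<open>n\<close>-th step is shorter
    than \<open>R * r0 / 2 ^ n\<close>; the bound on \<open>norm x\<close> is the geometric sum of
    these lengths. The \<open>True\<close> below fills the transition relation expected by
    \<open>dependent_nat_choice\<close>.\<close>
  let ?S = "\<lambda>n x. \<not> P x (r0 / 2 ^ n) \<and> norm x \<le> 2 * R * r0 * (1 - 1 / 2 ^ n)"
  have "\<exists>X. \<forall>n. ?S n (X n) \<and> True"
  proof (rule dependent_nat_choice)
    show "\<exists>x. ?S 0 x" using r0 by (intro exI[of _ 0]) auto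
    fix x n assume x: "?S n x"
    have "r0 / 2 ^ n \<le> r0" using r0(1) by (simp add: divide_le_eq)
    moreover have "norm x + R * (r0 / 2 ^ n) \<le> 2 * R * r0"
    proof -
      have "norm x + R * (r0 / 2 ^ n) \<le> 2 * R * r0 * (1 - 1 / 2 ^ n) + R * (r0 / 2 ^ n)" using x by simp
      also have "\<dots> = 2 * R * r0 - R * r0 / 2 ^ n" by (simp add: field_simps)
      also have "\<dots> \<le> 2 * R * r0" using r0 by simp
      finally show ?thesis .
    qed
    ultimately obtain y where y: "y \<in> ball x (R * (r0 / 2 ^ n))" "\<not> P y (r0 / 2 ^ n / 2)"
      using neg[of "r0 / 2 ^ n" x] x r0(1) by auto
    have "norm y \<le> norm x + dist x y" using norm_triangle_sub[of y x] by (simp add: dist_norm norm_minus_commute)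
    also have "\<dots> \<le> 2 * R * r0 * (1 - 1 / 2 ^ n) + R * (r0 / 2 ^ n)" using x y(1) by simp
    also have "\<dots> = 2 * R * r0 * (1 - 1 / 2 ^ Suc n)" by (simp add: field_simps)
    finally show "\<exists>y. ?S (Suc n) y \<and> True" using y(2) by (auto simp: mult.commute)
  qed
  then obtain X where X: "\<And>n. \<not> P (X n) (r0 / 2 ^ n)" "\<And>n. norm (X n) \<le> 2 * R * r0 * (1 - 1 / 2 ^ n)"
    by blast
  have "X n \<in> cball 0 (2 * R * r0)" for n
  proof -
    have "2 * R * r0 * (1 - 1 / 2 ^ n) \<le> 2 * R * r0 * 1" using r0 by (intro mult_left_mono) auto
    then show ?thesis using X(2)[of n] by simp
  qed
  then obtain l s where ls: "l \<in> cball 0 (2 * R * r0)" "strict_mono s" "(X \<circ> s) \<longlonglongrightarrow> l"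
    using compact_cball[of "0 :: complex" "2 * R * r0"] unfolding compact_def by metis
  obtain r where r: "r > 0" "P l r" using ex[of l] ls(1) r0 by auto
  have "eventually (\<lambda>n. dist ((X \<circ> s) n) l < r / 2) sequentially"
    using ls(3) r by (intro tendstoD half_gt_zero)
  moreover have "(\<lambda>n. r0 / 2 ^ n) \<longlonglongrightarrow> 0"
    using LIMSEQ_divide_realpow_zero[of 2 r0] by simp
  then have lim0: "((\<lambda>n. r0 / 2 ^ n) \<circ> s) \<longlonglongrightarrow> 0" using ls(2) by (rule LIMSEQ_subseq_LIMSEQ)
  have "eventually (\<lambda>n. ((\<lambda>n. r0 / 2 ^ n) \<circ> s) n < r / 2) sequentially"
    using r by (intro order_tendstoD(2)[OF lim0]) auto
  ultimately have "eventually (\<lambda>n. False) sequentially"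
  proof eventually_elim
    case (elim n)
    have "ball (X (s n)) (r0 / 2 ^ s n) \<subseteq> ball l r"
    proof
      fix u assume "u \<in> ball (X (s n)) (r0 / 2 ^ s n)"
      then have "dist (X (s n)) u < r / 2" using elim(2) unfolding o_def mem_ball by (rule less_trans)
      moreover have "dist l (X (s n)) < r / 2" using elim(1) by (simp add: dist_commute)
      ultimately show "u \<in> ball l r" using dist_triangle[of l u "X (s n)"] by simp
    qed
    then have "P (X (s n)) (r0 / 2 ^ s n)" using mono[OF r(2)] r0(1) by auto
    then show ?case using X(1) by blast
  qed
  then show False by simp
qed

section \<open>Uniform lifts of discs\<close>

text \<open>A balanced lift on the ball of radius \<open>r\<close> replaces a bound of order \<open>1 / r\<close> for the derivative
  at \<open>c\<close> in the Fubini--Study metric.\<close>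

definition has_balanced_lift :: "(complex \<Rightarrow> (complex ^ 'i::finite) set) \<Rightarrow> complex \<Rightarrow> real \<Rightarrow> bool" where
  "has_balanced_lift f c r \<longleftrightarrow> (\<exists>G. (\<forall>l. (\<lambda>w. G w $ l) holomorphic_on ball c r) \<and>
     (\<forall>w\<in>ball c r. f w = proj_pt (G w) \<and> 1 \<le> norm (G w) \<and> norm (G w) \<le> 2))"

lemma proj_pt_scale:
  fixes z :: "complex ^ 'i::finite"
  assumes "c \<noteq> 0" shows "proj_pt (c *s z) = proj_pt z"
proof (intro Set.set_eqI iffI)
  fix w assume "w \<in> proj_pt z"
  then obtain d where "w = d *s z" by (auto simp: mem_proj_pt)
  then have "w = (d / c) *s (c *s z)" using assms by simp
  then show "w \<in> proj_pt (c *s z)" unfolding mem_proj_pt by blast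
qed (auto simp: mem_proj_pt)

lemma proj_pt_eqD:
  fixes z w :: "complex ^ 'i::finite"
  assumes "proj_pt z = proj_pt w" "z \<noteq> 0"
  obtains c where "c \<noteq> 0" "z = c *s w"
proof -
  have "z \<in> proj_pt w" using assms(1) mem_proj_pt[of z z] by (metis vector_smult_lid)
  then obtain c where "z = c *s w" by (auto simp: mem_proj_pt)
  with assms(2) that show ?thesis by force
qed

lemma norm_vec_scale: "norm (c *s z) = norm c * norm z" for z :: "complex ^ 'i::finite"
  by (simp add: norm_vec_def norm_mult L2_set_left_distrib[symmetric] L2_set_right_distrib)

lemma has_balanced_lift_compose:
  assumes "has_balanced_lift f c r" "\<phi> holomorphic_on ball c' r'" "\<phi> ` ball c' r' \<subseteq> ball c r"
  shows "has_balanced_lift (\<lambda>z. f (\<phi> z)) c' r'"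
proof -
  obtain G where G: "\<And>l. (\<lambda>w. G w $ l) holomorphic_on ball c r"
    "\<And>w. w \<in> ball c r \<Longrightarrow> f w = proj_pt (G w) \<and> 1 \<le> norm (G w) \<and> norm (G w) \<le> 2"
    using assms(1) unfolding has_balanced_lift_def by blast
  have "(\<lambda>w. G (\<phi> w) $ l) holomorphic_on ball c' r'" for l
    using holomorphic_on_compose_gen[OF assms(2) G(1)[of l] assms(3)] by (simp add: o_def)
  then show ?thesis using G(2) assms(3) unfolding has_balanced_lift_def
    by (intro exI[of _ "\<lambda>w. G (\<phi> w)"]) blast
qed

lemma has_balanced_lift_mono:
  assumes "has_balanced_lift f c r" "ball c' r' \<subseteq> ball c r"
  shows "has_balanced_lift f c' r'"
  using has_balanced_lift_compose[OF assms(1), of "\<lambda>z. z" c' r'] assms(2) by auto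

lemma continuous_on_vecI:
  fixes G :: "complex \<Rightarrow> complex ^ 'i::finite"
  assumes "\<And>l. (\<lambda>w. G w $ l) holomorphic_on S"
  shows "continuous_on S G"
proof -
  have "continuous_on S (\<lambda>w. \<chi> l. G w $ l)"
    by (intro continuous_on_vec_lambda holomorphic_on_imp_continuous_on assms)
  then show ?thesis by (simp add: vec_lambda_eta)
qed

lemma proj_holomorphic_onD:
  assumes "proj_holomorphic_on f U" "t \<in> U"
  shows "\<exists>W F. open W \<and> t \<in> W \<and> W \<subseteq> U \<and> (\<forall>i. (\<lambda>w. F w $ i) holomorphic_on W) \<and>
    (\<forall>w\<in>W. F w \<noteq> 0 \<and> f w = proj_pt (F w))"
  using assms(2) by (rule bspec[OF assms(1)[unfolded proj_holomorphic_on_def]])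

lemma proj_holomorphic_on_imp_has_balanced_lift:
  assumes "proj_holomorphic_on f U" "t \<in> U"
  shows "\<exists>r>0. has_balanced_lift f t r"
proof -
  from proj_holomorphic_onD[OF assms] obtain W F where
    WF: "open W \<and> t \<in> W \<and> W \<subseteq> U \<and> (\<forall>i. (\<lambda>w. F w $ i) holomorphic_on W) \<and>
      (\<forall>w\<in>W. F w \<noteq> 0 \<and> f w = proj_pt (F w))"
    by (elim exE)
  then have W: "open W" "t \<in> W" "W \<subseteq> U" "\<And>i. (\<lambda>w. F w $ i) holomorphic_on W"
    "\<And>w. w \<in> W \<Longrightarrow> F w \<noteq> 0 \<and> f w = proj_pt (F w)"
    by simp_all
  \<comment> \<open>The lift is scaled to norm \<open>3 / 2\<close> at \<open>t\<close>, strictly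
    between \<open>1\<close> and \<open>2\<close>, so that continuity keeps it there nearby.\<close>
  define a where "a = 3 / (2 * norm (F t))"
  have a: "a > 0" "a * norm (F t) = 3 / 2" using W(2,5) by (auto simp: a_def)
  have "continuous_on W (\<lambda>w. a * norm (F w))"
    by (intro continuous_on_mult continuous_on_const continuous_on_norm continuous_on_vecI[OF W(4)])
  then have "open (W \<inter> (\<lambda>w. a * norm (F w)) -` {1<..<2})"
    using W(1) by (intro continuous_open_preimage) auto
  moreover have "t \<in> W \<inter> (\<lambda>w. a * norm (F w)) -` {1<..<2}" using W a by auto
  ultimately obtain r where r: "r > 0" "ball t r \<subseteq> W \<inter> (\<lambda>w. a * norm (F w)) -` {1<..<2}"
    using openE by metis
  have "has_balanced_lift f t r"
    unfolding has_balanced_lift_def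
  proof (intro exI conjI allI ballI)
    fix l
    have "(\<lambda>w. F w $ l) holomorphic_on ball t r" using r by (intro holomorphic_on_subset[OF W(4)]) auto
    then show "(\<lambda>w. (complex_of_real a *s F w) $ l) holomorphic_on ball t r"
      by (auto intro!: holomorphic_intros)
  next
    fix w assume "w \<in> ball t r"
    then have w: "w \<in> W" "1 < a * norm (F w)" "a * norm (F w) < 2" using r by auto
    show "f w = proj_pt (complex_of_real a *s F w)"
      using W(5)[OF w(1)] a by (subst proj_pt_scale) auto
    show "1 \<le> norm (complex_of_real a *s F w)" "norm (complex_of_real a *s F w) \<le> 2"
      using w a by (auto simp: norm_vec_scale)
  qed
  with r show ?thesis by blast
qed

lemma proj_holomorphic_on_compose:
  assumes "proj_holomorphic_on f U" "\<phi> holomorphic_on V" "open V" "\<phi> ` V \<subseteq> U"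
  shows "proj_holomorphic_on (\<lambda>z. f (\<phi> z)) V"
  unfolding proj_holomorphic_on_def
proof
  fix z assume z: "z \<in> V"
  then have "\<phi> z \<in> U" using assms(4) by blast
  from proj_holomorphic_onD[OF assms(1) this] obtain W F where
    WF: "open W \<and> \<phi> z \<in> W \<and> W \<subseteq> U \<and> (\<forall>i. (\<lambda>w. F w $ i) holomorphic_on W) \<and>
      (\<forall>w\<in>W. F w \<noteq> 0 \<and> f w = proj_pt (F w))"
    by (elim exE)
  then have W: "open W" "\<phi> z \<in> W" "W \<subseteq> U" "\<And>i. (\<lambda>w. F w $ i) holomorphic_on W"
    "\<And>w. w \<in> W \<Longrightarrow> F w \<noteq> 0 \<and> f w = proj_pt (F w)"
    by simp_all
  have "open (V \<inter> \<phi> -` W)" 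
    using assms(2,3) W(1) by (intro continuous_open_preimage holomorphic_on_imp_continuous_on)
  moreover have "(\<lambda>w. F (\<phi> w) $ i) holomorphic_on V \<inter> \<phi> -` W" for i
    using holomorphic_on_compose_gen[OF holomorphic_on_subset[OF assms(2)] W(4)[of i], of "V \<inter> \<phi> -` W"]
    by (auto simp: o_def)
  ultimately show "\<exists>W F. open W \<and> z \<in> W \<and> W \<subseteq> V \<and> (\<forall>i. (\<lambda>w. F w $ i) holomorphic_on W) \<and>
      (\<forall>w\<in>W. F w \<noteq> 0 \<and> f (\<phi> w) = proj_pt (F w))"
    using z W(2,5)
    by (intro exI[of _ "V \<inter> \<phi> -` W"] exI[of _ "\<lambda>w. F (\<phi> w)"] conjI allI ballI) simp_all
qed

subsection \<open>A metric on projective space\<close>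

text \<open>Lines are separated by the orthogonal projections onto them.\<close>

definition proj_entry :: "complex ^ 'i::finite \<Rightarrow> 'i \<Rightarrow> 'i \<Rightarrow> complex" where
  "proj_entry z a b = z $ a * cnj (z $ b) / of_real ((norm z)\<^sup>2)"

definition proj_dist :: "complex ^ 'i::finite \<Rightarrow> complex ^ 'i \<Rightarrow> real" where
  "proj_dist z w = (\<Sum>a\<in>UNIV. \<Sum>b\<in>UNIV. cmod (proj_entry z a b - proj_entry w a b))"

lemma proj_entry_scale: "c \<noteq> 0 \<Longrightarrow> proj_entry (c *s z) a b = proj_entry z a b"
proof -
  assume c: "c \<noteq> 0"
  have "complex_of_real ((norm (c *s z))\<^sup>2) = c * cnj c * of_real ((norm z)\<^sup>2)"
    by (simp add: norm_vec_scale power_mult_distrib complex_norm_square[symmetric])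
  then show ?thesis using c by (simp add: proj_entry_def)
qed

lemma proj_entry_cong:
  assumes "proj_pt z = proj_pt w" "z \<noteq> 0"
  shows "proj_entry z = proj_entry w"
proof -
  obtain c where "c \<noteq> 0" "z = c *s w" using assms by (rule proj_pt_eqD)
  then show ?thesis by (intro ext) (simp add: proj_entry_scale)
qed

lemma proj_dist_triangle: "proj_dist z v \<le> proj_dist z w + proj_dist w v"
  unfolding proj_dist_def sum.distrib[symmetric]
  unfolding dist_norm[symmetric] by (intro sum_mono dist_triangle)

lemma proj_dist_pos:
  assumes "z \<noteq> 0" "w \<noteq> 0" "proj_pt z \<noteq> proj_pt w"
  shows "proj_dist z w > 0"
proof (rule ccontr)
  assume "\<not> ?thesis"
  then have "proj_dist z w = 0" unfolding proj_dist_def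
    by (meson linorder_neqE_linordered_idom not_less sum_nonneg norm_ge_zero order_antisym)
  then have eq: "proj_entry z a b = proj_entry w a b" for a b
    unfolding proj_dist_def by (subst (asm) sum_nonneg_eq_0_iff, auto intro: sum_nonneg)
      (subst (asm) sum_nonneg_eq_0_iff, auto)
  obtain b where b: "z $ b \<noteq> 0" using assms(1) by (auto simp: Finite_Cartesian_Product.vec_eq_iff)
  \<comment> \<open>Equality of the entries in column \<open>b\<close>, solved for
    \<open>z $ a\<close>, exhibits this multiple of \<open>w\<close>.\<close>
  define s where "s = of_real ((norm z)\<^sup>2) / cnj (z $ b) * (cnj (w $ b) / of_real ((norm w)\<^sup>2))"
  have "z = s *s w"
  proof (subst Finite_Cartesian_Product.vec_eq_iff, rule allI)
    fix a show "z $ a = (s *s w) $ a"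
      using arg_cong[OF eq[of a b], of "\<lambda>x. x * of_real ((norm z)\<^sup>2) / cnj (z $ b)"] b assms(1)
      by (simp add: proj_entry_def s_def mult_ac)
  qed
  moreover have "s \<noteq> 0" using calculation assms(1) by auto
  ultimately show False using assms(3) proj_pt_scale by metis
qed

lemma norm_normalize_diff:
  fixes z w :: "'a::real_normed_vector"
  assumes "1 \<le> norm z" "1 \<le> norm w"
  shows "norm (z /\<^sub>R norm z - w /\<^sub>R norm w) \<le> 2 * norm (z - w)"
proof -
  have nz: "norm z \<noteq> 0" "norm w \<noteq> 0" using assms by auto
  have "z /\<^sub>R norm z - w /\<^sub>R norm w = (z - w) /\<^sub>R norm z + (inverse (norm z) - inverse (norm w)) *\<^sub>R w"
    by (simp add: algebra_simps)
  then have "norm (z /\<^sub>R norm z - w /\<^sub>R norm w) \<le>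
      norm ((z - w) /\<^sub>R norm z) + norm ((inverse (norm z) - inverse (norm w)) *\<^sub>R w)"
    by (metis norm_triangle_ineq)
  also have "norm ((inverse (norm z) - inverse (norm w)) *\<^sub>R w) = \<bar>norm w - norm z\<bar> / norm z"
  proof -
    have "(inverse (norm z) - inverse (norm w)) * norm w = (norm w - norm z) / norm z"
      using nz by (simp add: field_simps)
    then show ?thesis by (metis abs_divide abs_mult abs_norm_cancel norm_scaleR)
  qed
  also have "\<bar>norm w - norm z\<bar> / norm z \<le> norm (z - w) / 1"
    using norm_triangle_ineq3[of w z] assms by (intro frac_le) (auto simp: norm_minus_commute)
  also have "norm ((z - w) /\<^sub>R norm z) = norm (z - w) / norm z" by (simp add: divide_inverse mult.commute)
  also have "\<dots> \<le> norm (z - w) / 1" using assms by (intro frac_le) auto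
  finally show ?thesis by simp
qed

lemma proj_dist_le:
  fixes z w :: "complex ^ 'i::finite"
  assumes "1 \<le> norm z" "1 \<le> norm w"
  shows "proj_dist z w \<le> 4 * real CARD('i) ^ 2 * norm (z - w)"
proof -
  define u where "u = z /\<^sub>R norm z"
  define v where "v = w /\<^sub>R norm w"
  have uv: "norm u = 1" "norm v = 1" 
    using assms norm_sgn[of z] norm_sgn[of w] by (auto simp: u_def v_def sgn_div_norm)
  have d: "norm (u - v) \<le> 2 * norm (z - w)" unfolding u_def v_def using assms by (rule norm_normalize_diff)
  have "cmod (proj_entry z a b - proj_entry w a b) \<le> 4 * norm (z - w)" for a b
  proof -
    have nz: "norm z \<noteq> 0" "norm w \<noteq> 0" using assms by auto
    have "u $ c = z $ c / of_real (norm z)" "v $ c = w $ c / of_real (norm w)" for c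
      by (simp_all add: u_def v_def scaleR_conv_of_real[where 'a = complex] divide_inverse mult.commute)
    then have "proj_entry z a b = u $ a * cnj (u $ b)" "proj_entry w a b = v $ a * cnj (v $ b)"
      using nz by (simp_all add: proj_entry_def power2_eq_square)
    then have "proj_entry z a b - proj_entry w a b = u $ a * cnj ((u - v) $ b) + (u - v) $ a * cnj (v $ b)"
      by (simp add: algebra_simps)
    then have "cmod (proj_entry z a b - proj_entry w a b) \<le>
        cmod (u $ a) * cmod ((u - v) $ b) + cmod ((u - v) $ a) * cmod (v $ b)"
      by (metis complex_mod_cnj norm_mult norm_triangle_ineq)
    also have "\<dots> \<le> 1 * norm (u - v) + norm (u - v) * 1"
      using uv Finite_Cartesian_Product.norm_nth_le[of u a] Finite_Cartesian_Product.norm_nth_le[of v b]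
        Finite_Cartesian_Product.norm_nth_le[of "u - v"]
      by (intro add_mono mult_mono) auto
    also have "\<dots> \<le> 4 * norm (z - w)" using d by simp
    finally show ?thesis .
  qed
  then have "proj_dist z w \<le> (\<Sum>a\<in>(UNIV :: 'i set). \<Sum>b\<in>(UNIV :: 'i set). 4 * norm (z - w))"
    unfolding proj_dist_def by (intro sum_mono)
  then show ?thesis by (simp add: power2_eq_square)
qed

lemma norm_vec_le_sum: "norm z \<le> (\<Sum>l\<in>UNIV. norm (z $ l))" for z :: "complex ^ 'i::finite"
  unfolding norm_vec_def by (rule L2_set_le_sum) auto

text \<open>With \<open>N = CARD('i)\<close>, the constant is \<open>4 N^2\<close> from
  \<open>proj_dist_le\<close> times \<open>8 / \<rho>\<close> for each of the \<open>N\<close>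
  coordinates, which are bounded by \<open>2\<close> on a ball of radius
  \<open>\<rho>\<close>.\<close>

lemma has_balanced_lift_lipschitz:
  fixes f :: "complex \<Rightarrow> (complex ^ 'i::finite) set"
  assumes f: "has_balanced_lift f 0 \<rho>" "\<rho> > 0"
    and z: "f 0 = proj_pt z" "z \<noteq> 0" and w: "f b = proj_pt w" "w \<noteq> 0"
    and b: "b \<in> cball 0 (\<rho> / 2)"
  shows "proj_dist z w \<le> 32 * real CARD('i) ^ 3 / \<rho> * norm b"
proof -
  obtain G where G: "\<And>l. (\<lambda>w. G w $ l) holomorphic_on ball 0 \<rho>"
    "\<And>w. w \<in> ball 0 \<rho> \<Longrightarrow> f w = proj_pt (G w) \<and> 1 \<le> norm (G w) \<and> norm (G w) \<le> 2"
    using f(1) unfolding has_balanced_lift_def by blast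
  have in_ball: "0 \<in> ball 0 \<rho>" "b \<in> ball 0 \<rho>" using f(2) b by auto
  have "proj_dist z w = proj_dist (G 0) (G b)"
    unfolding proj_dist_def using proj_entry_cong[of z "G 0"] proj_entry_cong[of w "G b"] z w G(2) in_ball
    by auto
  also have "\<dots> \<le> 4 * real CARD('i) ^ 2 * norm (G 0 - G b)"
    using G(2) in_ball by (intro proj_dist_le) auto
  also have "norm (G 0 - G b) \<le> (\<Sum>l\<in>(UNIV::'i set). 8 / \<rho> * norm b)"
  proof (rule order_trans[OF norm_vec_le_sum sum_mono])
    fix l :: 'i
    have "norm (G w $ l) \<le> 2" if "w \<in> ball 0 \<rho>" for w
      using G(2)[OF that] Finite_Cartesian_Product.norm_nth_le[of "G w" l] by linarith
    then have "norm (G 0 $ l - G b $ l) \<le> 4 * 2 / \<rho> * norm (0 - b)"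
      using f(2) b G(1) by (intro holomorphic_bounded_lipschitz[of _ 0 \<rho>]) auto
    then show "norm ((G 0 - G b) $ l) \<le> 8 / \<rho> * norm b" by simp
  qed
  also have "\<dots> = real CARD('i) * (8 / \<rho> * norm b)" by simp
  finally show ?thesis by (simp add: power2_eq_square power3_eq_cube mult_ac)
qed

lemma proj_dist_le_const:
  fixes z w :: "complex ^ 'i::finite"
  assumes "z \<noteq> 0" "w \<noteq> 0"
  shows "proj_dist z w \<le> 8 * real CARD('i) ^ 2"
proof -
  let ?u = "\<lambda>z :: complex ^ 'i. of_real (inverse (norm z)) *s z"
  have n: "norm (?u z) = 1" "norm (?u w) = 1" using assms by (simp_all add: norm_vec_scale norm_inverse)
  have "proj_dist z w = proj_dist (?u z) (?u w)"
    using assms by (simp add: proj_dist_def proj_entry_scale)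
  also have "\<dots> \<le> 4 * real CARD('i) ^ 2 * norm (?u z - ?u w)"
    using n by (intro proj_dist_le) auto
  also have "\<dots> \<le> 4 * real CARD('i) ^ 2 * 2"
    using norm_triangle_ineq4[of "?u z" "?u w"] n by (intro mult_left_mono) auto
  finally show ?thesis by simp
qed

text \<open>For \<open>x\<close> the modulus of the Moebius image, the distance is
  \<open>ln ((1 + x) / (1 - x))\<close>. The inequality \<open>ln y \<le> y - 1\<close> at
  \<open>y = (1 - x) / (1 + x)\<close> bounds it below by \<open>2 * x / (1 + x)\<close>, hence by
  \<open>x\<close>.\<close>

lemma norm_Moebius_le_poincare_dist:
  assumes "norm a < 1" "norm b < 1"
  shows "norm (Moebius_function 0 a b) \<le> poincare_dist a b"
proof -
  define x where "x = cmod ((a - b) / (1 - cnj a * b))"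
  have x: "norm (Moebius_function 0 a b) = x"
    by (simp add: Moebius_function_simple x_def norm_divide norm_minus_commute)
  then have x1: "0 \<le> x" "x < 1" using Moebius_function_norm_lt_1[OF assms, of 0] by auto
  have "ln ((1 - x) / (1 + x)) \<le> (1 - x) / (1 + x) - 1" using x1 by (intro ln_le_minus_one) auto
  also have "\<dots> = - 2 * x / (1 + x)" using x1 by (simp add: field_simps)
  also have "ln ((1 - x) / (1 + x)) = - ln ((1 + x) / (1 - x))" using x1 by (simp add: ln_div)
  finally have "2 * x / (1 + x) \<le> ln ((1 + x) / (1 - x))" by simp
  moreover have "x \<le> 2 * x / (1 + x)" using x1 mult_left_mono[of x 1 x] by (simp add: field_simps)
  ultimately have "x \<le> 2 * artanh x" by (simp add: artanh_def)
  then show ?thesis by (simp add: x poincare_dist_def x_def)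
qed

text \<open>A common radius of balanced lifts makes all discs Lipschitz with one constant
  \<open>C\<close> from the Poincare distance to \<open>proj_dist\<close>. Every chain between two
  points is then at least as long as their \<open>proj_dist\<close> divided by
  \<open>C\<close>.\<close>

theorem kobayashi_hyperbolic_if_uniform_balanced_lift:
  fixes Y :: "(complex ^ 'i::finite) set set"
  assumes Y: "\<And>p. p \<in> Y \<Longrightarrow> \<exists>z. z \<noteq> 0 \<and> p = proj_pt z"
    and \<rho>: "\<rho> > 0" "\<And>f. holomorphic_disc Y f \<Longrightarrow> has_balanced_lift f 0 \<rho>"
  shows "kobayashi_hyperbolic Y"
proof -
  \<comment> \<open>The first summand handles points within \<open>\<rho> / 2\<close> of the centre.
    Beyond that the second suffices, as \<open>proj_dist\<close> never exceeds
    \<open>8 * real CARD('i) ^ 2\<close>.\<close>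
  define C where "C = 32 * real CARD('i) ^ 3 / \<rho> + 16 * real CARD('i) ^ 2 / \<rho>"
  have C: "C > 0" using \<rho>(1) by (simp add: C_def add_pos_pos)
  have disc0: "proj_dist z w \<le> C * norm b"
    if f: "holomorphic_disc Y f" and z: "f 0 = proj_pt z" "z \<noteq> 0" and w: "f b = proj_pt w" "w \<noteq> 0"
    for f b and z w :: "complex ^ 'i"
  proof (cases "norm b \<le> \<rho> / 2")
    case True
    then have "proj_dist z w \<le> 32 * real CARD('i) ^ 3 / \<rho> * norm b"
      using z w \<rho> f by (intro has_balanced_lift_lipschitz[of f]) auto
    also have "\<dots> \<le> C * norm b" using \<rho>(1) by (intro mult_right_mono) (auto simp: C_def)
    finally show ?thesis .
  next
    case False
    have "proj_dist z w \<le> 8 * real CARD('i) ^ 2" using z w by (intro proj_dist_le_const)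
    also have "\<dots> = 16 * real CARD('i) ^ 2 / \<rho> * (\<rho> / 2)" using \<rho>(1) by simp
    also have "\<dots> \<le> C * norm b" using False \<rho>(1) C by (intro mult_mono) (auto simp: C_def)
    finally show ?thesis .
  qed
  have disc: "proj_dist z w \<le> C * poincare_dist a b"
    if f: "holomorphic_disc Y f" and ab: "a \<in> ball 0 1" "b \<in> ball 0 1"
      and z: "f a = proj_pt z" "z \<noteq> 0" and w: "f b = proj_pt w" "w \<noteq> 0"
    for f a b and z w :: "complex ^ 'i"
  proof -
    \<comment> \<open>An automorphism of the disc moving \<open>0\<close> to \<open>a\<close>
      reduces the claim to \<open>disc0\<close>.\<close>
    let ?M = "Moebius_function 0 (- a)"
    have M: "?M holomorphic_on ball 0 1" "?M ` ball 0 1 \<subseteq> ball 0 1"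
      using ab Moebius_function_holomorphic[of "-a" 0] Moebius_function_norm_lt_1[of "-a" _ 0] by auto
    have "proj_holomorphic_on (\<lambda>v. f (?M v)) (ball 0 1)"
      using f M unfolding holomorphic_disc_def
      by (intro proj_holomorphic_on_compose[OF _ M(1) open_ball M(2)]) blast
    then have "holomorphic_disc Y (\<lambda>v. f (?M v))"
      using f M(2) unfolding holomorphic_disc_def by blast
    moreover have "?M 0 = a" by (simp add: Moebius_function_of_zero)
    moreover have "?M (Moebius_function 0 a b) = b"
      using ab by (intro Moebius_function_compose) auto
    ultimately have "proj_dist z w \<le> C * norm (Moebius_function 0 a b)"
      using z w by (intro disc0[of "\<lambda>v. f (?M v)"]) auto
    also have "\<dots> \<le> C * poincare_dist a b"
      using C ab by (intro mult_left_mono norm_Moebius_le_poincare_dist) auto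
    finally show ?thesis .
  qed
  have poin: "poincare_dist a b \<ge> 0" if "a \<in> ball 0 1" "b \<in> ball 0 1" for a b
    using norm_Moebius_le_poincare_dist[of a b] that order_trans[OF norm_ge_zero] by auto
  show ?thesis unfolding kobayashi_hyperbolic_def
  proof (intro ballI impI)
    fix p q assume pq: "p \<in> Y" "q \<in> Y" "p \<noteq> q"
    obtain z w where z: "z \<noteq> 0" "p = proj_pt z" and w: "w \<noteq> 0" "q = proj_pt w" using Y pq by metis
    have pos: "proj_dist z w / C > 0" using z w pq C by (auto intro!: divide_pos_pos proj_dist_pos)
    have "ennreal (proj_dist z w / C) \<le> kobayashi_dist Y p q"
      unfolding kobayashi_dist_def
    proof (rule Inf_greatest, clarify)
      fix l f a b assume "disc_chain Y p q l f a b"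
      then obtain x where x: "x 0 = p" "x l = q" and fi: "\<And>i. i < l \<Longrightarrow> holomorphic_disc Y (f i) \<and>
          a i \<in> ball 0 1 \<and> b i \<in> ball 0 1 \<and> f i (a i) = x i \<and> f i (b i) = x (Suc i)"
        unfolding disc_chain_def by blast
      have "x i \<in> Y" if "i \<le> l" for i
      proof (cases "i = l")
        case False
        then show ?thesis using that fi[of i] unfolding holomorphic_disc_def by force
      qed (use x pq in auto)
      then have "\<exists>v. v \<noteq> 0 \<and> x i = proj_pt v" if "i \<le> l" for i using Y that by blast
      then obtain v where v: "\<And>i. i \<le> l \<Longrightarrow> v i \<noteq> 0 \<and> x i = proj_pt (v i)" by metis
      have "proj_dist (v 0) (v k) \<le> C * (\<Sum>i<k. poincare_dist (a i) (b i))" if "k \<le> l" for k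
        using that
      proof (induction k)
        case 0
        then show ?case by (simp add: proj_dist_def)
      next
        case (Suc k)
        have "proj_dist (v 0) (v (Suc k)) \<le> proj_dist (v 0) (v k) + proj_dist (v k) (v (Suc k))"
          by (rule proj_dist_triangle)
        also have "proj_dist (v k) (v (Suc k)) \<le> C * poincare_dist (a k) (b k)"
          using Suc.prems fi[of k] v[of k] v[of "Suc k"] by (intro disc[of "f k"]) auto
        finally show ?case using Suc by (simp add: algebra_simps)
      qed
      from this[of l] have "proj_dist (v 0) (v l) / C \<le> (\<Sum>i<l. poincare_dist (a i) (b i))"
        using C by (simp add: field_simps)
      moreover have "proj_dist (v 0) (v l) = proj_dist z w"
        unfolding proj_dist_def
        using v[of 0] v[of l] x z w proj_entry_cong[of "v 0" z] proj_entry_cong[of "v l" w] by auto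
      moreover have "(\<Sum>i<l. ennreal (poincare_dist (a i) (b i))) = ennreal (\<Sum>i<l. poincare_dist (a i) (b i))"
        using fi poin by (intro sum_ennreal) auto
      ultimately show "ennreal (proj_dist z w / C) \<le> (\<Sum>i<l. ennreal (poincare_dist (a i) (b i)))"
        by (simp add: ennreal_leI)
    qed
    moreover have "ennreal (proj_dist z w / C) > 0" using pos by simp
    ultimately show "kobayashi_dist Y p q > 0" by (rule order.strict_trans2[rotated])
  qed
qed

section \<open>Brody curves\<close>

text \<open>A holomorphic curve from the plane to projective space, given by lifts \<open>G c\<close> on the unit balls
  around all points \<open>c\<close>; only values \<open>G c w\<close> with \<open>w \<in> ball c 1\<close> are meaningful. That the lifts
  can be normalised on balls of fixed size expresses boundedness of the derivative.\<close>

definition brody_curve :: "(complex \<Rightarrow> complex \<Rightarrow> complex ^ 'i::finite) \<Rightarrow> bool" where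
  "brody_curve G \<longleftrightarrow> (\<forall>c l. (\<lambda>w. G c w $ l) holomorphic_on ball c 1) \<and>
     (\<forall>c. \<forall>w\<in>ball c 1. 1 \<le> norm (G c w) \<and> norm (G c w) \<le> 2) \<and>
     (\<forall>c c'. \<forall>w\<in>ball c 1 \<inter> ball c' 1. \<forall>a b. G c w $ a * G c' w $ b = G c w $ b * G c' w $ a)"

text \<open>Even when the point of projective space is fixed, its lifts may vary by scalar
  functions; hence proportionality to a fixed vector, cross-multiplied to avoid division.\<close>

definition constant_curve :: "(complex \<Rightarrow> complex \<Rightarrow> complex ^ 'i::finite) \<Rightarrow> bool" where
  "constant_curve G \<longleftrightarrow> (\<exists>v. v \<noteq> 0 \<and> (\<forall>c. \<forall>w\<in>ball c 1. \<forall>a b. G c w $ a * v $ b = G c w $ b * v $ a))"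

text \<open>Hofer's selection is applied to the predicate of having a balanced lift on the ball
  around \<open>x\<close> of radius \<open>r\<close>. Zooming in by the factor \<open>r / 2\<close>
  turns the lifts of radius \<open>r / 2\<close> nearby into lifts on unit balls, and the failure on
  radius \<open>r\<close> into failure on radius \<open>2\<close>.\<close>

lemma rescaled_discs:
  fixes Y :: "(complex ^ 'i::finite) set set"
  assumes "\<And>\<rho>. \<rho> > 0 \<Longrightarrow> \<exists>f. holomorphic_disc Y f \<and> \<not> has_balanced_lift f 0 \<rho>" and R: "R > 0"
  shows "\<exists>g. (\<forall>c\<in>ball 0 R. g c \<in> Y \<and> has_balanced_lift g c 1) \<and> \<not> has_balanced_lift g 0 2"
proof -
  \<comment> \<open>This makes \<open>2 * R * r0\<close> equal to \<open>1 / 2\<close>, so the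
    search never leaves the unit disc.\<close>
  define r0 where "r0 = 1 / (4 * R)"
  have r0: "r0 > 0" "2 * R * r0 < 1" using R by (auto simp: r0_def)
  obtain f where f: "holomorphic_disc Y f" "\<not> has_balanced_lift f 0 r0" using assms(1) r0 by blast
  have fh: "proj_holomorphic_on f (ball 0 1)" "f ` ball 0 1 \<subseteq> Y" using f(1) by (auto simp: holomorphic_disc_def)
  have "\<exists>x r. 0 < r \<and> r \<le> r0 \<and> norm x + R * r \<le> 2 * R * r0 \<and> \<not> has_balanced_lift f x r \<and>
    (\<forall>y\<in>ball x (R * r). has_balanced_lift f y (r / 2))"
    using has_balanced_lift_mono proj_holomorphic_on_imp_has_balanced_lift[OF fh(1)] r0(1) R r0(2) f(2)
    by (rule hofer_selection)
  then obtain x r where xr: "0 < r \<and> r \<le> r0 \<and> norm x + R * r \<le> 2 * R * r0 \<and> \<not> has_balanced_lift f x r \<and>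
    (\<forall>y\<in>ball x (R * r). has_balanced_lift f y (r / 2))"
    by (elim exE)
  have r: "0 < r" "norm x + R * r < 1" "\<not> has_balanced_lift f x r"
    "\<And>y. y \<in> ball x (R * r) \<Longrightarrow> has_balanced_lift f y (r / 2)"
    using xr r0(2) by simp_all
  define g where "g = (\<lambda>z. f (x + of_real (r / 2) * z))"
  show ?thesis
  proof (intro exI[of _ g] conjI ballI)
    fix c :: complex assume c: "c \<in> ball 0 R"
    have "norm (of_real (r / 2) * c) = r / 2 * norm c" using r by (simp add: norm_mult)
    also have "\<dots> < r * R" using c r R by (intro mult_strict_mono) auto
    finally have y: "norm (of_real (r / 2) * c) < R * r" by (simp add: mult.commute)
    have "norm (x + of_real (r / 2) * c) \<le> norm x + norm (of_real (r / 2) * c)" by (rule norm_triangle_ineq)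
    also have "\<dots> < 1" using y r by simp
    finally show "g c \<in> Y" using fh(2) by (auto simp: g_def)
    have "has_balanced_lift f (x + of_real (r / 2) * c) (r / 2)"
      using y by (intro r(4)) (simp add: dist_norm)
    then show "has_balanced_lift g c 1"
      unfolding g_def
    proof (rule has_balanced_lift_compose)
      show "(\<lambda>z. x + of_real (r / 2) * z) ` ball c 1 \<subseteq> ball (x + of_real (r / 2) * c) (r / 2)"
      proof clarify
        fix z assume "z \<in> ball c 1"
        then have "r / 2 * norm (c - z) < r / 2 * 1"
          using r(1) by (intro mult_strict_left_mono) (auto simp: dist_norm)
        then have "norm (of_real (r / 2) * (c - z)) < r / 2"
          using r(1) by (simp add: norm_mult)
        then show "x + of_real (r / 2) * z \<in> ball (x + of_real (r / 2) * c) (r / 2)"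
          unfolding mem_ball dist_norm add_diff_cancel_left right_diff_distrib .
      qed
    qed (intro holomorphic_intros)
  next
    show "\<not> has_balanced_lift g 0 2"
    proof
      assume "has_balanced_lift g 0 2"
      then have "has_balanced_lift (\<lambda>z. g ((z - x) * of_real (2 / r))) x r"
      proof (rule has_balanced_lift_compose)
        show "(\<lambda>z. (z - x) * of_real (2 / r)) ` ball x r \<subseteq> ball 0 2"
        proof clarify
          fix z assume "z \<in> ball x r"
          then have "norm (z - x) * (2 / r) < 2"
            using r(1) by (simp add: dist_norm norm_minus_commute field_simps)
          then show "(z - x) * of_real (2 / r) \<in> ball 0 2"
            using r(1) unfolding mem_ball_0 norm_mult norm_of_real by simp
        qed
      qed (intro holomorphic_intros)
      moreover have "(\<lambda>z. g ((z - x) * of_real (2 / r))) = f"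
      proof
        fix z
        have "x + of_real (r / 2) * ((z - x) * of_real (2 / r)) = z"
          using r(1) by (simp add: field_simps)
        then show "g ((z - x) * of_real (2 / r)) = f z"
          by (simp only: g_def)
      qed
      ultimately show False using r(3) by simp
    qed
  qed
qed

lemma proj_pt_eq_cross:
  fixes z w :: "complex ^ 'i::finite"
  assumes "proj_pt z = proj_pt w" "z \<noteq> 0"
  shows "z $ a * w $ b = z $ b * w $ a"
proof -
  obtain c where "c \<noteq> 0" "z = c *s w" using assms by (rule proj_pt_eqD)
  then show ?thesis by simp
qed

lemma normalized_lift_eq:
  fixes z w :: "complex ^ 'i::finite"
  assumes "proj_pt z = proj_pt w" "z \<noteq> 0"
  shows "(\<beta> / z $ b) *s z = (\<beta> / w $ b) *s w"
proof -
  obtain c where "c \<noteq> 0" "z = c *s w" using assms by (rule proj_pt_eqD)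
  then show ?thesis by (simp add: Finite_Cartesian_Product.vec_eq_iff)
qed

text \<open>Local lifts become equal on overlaps once their coordinate \<open>b\<close> is
  normalised to \<open>u $ b\<close>, so they glue. Staying within \<open>1 / 2\<close> of a vector
  of norm \<open>3 / 2\<close> keeps the norm between \<open>1\<close> and \<open>2\<close>.\<close>

lemma has_balanced_lift_of_cover:
  fixes g :: "complex \<Rightarrow> (complex ^ 'i::finite) set" and L :: "complex \<Rightarrow> complex \<Rightarrow> complex ^ 'i"
  assumes cover: "ball a R \<subseteq> (\<Union>c\<in>N. ball c r)"
    and hol: "\<And>c l. c \<in> N \<Longrightarrow> (\<lambda>w. L c w $ l) holomorphic_on ball c r"
    and L: "\<And>c w. c \<in> N \<Longrightarrow> w \<in> ball c r \<Longrightarrow> L c w $ b \<noteq> 0 \<and> g w = proj_pt (L c w)"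
    and u: "norm u = 3 / 2" "u $ b \<noteq> 0"
      "\<And>c w. c \<in> N \<Longrightarrow> w \<in> ball c r \<Longrightarrow> norm ((u $ b / L c w $ b) *s L c w - u) \<le> 1 / 2"
  shows "has_balanced_lift g a R"
proof -
  have "\<forall>w\<in>ball a R. \<exists>c. c \<in> N \<and> w \<in> ball c r"
    using cover by blast
  then obtain k where k: "\<And>w. w \<in> ball a R \<Longrightarrow> k w \<in> N \<and> w \<in> ball (k w) r"
    by (elim bchoice[THEN exE]) blast
  define H where "H w = (u $ b / L (k w) w $ b) *s L (k w) w" for w
  have H_eq: "H w = (u $ b / L c w $ b) *s L c w" if "w \<in> ball a R" "c \<in> N" "w \<in> ball c r" for w c
    unfolding H_def
  proof (rule normalized_lift_eq)
    show "proj_pt (L (k w) w) = proj_pt (L c w)"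
      using L[of "k w" w] L[OF that(2,3)] k[OF that(1)] by simp
    show "L (k w) w \<noteq> 0" using L[of "k w" w] k[OF that(1)] by auto
  qed
  show ?thesis
    unfolding has_balanced_lift_def
  proof (intro exI[of _ H] conjI allI ballI)
    fix l
    show "(\<lambda>w. H w $ l) holomorphic_on ball a R"
      unfolding holomorphic_on_open[OF open_ball]
    proof
      fix w assume w: "w \<in> ball a R"
      define S where "S = ball a R \<inter> ball (k w) r"
      have kw: "k w \<in> N" "w \<in> S" "open S" using k[OF w] w by (auto simp: S_def)
      have "(\<lambda>v. L (k w) v $ i) holomorphic_on S" for i
        using kw by (intro holomorphic_on_subset[OF hol]) (auto simp: S_def)
      then have "(\<lambda>v. u $ b / L (k w) v $ b * L (k w) v $ l) holomorphic_on S"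
        using kw L by (intro holomorphic_intros) (auto simp: S_def)
      then have "(\<lambda>v. H v $ l) holomorphic_on S"
        by (rule holomorphic_transform) (use H_eq kw in \<open>auto simp: S_def\<close>)
      then show "\<exists>f'. ((\<lambda>w. H w $ l) has_field_derivative f') (at w)"
        using kw holomorphic_on_open by blast
    qed
  next
    fix w assume "w \<in> ball a R"
    note kw = k[OF this]
    have Lk: "L (k w) w $ b \<noteq> 0" "g w = proj_pt (L (k w) w)" using L kw by auto
    then show "g w = proj_pt (H w)"
      unfolding H_def using u(2) by (subst proj_pt_scale) auto
    have "norm (H w - u) \<le> 1 / 2" using u(3) kw by (auto simp: H_def)
    then show "1 \<le> norm (H w)" "norm (H w) \<le> 2"
      using u(1) norm_triangle_ineq2[of u "H w"] norm_triangle_ineq2[of "H w" u]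
      by (auto simp: norm_minus_commute)
  qed
qed

text \<open>The set \<open>S\<close> is a closed cone of vectors containing all lifts of points of
  \<open>Y\<close>. The limit is taken among lifts, so membership in \<open>S\<close> passes to
  it.\<close>

theorem brody_curve_exists:
  fixes Y :: "(complex ^ 'i::finite) set set"
  assumes bad: "\<And>\<rho>. \<rho> > 0 \<Longrightarrow> \<exists>f. holomorphic_disc Y f \<and> \<not> has_balanced_lift f 0 \<rho>"
    and S: "closed S" "\<And>z. z \<noteq> 0 \<Longrightarrow> proj_pt z \<in> Y \<Longrightarrow> z \<in> S"
  shows "\<exists>G. brody_curve G \<and> \<not> constant_curve G \<and> (\<forall>c. \<forall>w\<in>ball c 1. G c w \<in> S)"
proof -
  have "\<exists>g. (\<forall>c\<in>ball 0 (real (Suc j)). g c \<in> Y \<and> has_balanced_lift g c 1) \<and> \<not> has_balanced_lift g 0 2" for j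
    by (rule rescaled_discs[OF bad]) auto
  then obtain g where g: "\<And>j c. c \<in> ball 0 (real (Suc j)) \<Longrightarrow> g j c \<in> Y \<and> has_balanced_lift (g j) c 1"
    "\<And>j. \<not> has_balanced_lift (g j) 0 2"
    by metis
  have "\<exists>G. c \<in> ball 0 (real (Suc j)) \<longrightarrow> (\<forall>l. (\<lambda>w. G w $ l) holomorphic_on ball c 1) \<and>
     (\<forall>w\<in>ball c 1. g j w = proj_pt (G w) \<and> 1 \<le> norm (G w) \<and> norm (G w) \<le> 2)" for j c
    using g(1) unfolding has_balanced_lift_def by blast
  then have "\<forall>j. \<exists>L. \<forall>c. c \<in> ball 0 (real (Suc j)) \<longrightarrow> (\<forall>l. (\<lambda>w. L c w $ l) holomorphic_on ball c 1) \<and>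
     (\<forall>w\<in>ball c 1. g j w = proj_pt (L c w) \<and> 1 \<le> norm (L c w) \<and> norm (L c w) \<le> 2)"
    by (intro allI choice)
  from choice[OF this] obtain L where L_all: "\<forall>j c. c \<in> ball 0 (real (Suc j)) \<longrightarrow>
     (\<forall>l. (\<lambda>w. L j c w $ l) holomorphic_on ball c 1) \<and>
     (\<forall>w\<in>ball c 1. g j w = proj_pt (L j c w) \<and> 1 \<le> norm (L j c w) \<and> norm (L j c w) \<le> 2)"
    by (elim exE)
  note L = L_all[rule_format, THEN conjunct1, rule_format]
    L_all[rule_format, THEN conjunct2, rule_format, THEN conjunct1]
    L_all[rule_format, THEN conjunct2, rule_format, THEN conjunct2, THEN conjunct1]
    L_all[rule_format, THEN conjunct2, rule_format, THEN conjunct2, THEN conjunct2]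
  \<comment> \<open>Meaningless pairs of centre and point get the value \<open>0\<close>, which puts
    all values into one compact ball.\<close>
  define L' where "L' j p = (if fst p \<in> ball 0 (real (Suc j)) \<and> snd p \<in> ball (fst p) 1
    then L j (fst p) (snd p) else 0)" for j p
  have "L' j p \<in> cball 0 2" for j p using L(4) by (auto simp: L'_def)
  then obtain F G' where F: "F \<noteq> bot" "F \<le> sequentially" "\<And>p. ((\<lambda>j. L' j p) \<longlongrightarrow> G' p) F"
    using tychonoff_filter[OF compact_cball] by metis
  define G where "G c w = G' (c, w)" for c w
  have ev: "eventually (\<lambda>j. c \<in> ball 0 (real (Suc j))) F" for c :: complex
  proof -
    have "eventually (\<lambda>j. norm c < real j) sequentially" using eventually_gt_at_top[of "nat \<lceil>norm c\<rceil>"]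
      by eventually_elim linarith
    then have "eventually (\<lambda>j. norm c < real j) F" using F(2) by (rule filter_leD[rotated])
    then show ?thesis by eventually_elim auto
  qed
  have lim: "((\<lambda>j. L j c w) \<longlongrightarrow> G c w) F" if "w \<in> ball c 1" for c w
  proof -
    have "eventually (\<lambda>j. L' j (c, w) = L j c w) F"
      using ev[of c] by eventually_elim (use that in \<open>auto simp: L'_def\<close>)
    then show ?thesis using F(3)[of "(c, w)"] unfolding G_def by (simp cong: tendsto_cong)
  qed
  have lim': "((\<lambda>j. L j c w $ l) \<longlongrightarrow> G c w $ l) F" if "w \<in> ball c 1" for c w l
    using lim[OF that] by (rule tendsto_vec_nth)
  have hb: "eventually (\<lambda>j. (\<lambda>w. L j c w $ l) holomorphic_on ball c 1 \<and> (\<forall>w\<in>ball c 1. norm (L j c w $ l) \<le> 2)) F"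
    for c l
    using ev[of c]
  proof eventually_elim
    case (elim j)
    then show ?case using L(1)[OF elim, of l] L(4)[OF elim] Finite_Cartesian_Product.norm_nth_le order_trans
      by blast
  qed
  have norm1: "1 \<le> norm (G c w)" if w: "w \<in> ball c 1" for c w
    by (rule tendsto_lowerbound[OF tendsto_norm[OF lim[OF w]] _ F(1)])
      (use ev[of c] in \<open>eventually_elim, use L(3) w in auto\<close>)
  have norm2: "norm (G c w) \<le> 2" if w: "w \<in> ball c 1" for c w
    by (rule tendsto_upperbound[OF tendsto_norm[OF lim[OF w]] _ F(1)])
      (use ev[of c] in \<open>eventually_elim, use L(4) w in auto\<close>)
  have cross: "G c w $ a * G c' w $ b = G c w $ b * G c' w $ a" if w: "w \<in> ball c 1" "w \<in> ball c' 1"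
    for c c' w a b
  proof (rule tendsto_unique[OF F(1)])
    show "((\<lambda>j. L j c w $ a * L j c' w $ b) \<longlongrightarrow> G c w $ a * G c' w $ b) F"
      by (intro tendsto_mult lim' w)
    have "((\<lambda>j. L j c w $ b * L j c' w $ a) \<longlongrightarrow> G c w $ b * G c' w $ a) F"
      by (intro tendsto_mult lim' w)
    moreover have "eventually (\<lambda>j. L j c w $ b * L j c' w $ a = L j c w $ a * L j c' w $ b) F"
      using ev[of c] ev[of c']
    proof eventually_elim
      case (elim j)
      have "proj_pt (L j c w) = proj_pt (L j c' w)" using L(2)[OF elim(1) w(1)] L(2)[OF elim(2) w(2)] by simp
      moreover have "L j c w \<noteq> 0" using L(3)[OF elim(1) w(1)] by auto
      ultimately show ?case by (rule proj_pt_eq_cross)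
    qed
    ultimately show "((\<lambda>j. L j c w $ a * L j c' w $ b) \<longlongrightarrow> G c w $ b * G c' w $ a) F"
      by (rule Lim_transform_eventually)
  qed
  have "brody_curve G"
    unfolding brody_curve_def using norm1 norm2 cross holomorphic_pointwise_limit[OF F(1) hb lim'] by auto
  moreover have "G c w \<in> S" if w: "w \<in> ball c 1" for c w
  proof (rule Lim_in_closed_set[OF S(1) _ F(1) lim[OF w]])
    show "eventually (\<lambda>j. L j c w \<in> S) F" using ev[of c] ev[of w]
    proof eventually_elim
      case (elim j)
      show ?case using L(2,3)[OF elim(1) w] g(1)[OF elim(2)] by (intro S(2)) auto
    qed
  qed
  \<comment> \<open>A constant limit would force the lifts of \<open>g j\<close> close to multiples
    of one vector, uniformly near \<open>cball 0 2\<close>. They would then glue to a balanced lift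
    of radius \<open>2\<close>, which \<open>g j\<close> does not have.\<close>
  moreover have "\<not> constant_curve G"
  proof
    assume "constant_curve G"
    then obtain v where v: "v \<noteq> 0" "\<And>c w a b. w \<in> ball c 1 \<Longrightarrow> G c w $ a * v $ b = G c w $ b * v $ a"
      unfolding constant_curve_def by blast
    obtain b where b: "v $ b \<noteq> 0" using v(1) by (auto simp: Finite_Cartesian_Product.vec_eq_iff)
    define u where "u = complex_of_real (3 / (2 * norm v)) *s v"
    have u: "norm u = 3 / 2" "u $ b \<noteq> 0" using v(1) b by (auto simp: u_def norm_vec_scale norm_divide norm_mult)
    have Gv: "G c w = (G c w $ b / v $ b) *s v" if "w \<in> ball c 1" for c w
    proof (subst Finite_Cartesian_Product.vec_eq_iff, rule allI)
      fix a show "G c w $ a = ((G c w $ b / v $ b) *s v) $ a"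
        using v(2)[OF that, of a b] b by (simp add: field_simps)
    qed
    \<comment> \<open>Since \<open>G c w\<close> has norm at least \<open>1\<close> and is parallel
      to \<open>v\<close>, its coordinate \<open>b\<close> is at least \<open>\<kappa>\<close>. This
      makes division by that coordinate compatible with uniform limits.\<close>
    define \<kappa> where "\<kappa> = norm (v $ b) / norm v"
    have \<kappa>: "\<kappa> > 0" using b v(1) by (simp add: \<kappa>_def)
    have Gb: "norm (G c w $ b) \<ge> \<kappa>" if "w \<in> ball c 1" for c w
    proof -
      have "1 \<le> norm (G c w $ b) / norm (v $ b) * norm v"
        using norm1[OF that] Gv[OF that] by (metis norm_divide norm_vec_scale)
      then show ?thesis using v(1) b by (simp add: \<kappa>_def field_simps)
    qed
    \<comment> \<open>An error of \<open>\<epsilon>\<close> in each coordinate adds up to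
      \<open>1 / 2\<close>, the tolerance of \<open>has_balanced_lift_of_cover\<close>.\<close>
    define \<epsilon> where "\<epsilon> = 1 / (2 * real CARD('i))"
    have \<epsilon>: "\<epsilon> > 0" by (simp add: \<epsilon>_def)
    let ?Q = "\<lambda>j c. \<forall>w\<in>cball c (1 / 2). L j c w $ b \<noteq> 0 \<and> norm ((u $ b / L j c w $ b) *s L j c w - u) \<le> 1 / 2"
    have evQ: "eventually (\<lambda>j. ?Q j c) F" for c
    proof -
      have sub: "w \<in> ball c 1" if "w \<in> cball c (1 / 2)" for w using that by auto
      have ul: "uniform_limit (cball c (1 / 2)) (\<lambda>j w. L j c w $ l) (\<lambda>w. G c w $ l) F" for l
        using uniform_limit_cball_of_pointwise[OF F(1) _ hb lim'] by simp
      have "uniform_limit (cball c (1 / 2)) (\<lambda>j w. L j c w $ l / L j c w $ b) (\<lambda>w. G c w $ l / G c w $ b) F" for l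
      proof (rule uniform_lim_divide[OF ul ul _ _ \<kappa>])
        show "bounded ((\<lambda>w. G c w $ l) ` cball c (1 / 2))"
          unfolding bounded_iff
          by (intro exI[of _ 2] ballI, elim imageE)
            (use norm2 sub Finite_Cartesian_Product.norm_nth_le order_trans in blast)
      qed (use Gb sub in auto)
      then have "eventually (\<lambda>j. \<forall>w\<in>cball c (1 / 2). dist (L j c w $ l / L j c w $ b) (G c w $ l / G c w $ b)
          < \<epsilon> / norm (u $ b)) F" for l
        using \<epsilon> u by (intro uniform_limitD) auto
      then have e1: "eventually (\<lambda>j. \<forall>l\<in>UNIV. \<forall>w\<in>cball c (1 / 2). dist (L j c w $ l / L j c w $ b) (G c w $ l / G c w $ b)
          < \<epsilon> / norm (u $ b)) F"
        by (intro eventually_ball_finite) auto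
      have "eventually (\<lambda>j. \<forall>w\<in>cball c (1 / 2). dist (L j c w $ b) (G c w $ b) < \<kappa>) F"
        using ul \<kappa> by (rule uniform_limitD)
      with e1 show ?thesis
      proof eventually_elim
        case (elim j)
        show ?case
        proof
          fix w assume w: "w \<in> cball c (1 / 2)"
          have "dist (L j c w $ b) (G c w $ b) < \<kappa>" using elim(2) w by blast
          then have "L j c w $ b \<noteq> 0" using Gb[OF sub[OF w]] by auto
          moreover have "norm ((u $ b / L j c w $ b) *s L j c w - u) \<le> (\<Sum>l\<in>(UNIV :: 'i set). \<epsilon>)"
          proof (rule order_trans[OF norm_vec_le_sum sum_mono])
            fix l
            have Gb0: "G c w $ b \<noteq> 0" using Gb[OF sub[OF w]] \<kappa> by auto
            have ul: "u $ l = u $ b * (G c w $ l / G c w $ b)"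
              unfolding u_def vector_smult_component mult.assoc
              by (rule arg_cong) (use v(2)[OF sub[OF w], of l b] Gb0 in \<open>simp add: field_simps\<close>)
            have "((u $ b / L j c w $ b) *s L j c w - u) $ l
                = u $ b * (L j c w $ l / L j c w $ b - G c w $ l / G c w $ b)"
              unfolding vector_minus_component vector_smult_component by (subst ul) (simp add: algebra_simps)
            then have "norm (((u $ b / L j c w $ b) *s L j c w - u) $ l)
                = norm (u $ b) * dist (L j c w $ l / L j c w $ b) (G c w $ l / G c w $ b)"
              by (simp add: norm_mult dist_norm)
            also have "\<dots> \<le> norm (u $ b) * (\<epsilon> / norm (u $ b))"
              using elim(1) w by (intro mult_left_mono) (auto intro: less_imp_le)
            finally show "norm (((u $ b / L j c w $ b) *s L j c w - u) $ l) \<le> \<epsilon>" using u(2) by simp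
          qed
          ultimately show "L j c w $ b \<noteq> 0 \<and> norm ((u $ b / L j c w $ b) *s L j c w - u) \<le> 1 / 2"
            by (simp add: \<epsilon>_def)
        qed
      qed
    qed
    obtain N where N: "finite N" "cball (0 :: complex) 2 \<subseteq> (\<Union>c\<in>N. ball c (1 / 2))"
      using compact_imp_seq_compact[OF compact_cball, THEN seq_compact_imp_totally_bounded,
        rule_format, of "1 / 2" "0 :: complex" 2] by auto
    have "eventually (\<lambda>j. \<forall>c\<in>N. ?Q j c \<and> c \<in> ball 0 (real (Suc j))) F"
      by (rule eventually_ball_finite[OF N(1)]) (intro ballI eventually_conj evQ ev)
    then obtain j where j: "\<And>c. c \<in> N \<Longrightarrow> ?Q j c \<and> c \<in> ball 0 (real (Suc j))"
      using F(1) eventually_happens' by blast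
    have "has_balanced_lift (g j) 0 2"
    proof (rule has_balanced_lift_of_cover)
      show "ball 0 2 \<subseteq> (\<Union>c\<in>N. ball c (1 / 2))" using N(2) by auto
      fix c assume c: "c \<in> N"
      have sub: "ball c (1 / 2) \<subseteq> ball c 1" by auto
      show "(\<lambda>w. L j c w $ l) holomorphic_on ball c (1 / 2)" for l
        using j[OF c] L(1) sub holomorphic_on_subset by blast
      fix w assume w: "w \<in> ball c (1 / 2)"
      then have "w \<in> ball c 1" "w \<in> cball c (1 / 2)" by auto
      then show "L j c w $ b \<noteq> 0 \<and> g j w = proj_pt (L j c w)"
        "norm ((u $ b / L j c w $ b) *s L j c w - u) \<le> 1 / 2"
        using j[OF c] L(2) by blast+
    qed (use u in auto)
    with g(2) show False by blast
  qed
  ultimately show ?thesis by blast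
qed

section \<open>Brody curves in Fermat covers\<close>

lemma holomorphic_mult_nonzero:
  assumes "open U" "connected U" "f holomorphic_on U" "g holomorphic_on U"
    and "\<exists>w\<in>U. f w \<noteq> 0" "\<exists>w\<in>U. g w \<noteq> (0 :: complex)"
  shows "\<exists>w\<in>U. f w * g w \<noteq> 0"
proof (rule ccontr)
  assume neg: "\<not> ?thesis"
  have "open (U \<inter> f -` (- {0}))"
    using assms by (intro continuous_open_preimage holomorphic_on_imp_continuous_on) auto
  then have "g w = 0" if "w \<in> U" for w
    by (rule analytic_continuation_open[of "U \<inter> f -` (- {0})" U g "\<lambda>_. 0"]) (use assms neg that in auto)
  with assms(6) show False by blast
qed

lemma holomorphic_prod_nonzero:
  assumes "finite I" "open U" "connected U" "U \<noteq> {}"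
    and "\<And>i. i \<in> I \<Longrightarrow> f i holomorphic_on U" "\<And>i. i \<in> I \<Longrightarrow> \<exists>w\<in>U. f i w \<noteq> (0 :: complex)"
  shows "\<exists>w\<in>U. (\<Prod>i\<in>I. f i w) \<noteq> 0"
  using assms(1,5,6)
proof (induction I rule: finite_induct)
  case empty
  then show ?case using assms(4) by auto
next
  case (insert i I)
  have "\<exists>w\<in>U. f i w * (\<Prod>i\<in>I. f i w) \<noteq> 0"
    by (intro holomorphic_mult_nonzero assms insert.IH holomorphic_intros insert.prems) auto
  then show ?case using insert by simp
qed

text \<open>The positivity of the degree of the jet differential used below. With \<open>n' = n - s\<close> and
  \<open>k = r - 1\<close> it follows from \<open>4 (n' - k + 1) (k + 1) \<le> (n' + 2)\<^sup>2\<close>.\<close>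

lemma degree_inequality:
  fixes n m d r s :: nat
  assumes "n \<ge> 1" "m \<ge> 2 * n + 2" "2 * d \<ge> (n + 1) * (n + 2)" "r \<ge> 1" "r + s \<le> n + 1"
  shows "m * r * (n + 2 - r - s) < (m - (r - 1)) * (d - s)"
proof -
  define k where "k = r - 1"
  define n' where "n' = n - s"
  have rk: "r = k + 1" using assms(4) by (simp add: k_def)
  have sn: "n = n' + s" "k \<le> n'" "n + 2 - r - s = n' - k + 1" 
    using assms(5) rk by (auto simp: n'_def)
  \<comment> \<open>Removing \<open>s\<close> identically vanishing coordinates lowers the dimension
    to \<open>n'\<close>; the identity shows that \<open>d - s\<close> still satisfies the analogous
    bound, with \<open>s * s + s\<close> to spare.\<close>
  have "(n' + s + 1) * (n' + s + 2) = (n' + 1) * (n' + 2) + 2 * s + (2 * n' * s + s * s + s)"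
    by (simp add: algebra_simps)
  then have d: "2 * d \<ge> (n' + 1) * (n' + 2) + 2 * s + (s * s + s)" 
    using assms(3)[unfolded sn(1)] by linarith
  then have sd: "s \<le> d" by linarith
  define D where "D = d - s"
  have D: "2 * D \<ge> (n' + 1) * (n' + 2) + (s * s + s)" using d sd by (simp add: D_def)
  have m: "m \<ge> 2 * n' + 2" using assms(2) sn by simp
  show ?thesis
  proof (cases "n' = 0")
    case True
    then have "k = 0" "s \<ge> 1" using sn assms(1) by auto
    then have "D \<ge> 2" using D True by (cases s) auto
    then show ?thesis
      using \<open>k = 0\<close> True m unfolding sn(3) unfolding D_def[symmetric] k_def[symmetric] rk by simp
  next
    case False
    have km: "k \<le> m" using sn m by linarith
    \<comment> \<open>Here the lower bound on \<open>m\<close> enters: the difference of the two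
      sides is \<open>k * (m - (2 * n' + 2))\<close>.\<close>
    have "(int m - int k) * (2 * int n' + 2) \<ge> int m * (2 * int n' + 2 - int k)"
    proof -
      have "(int m - int k) * (2 * int n' + 2) - int m * (2 * int n' + 2 - int k)
          = int k * (int m - (2 * int n' + 2))" by (simp add: algebra_simps)
      also have "\<dots> \<ge> 0" using m by (intro mult_nonneg_nonneg) auto
      finally show ?thesis by simp
    qed
    then have "(2 * int D) * ((int m - int k) * (2 * int n' + 2)) \<ge> 2 * int D * (int m * (2 * int n' + 2 - int k))"
      by (intro mult_left_mono) auto
    moreover have "2 * int D * (int m * (2 * int n' + 2 - int k)) \<ge>
        ((int n' + 1) * (int n' + 2)) * (int m * (2 * int n' + 2 - int k))"
    proof (rule mult_right_mono)
      have "int (2 * D) \<ge> int ((n' + 1) * (n' + 2))" using D by linarith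
      then show "(int n' + 1) * (int n' + 2) \<le> 2 * int D" by (simp add: algebra_simps)
    qed (use sn in auto)
    ultimately have "(int n' + 1) * (4 * int D * (int m - int k)) \<ge>
        (int n' + 1) * ((int n' + 2) * (int m * (2 * int n' + 2 - int k)))"
      by (simp add: algebra_simps)
    then have 1: "4 * int D * (int m - int k) \<ge> (int n' + 2) * (int m * (2 * int n' + 2 - int k))"
      by (rule mult_left_le_imp_le) simp
    have "(int n' - 2 * int k) ^ 2 \<ge> 0" by simp
    then have 2: "4 * ((int n' - int k + 1) * (int k + 1)) \<le> (int n' + 2) * (int n' + 2)"
      by (simp add: algebra_simps power2_eq_square)
    \<comment> \<open>Strictness has two sources. If \<open>k = n'\<close>, then
      \<open>4 * (n' + 1) < (n' + 2)^2\<close> as \<open>n' > 0\<close>; otherwise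
      \<open>n' + 2 < 2 * n' + 2 - k\<close>.\<close>
    have "4 * (int m * (int k + 1) * (int n' - int k + 1)) < 4 * int D * (int m - int k)"
    proof (cases "k = n'")
      case True
      have "4 * (int m * (int k + 1) * (int n' - int k + 1)) = int m * (4 * (int n' + 1))"
        using True by simp
      also have "\<dots> < int m * ((int n' + 2) * (int n' + 2))"
        using m False by (intro mult_strict_left_mono) (auto simp: algebra_simps)
      also have "\<dots> \<le> 4 * int D * (int m - int k)" using 1 True by (simp add: algebra_simps)
      finally show ?thesis .
    next
      case kn: False
      have "4 * (int m * (int k + 1) * (int n' - int k + 1)) = int m * (4 * ((int n' - int k + 1) * (int k + 1)))"
        by (simp add: algebra_simps)
      also have "\<dots> \<le> int m * ((int n' + 2) * (int n' + 2))"
        using 2 by (intro mult_left_mono) auto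
      also have "\<dots> < int m * ((int n' + 2) * (2 * int n' + 2 - int k))"
        using m kn sn(2) by (intro mult_strict_left_mono) auto
      also have "\<dots> \<le> 4 * int D * (int m - int k)" using 1 by (simp add: algebra_simps)
      finally show ?thesis .
    qed
    then have "int m * (int k + 1) * (int n' - int k + 1) < int D * (int m - int k)" by linarith
    then have "int (m * r * (n' - k + 1)) < int ((m - k) * D)"
      by (simp only: rk of_nat_mult of_nat_add of_nat_diff[OF km] of_nat_diff[OF sn(2)] of_nat_1 mult.commute)
    then show ?thesis unfolding sn(3) D_def k_def[symmetric] by linarith
  qed
qed

lemma sum_restrict_mult:
  fixes f :: "'a::finite \<Rightarrow> complex"
  shows "(\<Sum>\<gamma>\<in>UNIV. (if \<gamma> \<in> B then u \<gamma> else 0) * f \<gamma>) = (\<Sum>\<gamma>\<in>B. u \<gamma> * f \<gamma>)"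
  by (rule sum.mono_neutral_cong_right) auto

lemma sum_axis_mult:
  fixes f :: "'a::finite \<Rightarrow> complex"
  shows "(\<Sum>\<gamma>\<in>UNIV. axis \<alpha> 1 $ \<gamma> * f \<gamma>) = f \<alpha>"
  using sum_restrict_mult[of "{\<alpha>}" "\<lambda>_. 1" f] by (simp add: axis_def)

section \<open>Lifts, linear relations and vanishing coordinates of the curve\<close>

text \<open>Fermat equations and general position enter through \<open>span\<close>: any
  \<open>n + 1\<close> of the \<open>m\<close>-th powers span all of them, with coefficients that
  depend neither on the point nor on the lift.\<close>

locale fermat_curve =
  fixes G :: "complex \<Rightarrow> complex \<Rightarrow> complex ^ 'a::finite" and m n :: nat
  assumes curve: "brody_curve G"
    and span: "\<And>S :: 'a set. card S = n + 1 \<Longrightarrow> \<exists>q. \<forall>\<alpha> c. \<forall>w\<in>ball c 1.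
      (G c w $ \<alpha>) ^ m = (\<Sum>\<beta>\<in>S. q \<alpha> \<beta> * (G c w $ \<beta>) ^ m)"
    and n_pos: "n \<ge> 1" and m_ge: "m \<ge> 2 * n + 2"
    and card_ge: "2 * CARD('a) \<ge> (n + 1) * (n + 2)"
begin

definition X :: "complex \<Rightarrow> 'a \<Rightarrow> complex \<Rightarrow> complex" where "X c \<alpha> w = (G c w $ \<alpha>) ^ m"

definition zeros :: "'a set" where "zeros = {\<alpha>. \<forall>w\<in>ball 0 1. G 0 w $ \<alpha> = 0}"

lemma hol: "(\<lambda>w. G c w $ \<alpha>) holomorphic_on ball c 1"
  using curve unfolding brody_curve_def by blast

lemma norm_bounds: "w \<in> ball c 1 \<Longrightarrow> 1 \<le> norm (G c w)" "w \<in> ball c 1 \<Longrightarrow> norm (G c w) \<le> 2"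
  using curve unfolding brody_curve_def by blast+

lemma comp_le: "w \<in> ball c 1 \<Longrightarrow> norm (G c w $ \<alpha>) \<le> 2"
  using norm_bounds(2)[of w c] Finite_Cartesian_Product.norm_nth_le[of "G c w" \<alpha>] by linarith

lemma G_nonzero: "w \<in> ball c 1 \<Longrightarrow> \<exists>\<alpha>. G c w $ \<alpha> \<noteq> 0"
  using norm_bounds(1)[of w c] Finite_Cartesian_Product.vec_eq_iff[of "G c w" 0] by force

lemma hol_X: "X c \<alpha> holomorphic_on ball c 1"
  unfolding X_def[abs_def] by (intro holomorphic_intros hol)

lemma cross: "w \<in> ball c 1 \<Longrightarrow> w \<in> ball c' 1 \<Longrightarrow> G c w $ a * G c' w $ b = G c w $ b * G c' w $ a"
  using curve unfolding brody_curve_def by blast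

lemma m_pos: "m > 0" using m_ge by simp

text \<open>The ratio of one nonvanishing coordinate serves for all coordinates by
  \<open>cross\<close>, and it has no zero because no lift vanishes. It exists near
  \<open>w0\<close> only, which is enough for pointwise identities.\<close>

lemma transition:
  assumes w0: "w0 \<in> ball c 1" "w0 \<in> ball c' 1"
  obtains U g where "open U" "w0 \<in> U" "U \<subseteq> ball c 1" "U \<subseteq> ball c' 1" "g holomorphic_on U"
    "\<And>v. v \<in> U \<Longrightarrow> g v \<noteq> 0" "\<And>v \<alpha>. v \<in> U \<Longrightarrow> G c' v $ \<alpha> = g v * G c v $ \<alpha>"
proof -
  obtain i where i: "G c w0 $ i \<noteq> 0" using G_nonzero w0 by blast
  define U where "U = ball c' 1 \<inter> (ball c 1 \<inter> (\<lambda>w. G c w $ i) -` (- {0}))"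
  define g where "g v = G c' v $ i / G c v $ i" for v
  have U: "w0 \<in> U" "U \<subseteq> ball c 1" "U \<subseteq> ball c' 1" "\<And>v. v \<in> U \<Longrightarrow> G c v $ i \<noteq> 0"
    using w0 i by (auto simp: U_def)
  have op: "open U" unfolding U_def
    by (intro open_Int open_ball continuous_open_preimage holomorphic_on_imp_continuous_on hol) auto
  have eq: "G c' v $ \<alpha> = g v * G c v $ \<alpha>" if "v \<in> U" for v \<alpha>
    using cross[OF subsetD[OF U(2) that] subsetD[OF U(3) that], of \<alpha> i] U(4)[OF that]
    by (simp add: g_def field_simps)
  have nz: "g v \<noteq> 0" if "v \<in> U" for v
  proof
    assume "g v = 0"
    then have "G c' v $ \<alpha> = 0" for \<alpha> using eq[OF that] by simp
    then show False using G_nonzero[of v c'] that U(3) by blast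
  qed
  have "g holomorphic_on U" unfolding g_def[abs_def]
    using U by (intro holomorphic_intros holomorphic_on_subset[OF hol]) auto
  then show ?thesis using that[of U g] op U(1-3) nz eq by blast
qed

definition Rel :: "complex \<Rightarrow> ('a \<Rightarrow> complex) \<Rightarrow> bool" where
  "Rel c q \<longleftrightarrow> (\<forall>w\<in>ball c 1. (\<Sum>\<alpha>\<in>UNIV. q \<alpha> * X c \<alpha> w) = 0)"

text \<open>On an overlap all \<open>X\<close> are multiplied by the same factor
  \<open>g ^ m\<close>, so linear relations carry over; the identity theorem extends them to the new
  ball.\<close>

lemma Rel_near:
  assumes "Rel c q" "dist c c' < 1"
  shows "Rel c' q"
  unfolding Rel_def
proof
  fix w assume w: "w \<in> ball c' 1"
  show "(\<Sum>\<alpha>\<in>UNIV. q \<alpha> * X c' \<alpha> w) = 0"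
  proof (rule analytic_continuation_open[of "ball c 1 \<inter> ball c' 1" "ball c' 1" "\<lambda>w. \<Sum>\<alpha>\<in>UNIV. q \<alpha> * X c' \<alpha> w" "\<lambda>_. 0"])
    show "ball c 1 \<inter> ball c' 1 \<noteq> {}" using assms(2) by (auto intro!: exI[of _ c'])
    fix z assume "z \<in> ball c 1 \<inter> ball c' 1"
    then have z: "z \<in> ball c 1" "z \<in> ball c' 1" by auto
    obtain U g where "z \<in> U" "\<And>v \<alpha>. v \<in> U \<Longrightarrow> G c' v $ \<alpha> = g v * G c v $ \<alpha>"
      using transition[OF z] by metis
    then have "(\<Sum>\<alpha>\<in>UNIV. q \<alpha> * X c' \<alpha> z) = g z ^ m * (\<Sum>\<alpha>\<in>UNIV. q \<alpha> * X c \<alpha> z)"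
      by (simp add: X_def power_mult_distrib sum_distrib_left mult_ac)
    then show "(\<Sum>\<alpha>\<in>UNIV. q \<alpha> * X c' \<alpha> z) = 0" using assms(1) z by (simp add: Rel_def)
  qed (use w in \<open>auto intro!: holomorphic_intros hol_X\<close>)
qed

text \<open>By \<open>Rel_near\<close> validity of a relation is locally constant in the centre, and
  the plane is connected.\<close>

lemma Rel_eq: "Rel c q \<longleftrightarrow> Rel c' q"
proof (rule connected_local_const[of UNIV c c' "\<lambda>c. Rel c q"])
  show "\<forall>a\<in>UNIV. \<forall>\<^sub>F b in at a within UNIV. Rel a q = Rel b q"
  proof
    fix a :: complex
    have "\<forall>\<^sub>F b in at a. dist b a < 1" by (simp add: eventually_at_filter eventually_nhds_metric)
        (auto intro!: exI[of _ 1])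
    then show "\<forall>\<^sub>F b in at a within UNIV. Rel a q = Rel b q"
      by eventually_elim (use Rel_near dist_commute in metis)
  qed
qed auto

lemma zeros_iff: "\<alpha> \<in> zeros \<longleftrightarrow> (\<forall>w\<in>ball c 1. G c w $ \<alpha> = 0)"
proof -
  have "Rel c (\<lambda>\<beta>. if \<beta> = \<alpha> then 1 else 0) \<longleftrightarrow> (\<forall>w\<in>ball c 1. G c w $ \<alpha> = 0)" for c
    using m_pos by (simp add: Rel_def X_def if_distrib if_distribR cong: if_cong)
  then show ?thesis using Rel_eq[of c _ 0] unfolding zeros_def mem_Collect_eq by metis
qed

section \<open>Bases of the span of the coordinate powers\<close>

definition basis :: "nat \<Rightarrow> 'a set \<Rightarrow> bool" where
  "basis r B \<longleftrightarrow> card B = r \<and>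
     (\<exists>A. \<forall>\<alpha> c. \<forall>w\<in>ball c 1. X c \<alpha> w = (\<Sum>\<beta>\<in>B. A \<alpha> \<beta> * X c \<beta> w)) \<and>
     (\<forall>c q. (\<forall>w\<in>ball c 1. (\<Sum>\<beta>\<in>B. q \<beta> * X c \<beta> w) = 0) \<longrightarrow> (\<forall>\<beta>\<in>B. q \<beta> = 0))"


lemma Rel_supported:
  "Rel c (\<lambda>\<alpha>. if \<alpha> \<in> B then q \<alpha> else 0) \<longleftrightarrow> (\<forall>w\<in>ball c 1. (\<Sum>\<beta>\<in>B. q \<beta> * X c \<beta> w) = 0)"
  unfolding Rel_def sum_restrict_mult ..

text \<open>Bases of the span of the functions \<open>X c \<alpha>\<close> are bases of the coordinate space modulo the
  relations, so the exchange property of the vectors \<open>axis \<alpha> 1\<close> applies.\<close>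

lemma basis_exists:
  obtains r where "\<And>S. card S = n + 1 \<Longrightarrow> \<exists>B\<subseteq>S. basis r B"
    "\<And>\<alpha>. \<alpha> \<notin> zeros \<Longrightarrow> \<exists>B. \<alpha> \<in> B \<and> basis r B"
proof -
  define K :: "(complex ^ 'a) set" where "K = {v. Rel 0 (($) v)}"
  define ax :: "'a \<Rightarrow> complex ^ 'a" where "ax \<alpha> = axis \<alpha> 1" for \<alpha>
  have inj_ax: "inj ax" by (auto simp: inj_def ax_def axis_eq_axis)
  have inK: "v \<in> K \<longleftrightarrow> Rel c (($) v)" for v c using Rel_eq[of c _ 0] by (simp add: K_def)
  have subK: "vec.subspace K"
    unfolding vec.subspace_def K_def Rel_def
    by (auto simp: distrib_right sum.distrib mult.assoc sum_distrib_left[symmetric])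
  obtain R0 where R0: "R0 \<subseteq> K" "vec.independent R0" "K \<subseteq> vec.span R0"
    using vec.basis_exists[of K] by metis
  have finR0: "finite R0" using R0(2) by (rule vec.finiteI_independent)
  have spanR0: "vec.span R0 = K" using R0 subK vec.span_minimal by blast
  \<comment> \<open>The codimension of the space of relations, that is, the dimension of the span of
    the functions.\<close>
  define r where "r = CARD('a) - card R0"
  have lin_comb: "(\<Sum>\<beta>\<in>B. u \<beta> *s ax \<beta>) $ \<gamma> = (if \<gamma> \<in> B then u \<gamma> else 0)" for B u \<gamma>
    by (simp add: ax_def axis_def if_distrib cong: if_cong)
  \<comment> \<open>Coordinate vectors completing \<open>R0\<close> to a basis of the whole space
    give a basis of the functions: spanning yields the coefficients, and independence excludes
    relations supported on \<open>B\<close>.\<close>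
  have core: "basis r B" if disj: "R0 \<inter> ax ` B = {}" and ind: "vec.independent (R0 \<union> ax ` B)"
    and sp: "vec.span (R0 \<union> ax ` B) = UNIV" for B
    unfolding basis_def
  proof (intro conjI)
    have "card (R0 \<union> ax ` B) = vec.dim (UNIV :: (complex ^ 'a) set)"
      using ind sp vec.dim_eq_card[of "R0 \<union> ax ` B" UNIV] by simp
    also have "\<dots> = CARD('a)" by (rule vec_dim_card)
    finally have "card R0 + card B = CARD('a)"
      using disj finR0 card_image[OF inj_on_subset[OF inj_ax], of B] by (simp add: card_Un_disjoint)
    then show "card B = r" by (simp add: r_def)
    have "\<exists>u. \<forall>c. \<forall>w\<in>ball c 1. X c \<alpha> w = (\<Sum>\<beta>\<in>B. u \<beta> * X c \<beta> w)" for \<alpha>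
    proof -
      have "ax \<alpha> \<in> vec.span (R0 \<union> ax ` B)" using sp by simp
      then obtain x y where xy: "ax \<alpha> = x + y" "x \<in> vec.span R0" "y \<in> vec.span (ax ` B)"
        unfolding vec.span_Un by auto
      obtain u where "y = (\<Sum>v\<in>ax ` B. u v *s v)" using xy(3) by (auto simp: vec.span_finite)
      then have y: "y = (\<Sum>\<beta>\<in>B. u (ax \<beta>) *s ax \<beta>)"
        by (simp add: sum.reindex inj_on_subset[OF inj_ax])
      have "X c \<alpha> w = (\<Sum>\<beta>\<in>B. u (ax \<beta>) * X c \<beta> w)" if w: "w \<in> ball c 1" for c w
      proof -
        have "X c \<alpha> w = (\<Sum>\<gamma>\<in>UNIV. ax \<alpha> $ \<gamma> * X c \<gamma> w)"
          unfolding ax_def sum_axis_mult ..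
        also have "\<dots> = (\<Sum>\<gamma>\<in>UNIV. x $ \<gamma> * X c \<gamma> w) + (\<Sum>\<gamma>\<in>UNIV. y $ \<gamma> * X c \<gamma> w)"
          by (simp add: xy(1) distrib_right sum.distrib)
        also have "(\<Sum>\<gamma>\<in>UNIV. x $ \<gamma> * X c \<gamma> w) = 0"
          using xy(2) w unfolding spanR0 inK[of _ c] Rel_def by blast
        also have "(\<Sum>\<gamma>\<in>UNIV. y $ \<gamma> * X c \<gamma> w) = (\<Sum>\<beta>\<in>B. u (ax \<beta>) * X c \<beta> w)"
          unfolding y lin_comb sum_restrict_mult ..
        finally show ?thesis by simp
      qed
      then show ?thesis by (intro exI[of _ "\<lambda>\<beta>. u (ax \<beta>)"] allI ballI)
    qed
    then show "\<exists>A. \<forall>\<alpha> c. \<forall>w\<in>ball c 1. X c \<alpha> w = (\<Sum>\<beta>\<in>B. A \<alpha> \<beta> * X c \<beta> w)"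
      by (intro choice allI)
    show "\<forall>c q. (\<forall>w\<in>ball c 1. (\<Sum>\<beta>\<in>B. q \<beta> * X c \<beta> w) = 0) \<longrightarrow> (\<forall>\<beta>\<in>B. q \<beta> = 0)"
    proof (intro allI impI ballI, rule ccontr)
      fix c q \<beta> assume q: "\<forall>w\<in>ball c 1. (\<Sum>\<beta>\<in>B. q \<beta> * X c \<beta> w) = 0" and \<beta>: "\<beta> \<in> B" "q \<beta> \<noteq> 0"
      define v where "v = (\<Sum>\<gamma>\<in>B. q \<gamma> *s ax \<gamma>)"
      have "(($) v) = (\<lambda>\<alpha>. if \<alpha> \<in> B then q \<alpha> else 0)" unfolding v_def lin_comb ..
      then have "v \<in> K" using q by (simp add: inK[of _ c] Rel_supported)
      define T where "T = R0 \<union> ax ` B - {ax \<beta>}"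
      have "v \<in> vec.span T"
        using \<open>v \<in> K\<close> spanR0 disj \<beta>(1) vec.span_mono[of R0 T] by (auto simp: T_def)
      moreover have "ax \<gamma> \<in> vec.span T" if "\<gamma> \<in> B - {\<beta>}" for \<gamma>
        using that inj_ax by (intro vec.span_base) (auto simp: T_def inj_def)
      then have "(\<Sum>\<gamma>\<in>B - {\<beta>}. q \<gamma> *s ax \<gamma>) \<in> vec.span T"
        by (intro vec.span_sum vec.span_scale)
      ultimately have "v - (\<Sum>\<gamma>\<in>B - {\<beta>}. q \<gamma> *s ax \<gamma>) \<in> vec.span T" by (rule vec.span_diff)
      also have "v - (\<Sum>\<gamma>\<in>B - {\<beta>}. q \<gamma> *s ax \<gamma>) = q \<beta> *s ax \<beta>"
        unfolding v_def using \<beta>(1) by (subst sum.remove[of B \<beta>]) auto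
      finally have "inverse (q \<beta>) *s (q \<beta> *s ax \<beta>) \<in> vec.span T" by (rule vec.span_scale)
      then have "ax \<beta> \<in> vec.span T" using \<beta>(2) by simp
      then have "vec.dependent (R0 \<union> ax ` B)"
        unfolding vec.dependent_def T_def using \<beta>(1) by blast
      with ind show False by blast
    qed
  qed
  \<comment> \<open>The set \<open>T\<close> is forced into the basis. It is empty for the choice
    inside \<open>S\<close>, and a single vector when a prescribed coordinate has to belong to
    \<open>B\<close>.\<close>
  have ext: "\<exists>B\<subseteq>S. basis r B \<and> T \<subseteq> R0 \<union> ax ` B" if sp: "\<And>\<alpha>. ax \<alpha> \<in> vec.span (R0 \<union> ax ` S)"
    and T: "T \<subseteq> ax ` S" "vec.independent (R0 \<union> T)" for S T
  proof -
    have UN: "vec.span (R0 \<union> ax ` S) = UNIV"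
    proof (intro equalityI subsetI UNIV_I)
      fix v :: "complex ^ 'a"
      have "(\<Sum>\<alpha>\<in>UNIV. v $ \<alpha> *s ax \<alpha>) \<in> vec.span (R0 \<union> ax ` S)"
        by (intro vec.span_sum vec.span_scale sp)
      then show "v \<in> vec.span (R0 \<union> ax ` S)" unfolding ax_def basis_expansion .
    qed
    obtain Bs where Bs: "R0 \<union> T \<subseteq> Bs" "Bs \<subseteq> R0 \<union> ax ` S" "vec.independent Bs" "R0 \<union> ax ` S \<subseteq> vec.span Bs"
      using vec.maximal_independent_subset_extend[of "R0 \<union> T" "R0 \<union> ax ` S"] T by blast
    define B where "B = {\<beta>\<in>S. ax \<beta> \<in> Bs \<and> ax \<beta> \<notin> R0}"
    have eq: "R0 \<union> ax ` B = Bs" using Bs by (auto simp: B_def)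
    have "vec.span Bs = UNIV" using UN Bs(4) vec.span_minimal[OF Bs(4)] by auto
    then have "basis r B" using Bs eq by (intro core) (auto simp: B_def)
    moreover have "B \<subseteq> S" by (auto simp: B_def)
    ultimately show ?thesis using Bs(1) eq by blast
  qed
  show ?thesis
  proof (rule that[of r])
    fix S :: "'a set" assume "card S = n + 1"
    from span[OF this] obtain q where
      "\<forall>\<alpha> c. \<forall>w\<in>ball c 1. (G c w $ \<alpha>) ^ m = (\<Sum>\<beta>\<in>S. q \<alpha> \<beta> * (G c w $ \<beta>) ^ m)"
      by (elim exE)
    then have q: "\<And>\<alpha> c w. w \<in> ball c 1 \<Longrightarrow> X c \<alpha> w = (\<Sum>\<beta>\<in>S. q \<alpha> \<beta> * X c \<beta> w)"
      by (simp add: X_def)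
    have "ax \<alpha> \<in> vec.span (R0 \<union> ax ` S)" for \<alpha>
    proof -
      let ?y = "\<Sum>\<beta>\<in>S. q \<alpha> \<beta> *s ax \<beta>"
      have "ax \<alpha> - ?y \<in> K"
        unfolding inK[of _ 0] Rel_def
      proof
        fix w :: complex assume w: "w \<in> ball 0 1"
        have "(\<Sum>\<gamma>\<in>UNIV. (ax \<alpha> - ?y) $ \<gamma> * X 0 \<gamma> w)
            = (\<Sum>\<gamma>\<in>UNIV. ax \<alpha> $ \<gamma> * X 0 \<gamma> w) - (\<Sum>\<gamma>\<in>UNIV. ?y $ \<gamma> * X 0 \<gamma> w)"
          unfolding vector_minus_component by (simp add: left_diff_distrib sum_subtractf)
        also have "(\<Sum>\<gamma>\<in>UNIV. ax \<alpha> $ \<gamma> * X 0 \<gamma> w) = X 0 \<alpha> w"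
          unfolding ax_def sum_axis_mult ..
        also have "(\<Sum>\<gamma>\<in>UNIV. ?y $ \<gamma> * X 0 \<gamma> w) = (\<Sum>\<beta>\<in>S. q \<alpha> \<beta> * X 0 \<beta> w)"
          unfolding lin_comb sum_restrict_mult ..
        also have "X 0 \<alpha> w - (\<Sum>\<beta>\<in>S. q \<alpha> \<beta> * X 0 \<beta> w) = 0"
          using q[OF w, of \<alpha>] unfolding right_minus_eq .
        finally show "(\<Sum>\<gamma>\<in>UNIV. (ax \<alpha> - ?y) $ \<gamma> * X 0 \<gamma> w) = 0" .
      qed
      then have "ax \<alpha> - ?y \<in> vec.span (R0 \<union> ax ` S)" using spanR0 vec.span_mono[of R0 "R0 \<union> ax ` S"] by blast
      moreover have "?y \<in> vec.span (R0 \<union> ax ` S)"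
        by (intro vec.span_sum vec.span_scale vec.span_base) auto
      ultimately have "ax \<alpha> - ?y + ?y \<in> vec.span (R0 \<union> ax ` S)" by (rule vec.span_add)
      then show ?thesis by simp
    qed
    then show "\<exists>B\<subseteq>S. basis r B" using ext[of S "{}"] R0(2) by auto
  next
    fix \<alpha> assume \<alpha>: "\<alpha> \<notin> zeros"
    have "ax \<alpha> \<notin> K"
    proof
      assume "ax \<alpha> \<in> K"
      then have "\<forall>w\<in>ball 0 1. X 0 \<alpha> w = 0"
        unfolding inK[of _ 0] Rel_def ax_def sum_axis_mult .
      then show False using \<alpha> by (simp add: zeros_def X_def)
    qed
    then have "vec.independent (R0 \<union> {ax \<alpha>})"
      using R0(2) spanR0 vec.independent_insert[of "ax \<alpha>" R0] R0(1) by auto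
    moreover have "ax \<beta> \<in> vec.span (R0 \<union> ax ` UNIV)" for \<beta> by (intro vec.span_base) auto
    ultimately obtain B where "basis r B" "{ax \<alpha>} \<subseteq> R0 \<union> ax ` B"
      using ext[of UNIV "{ax \<alpha>}"] by auto
    then have "\<alpha> \<in> B" using \<open>ax \<alpha> \<notin> K\<close> R0(1) inj_ax by (auto simp: inj_def)
    then show "\<exists>B. \<alpha> \<in> B \<and> basis r B" using \<open>basis r B\<close> by blast
  qed
qed

section \<open>The Wronskian of a basis\<close>

definition enum :: "'a set \<Rightarrow> nat \<Rightarrow> 'a" where
  "enum B = (SOME e. bij_betw e {..<card B} B)"

lemma bij_enum: "bij_betw (enum B) {..<card B} B"
proof -
  have "\<exists>e. bij_betw e {..<card B} B"
    using ex_bij_betw_nat_finite[of B] by (simp add: lessThan_atLeast0)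
  then show ?thesis unfolding enum_def by (rule someI_ex)
qed

definition Wr :: "'a set \<Rightarrow> complex \<Rightarrow> complex \<Rightarrow> complex" where
  "Wr B c = wronsk (card B) (\<lambda>i. X c (enum B i))"

lemma hol_Wr: "Wr B c holomorphic_on ball c 1"
  unfolding Wr_def by (intro holomorphic_wronsk open_ball hol_X)

lemma basisD:
  assumes "basis r B"
  shows "card B = r"
    and "\<exists>A. \<forall>\<alpha> c. \<forall>w\<in>ball c 1. X c \<alpha> w = (\<Sum>\<beta>\<in>B. A \<alpha> \<beta> * X c \<beta> w)"
    and "(\<And>w. w \<in> ball c 1 \<Longrightarrow> (\<Sum>\<beta>\<in>B. q \<beta> * X c \<beta> w) = 0) \<Longrightarrow> \<beta> \<in> B \<Longrightarrow> q \<beta> = 0"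
proof -
  show "card B = r" using assms unfolding basis_def by (elim conjE)
  show "\<exists>A. \<forall>\<alpha> c. \<forall>w\<in>ball c 1. X c \<alpha> w = (\<Sum>\<beta>\<in>B. A \<alpha> \<beta> * X c \<beta> w)"
    using assms unfolding basis_def by (elim conjE)
  have *: "\<forall>c q. (\<forall>w\<in>ball c 1. (\<Sum>\<beta>\<in>B. q \<beta> * X c \<beta> w) = 0) \<longrightarrow> (\<forall>\<beta>\<in>B. q \<beta> = 0)"
    using assms unfolding basis_def by (elim conjE)
  show "q \<beta> = 0" if "\<And>w. w \<in> ball c 1 \<Longrightarrow> (\<Sum>\<beta>\<in>B. q \<beta> * X c \<beta> w) = 0" "\<beta> \<in> B"
    using *[rule_format, of c q \<beta>] that by simp
qed

text \<open>The factor is the determinant of the constant matrix of the change of basis, hence the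
  same on all balls.\<close>

lemma Wr_change_basis:
  assumes "basis r B" "basis r B'"
  shows "\<exists>\<kappa>. \<forall>c. \<forall>w\<in>ball c 1. Wr B' c w = \<kappa> * Wr B c w"
proof -
  from basisD(2)[OF assms(1)] obtain A where
    A: "\<forall>\<alpha> c. \<forall>w\<in>ball c 1. X c \<alpha> w = (\<Sum>\<beta>\<in>B. A \<alpha> \<beta> * X c \<beta> w)"
    by (elim exE)
  have cards: "card B = r" "card B' = r" using assms basisD(1) by auto
  let ?M = "Matrix.mat r r (\<lambda>(i, l). A (enum B' i) (enum B l))"
  have "Wr B' c w = Determinant.det ?M * Wr B c w" if w: "w \<in> ball c 1" for c w
    unfolding Wr_def cards
  proof (rule wronsk_linear_comb[OF open_ball w])
    show "X c (enum B l) holomorphic_on ball c 1" for l by (rule hol_X)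
    fix i v assume "v \<in> ball c 1"
    then have "X c (enum B' i) v = (\<Sum>\<beta>\<in>B. A (enum B' i) \<beta> * X c \<beta> v)"
      by (rule A[rule_format])
    also have "\<dots> = (\<Sum>l<r. A (enum B' i) (enum B l) * X c (enum B l) v)"
      using bij_enum[of B] by (subst sum.reindex_bij_betw[symmetric]) (auto simp: cards)
    finally show "X c (enum B' i) v = (\<Sum>l<r. A (enum B' i) (enum B l) * X c (enum B l) v)" .
  qed
  then show ?thesis by (intro exI[of _ "Determinant.det ?M"] allI ballI)
qed

lemma Wr_nonzero:
  assumes "basis r B"
  shows "\<exists>w\<in>ball c 1. Wr B c w \<noteq> 0"
  unfolding Wr_def
proof (rule wronsk_nonzero)
  fix q :: "nat \<Rightarrow> complex"
  assume q: "\<And>w. w \<in> ball c 1 \<Longrightarrow> (\<Sum>i<card B. q i * X c (enum B i) w) = 0"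
  define q' where "q' \<beta> = q (inv_into {..<card B} (enum B) \<beta>)" for \<beta>
  have inv: "q' (enum B i) = q i" if "i < card B" for i
    using bij_enum[of B] that by (simp add: q'_def bij_betw_def inv_into_f_f)
  have "(\<Sum>\<beta>\<in>B. q' \<beta> * X c \<beta> w) = 0" if w: "w \<in> ball c 1" for w
  proof -
    have "(\<Sum>\<beta>\<in>B. q' \<beta> * X c \<beta> w) = (\<Sum>i<card B. q' (enum B i) * X c (enum B i) w)"
      using bij_enum[of B] by (rule sum.reindex_bij_betw[symmetric])
    also have "\<dots> = 0" using q[OF w] inv by simp
    finally show ?thesis .
  qed
  then have *: "q' \<beta> = 0" if "\<beta> \<in> B" for \<beta> using basisD(3)[OF assms] that by metis
  show "\<forall>i<card B. q i = 0"
  proof (intro allI impI)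
    fix i assume "i < card B"
    then show "q i = 0" using *[of "enum B i"] inv[of i] bij_betwE[OF bij_enum[of B]] by simp
  qed
qed (auto intro: hol_X)

lemma Wr_transition:
  assumes "open U" "w \<in> U" "U \<subseteq> ball c 1" "g holomorphic_on U"
    and "\<And>v \<alpha>. v \<in> U \<Longrightarrow> G c' v $ \<alpha> = g v * G c v $ \<alpha>"
  shows "Wr B c' w = g w ^ (m * card B) * Wr B c w"
proof -
  have "Wr B c' w = wronsk (card B) (\<lambda>i v. g v ^ m * X c (enum B i) v) w"
    unfolding Wr_def by (rule wronsk_cong[of U]) (use assms in \<open>auto simp: X_def power_mult_distrib\<close>)
  also have "\<dots> = (g w ^ m) ^ card B * Wr B c w"
    unfolding Wr_def
    by (rule wronsk_scale[of U]) (use assms in \<open>auto intro!: holomorphic_intros holomorphic_on_subset[OF hol_X]\<close>)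
  finally show ?thesis by (simp add: power_mult)
qed

text \<open>Only the centre is treated, where the unit ball of the lift gives uniform Cauchy
  estimates; other points are reached by changing to the lift centred there.\<close>

lemma norm_Wr_le:
  assumes "card B = r" "1 \<le> r" "r \<le> n + 1"
  shows "norm (Wr B c c) \<le> fact r * (fact (r - 1) * 3 ^ m * 8 ^ (r - 1)) ^ r *
    (\<Prod>\<beta>\<in>B. norm (G c c $ \<beta>) ^ (m - (r - 1)))"
proof -
  have "norm (Wr B c c) \<le> fact r * (fact (r - 1) * 3 ^ m * 8 ^ (r - 1)) ^ r *
    (\<Prod>i<r. norm (G c c $ enum B i) ^ (m - (r - 1)))"
    unfolding Wr_def assms(1)
  proof (rule norm_wronsk_le)
    fix i j assume ij: "i < r" "j < r"
    show "norm ((deriv ^^ j) (X c (enum B i)) c)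
        \<le> fact (r - 1) * 3 ^ m * 8 ^ (r - 1) * norm (G c c $ enum B i) ^ (m - (r - 1))"
      unfolding X_def[abs_def]
      by (rule norm_higher_deriv_power_le) (use ij assms m_ge in \<open>auto intro: hol comp_le\<close>)
  qed
  also have "(\<Prod>i<r. norm (G c c $ enum B i) ^ (m - (r - 1))) = (\<Prod>\<beta>\<in>B. norm (G c c $ \<beta>) ^ (m - (r - 1)))"
    using bij_enum[of B] unfolding assms(1) by (rule prod.reindex_bij_betw)
  finally show ?thesis .
qed

section \<open>Quantitative general position\<close>

text \<open>If all coordinates in \<open>S\<close> were small, then by \<open>span\<close> all
  coordinates would be, but the lift has norm at least \<open>1\<close>.\<close>

lemma component_lower_bound:
  assumes "card S = n + 1"
  shows "\<exists>\<epsilon>>0. \<forall>c. \<exists>\<alpha>\<in>S. \<epsilon> \<le> norm (G c c $ \<alpha>)"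
proof -
  from span[OF assms] obtain q where
    q: "\<forall>\<alpha> c. \<forall>w\<in>ball c 1. (G c w $ \<alpha>) ^ m = (\<Sum>\<beta>\<in>S. q \<alpha> \<beta> * (G c w $ \<beta>) ^ m)"
    by (elim exE)
  define M where "M = (\<Sum>\<alpha>\<in>UNIV. \<Sum>\<beta>\<in>S. norm (q \<alpha> \<beta>))"
  define N where "N = real CARD('a)"
  \<comment> \<open>Chosen so that \<open>M * \<epsilon> < (1 / N) ^ m\<close>: every coordinate is
    then below \<open>1 / N\<close>, and the \<open>N\<close> of them sum to less than
    \<open>1\<close>.\<close>
  define \<epsilon> where "\<epsilon> = 1 / ((M + 1) * N ^ m)"
  have M: "M \<ge> 0" unfolding M_def by (intro sum_nonneg) auto
  have N: "N \<ge> 1" unfolding N_def by (simp add: Suc_leI)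
  have \<epsilon>: "\<epsilon> > 0" using M N by (simp add: \<epsilon>_def)
  have "\<epsilon> \<le> 1" unfolding \<epsilon>_def using M N mult_mono[of 1 "M + 1" 1 "N ^ m"] one_le_power[of N m] by (simp add: divide_le_eq)
  have "\<exists>\<alpha>\<in>S. \<epsilon> \<le> norm (G c c $ \<alpha>)" for c
  proof (rule ccontr)
    assume "\<not> ?thesis"
    then have small: "norm (G c c $ \<beta>) < \<epsilon>" if "\<beta> \<in> S" for \<beta> using that by force
    have "norm (G c c $ \<alpha>) < 1 / N" for \<alpha>
    proof -
      have "norm (G c c $ \<alpha>) ^ m = norm (\<Sum>\<beta>\<in>S. q \<alpha> \<beta> * (G c c $ \<beta>) ^ m)"
        using q[rule_format, of c c \<alpha>] by (simp flip: norm_power)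
      also have "\<dots> \<le> (\<Sum>\<beta>\<in>S. norm (q \<alpha> \<beta>) * \<epsilon>)"
      proof (rule sum_norm_le)
        fix \<beta> assume "\<beta> \<in> S"
        have "norm (G c c $ \<beta>) ^ m \<le> \<epsilon> ^ m" using small[OF \<open>\<beta> \<in> S\<close>] by (intro power_mono) auto
        also have "\<dots> \<le> \<epsilon> ^ 1" using \<epsilon> \<open>\<epsilon> \<le> 1\<close> m_pos by (intro power_decreasing) auto
        finally show "norm (q \<alpha> \<beta> * (G c c $ \<beta>) ^ m) \<le> norm (q \<alpha> \<beta>) * \<epsilon>"
          by (auto simp: norm_mult norm_power intro: mult_left_mono)
      qed
      also have "\<dots> = (\<Sum>\<beta>\<in>S. norm (q \<alpha> \<beta>)) * \<epsilon>" by (simp add: sum_distrib_right)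
      also have "\<dots> \<le> M * \<epsilon>"
        unfolding M_def using \<epsilon>
        by (intro mult_right_mono member_le_sum[of \<alpha> UNIV "\<lambda>\<alpha>. \<Sum>\<beta>\<in>S. norm (q \<alpha> \<beta>)"] sum_nonneg) auto
      also have "M * \<epsilon> = M / (M + 1) * (1 / N) ^ m"
        by (simp add: \<epsilon>_def power_divide)
      also have "\<dots> < 1 * (1 / N) ^ m"
        using M N by (intro mult_strict_right_mono) auto
      also have "\<dots> = (1 / N) ^ m" by simp
      finally show ?thesis using N by (auto intro: power_less_imp_less_base)
    qed
    then have "(\<Sum>\<alpha>\<in>UNIV. norm (G c c $ \<alpha>)) < (\<Sum>\<alpha>\<in>(UNIV :: 'a set). 1 / N)"
      by (intro sum_strict_mono) auto
    also have "\<dots> = 1" using N by (simp add: N_def)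
    finally show False using norm_bounds(1)[of c c] norm_vec_le_sum[of "G c c"] by simp
  qed
  with \<epsilon> show ?thesis by blast
qed

lemma few_small_components:
  "\<exists>\<epsilon>>0. \<forall>c. card {\<alpha>. norm (G c c $ \<alpha>) < \<epsilon>} \<le> n"
proof -
  have "\<forall>S. \<exists>\<epsilon>>0. card S = n + 1 \<longrightarrow> (\<forall>c. \<exists>\<alpha>\<in>S. \<epsilon> \<le> norm (G c c $ \<alpha>))"
  proof
    fix S :: "'a set"
    show "\<exists>\<epsilon>>0. card S = n + 1 \<longrightarrow> (\<forall>c. \<exists>\<alpha>\<in>S. \<epsilon> \<le> norm (G c c $ \<alpha>))"
      using component_lower_bound[of S] by (cases "card S = n + 1") (auto intro: exI[of _ 1])
  qed
  from choice[OF this] obtain e where e: "\<And>S. e S > 0"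
    "\<And>S c. card S = n + 1 \<Longrightarrow> \<exists>\<alpha>\<in>S. e S \<le> norm (G c c $ \<alpha>)"
    by auto
  define \<epsilon> where "\<epsilon> = Min (range e)"
  have "\<epsilon> > 0" using e(1) by (simp add: \<epsilon>_def)
  moreover have "card {\<alpha>. norm (G c c $ \<alpha>) < \<epsilon>} \<le> n" for c
  proof (rule ccontr)
    assume "\<not> ?thesis"
    then have "n + 1 \<le> card {\<alpha>. norm (G c c $ \<alpha>) < \<epsilon>}" by simp
    then obtain S where S: "S \<subseteq> {\<alpha>. norm (G c c $ \<alpha>) < \<epsilon>}" "card S = n + 1"
      using obtain_subset_with_card_n by metis
    obtain \<alpha> where \<alpha>: "\<alpha> \<in> S" "e S \<le> norm (G c c $ \<alpha>)" using e(2)[OF S(2)] by blast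
    moreover have "\<epsilon> \<le> e S" unfolding \<epsilon>_def by (intro Min_le) auto
    ultimately show False using S(1) by force
  qed
  ultimately show ?thesis by blast
qed

lemma basis_disjoint_zeros:
  assumes "basis r B"
  shows "B \<inter> zeros = {}"
proof (rule ccontr)
  assume "\<not> ?thesis"
  then obtain \<beta> where \<beta>: "\<beta> \<in> B" "\<beta> \<in> zeros" by blast
  have "(\<Sum>\<gamma>\<in>B. (if \<gamma> \<in> {\<beta>} then 1 else 0) * X 0 \<gamma> w) = 0" if "w \<in> ball 0 1" for w
  proof (rule sum.neutral, rule ballI)
    fix \<gamma>
    show "(if \<gamma> \<in> {\<beta>} then 1 else 0) * X 0 \<gamma> w = 0"
      using \<beta>(2) that m_pos by (auto simp: zeros_def X_def)
  qed
  from basisD(3)[OF assms this \<beta>(1)] show False by simp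
qed

text \<open>With \<open>k = r - 1\<close> one has \<open>\<bar>Wr\<bar> \<le> C \<Prod>\<^sub>B \<bar>Z\<^sub>\<beta>\<bar>^(m - k)\<close> for every basis \<open>B\<close>. At a given point all
  but at most \<open>n\<close> components are bounded below, and the others lie in a set \<open>S\<close> of size \<open>n + 1\<close>, which contains a basis \<open>B\<close> and consists, apart from \<open>B\<close> and the zero components, of
  \<open>n + 1 - r - card zeros\<close> elements, each in a basis of its own.\<close>

lemma Wr_power_estimate:
  assumes all: "\<And>S. card S = n + 1 \<Longrightarrow> \<exists>B\<subseteq>S. basis r B"
    and each: "\<And>\<alpha>. \<alpha> \<notin> zeros \<Longrightarrow> \<exists>B. \<alpha> \<in> B \<and> basis r B"
    and B0: "basis r B0"
  shows "1 \<le> r" "r + card zeros \<le> n + 1"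
    "\<exists>C. \<forall>c. norm (Wr B0 c c) ^ (n + 2 - r - card zeros)
       \<le> C * (\<Prod>\<alpha>\<in>- zeros. norm (G c c $ \<alpha>) ^ (m - (r - 1)))"
proof -
  obtain \<epsilon> where \<epsilon>: "\<epsilon> > 0" "\<And>c. card {\<alpha>. norm (G c c $ \<alpha>) < \<epsilon>} \<le> n"
    using few_small_components by blast
  have "n + 1 \<le> CARD('a)"
  proof -
    have "2 * (n + 1) \<le> 2 * CARD('a)"
      by (rule order_trans[OF _ card_ge]) (use n_pos in simp)
    then show ?thesis by simp
  qed
  have split: "\<exists>S B. {\<alpha>. norm (G c c $ \<alpha>) < \<epsilon>} \<subseteq> S \<and> zeros \<subseteq> S \<and> B \<subseteq> S \<and> card S = n + 1 \<and> basis r B" for c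
  proof -
    obtain S where S: "{\<alpha>. norm (G c c $ \<alpha>) < \<epsilon>} \<subseteq> S" "card S = n + 1"
      using exists_subset_between[of "{\<alpha>. norm (G c c $ \<alpha>) < \<epsilon>}" "n + 1" UNIV] \<epsilon>(2)[of c] \<open>n + 1 \<le> CARD('a)\<close>
      by auto
    have "zeros \<subseteq> {\<alpha>. norm (G c c $ \<alpha>) < \<epsilon>}"
      using zeros_iff[of _ c] \<epsilon>(1) by auto
    then show ?thesis using S all[OF S(2)] by blast
  qed
  have card_split: "r + card zeros + card (S - B - zeros) = n + 1"
    if "zeros \<subseteq> S" "B \<subseteq> S" "card S = n + 1" "basis r B" for S B
  proof -
    have "S = B \<union> zeros \<union> (S - B - zeros)" using that by blast
    then have "card S = card (B \<union> zeros \<union> (S - B - zeros))" by simp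
    also have "\<dots> = card (B \<union> zeros) + card (S - B - zeros)" by (intro card_Un_disjoint) auto
    also have "card (B \<union> zeros) = card B + card zeros"
      using basis_disjoint_zeros[OF that(4)] by (intro card_Un_disjoint) auto
    finally show ?thesis using that basisD(1) by simp
  qed
  show rs: "r + card zeros \<le> n + 1"
    using split[of 0] card_split by (metis le_add1)
  show r: "1 \<le> r"
  proof -
    obtain \<alpha> where "G 0 0 $ \<alpha> \<noteq> 0" using G_nonzero[of 0 0] by auto
    then have "\<alpha> \<notin> zeros" by (auto simp: zeros_def)
    then obtain B where "\<alpha> \<in> B" "basis r B" using each by blast
    then have "card B \<noteq> 0" by auto
    then show ?thesis using basisD(1)[OF \<open>basis r B\<close>] by simp
  qed
  define e where "e = m - (r - 1)"
  define y where "y c \<alpha> = norm (G c c $ \<alpha>) ^ e" for c \<alpha>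
  have y0: "y c \<alpha> \<ge> 0" for c \<alpha> by (simp add: y_def)
  have y2: "y c \<alpha> \<le> 2 ^ e" for c \<alpha> unfolding y_def by (intro power_mono comp_le) auto
  have "\<forall>B. \<exists>K\<ge>0. basis r B \<longrightarrow> (\<forall>c. norm (Wr B0 c c) \<le> K * (\<Prod>\<beta>\<in>B. y c \<beta>))"
  proof
    fix B
    show "\<exists>K\<ge>0. basis r B \<longrightarrow> (\<forall>c. norm (Wr B0 c c) \<le> K * (\<Prod>\<beta>\<in>B. y c \<beta>))"
    proof (cases "basis r B")
      case True
      obtain \<kappa> where \<kappa>: "\<And>c w. w \<in> ball c 1 \<Longrightarrow> Wr B0 c w = \<kappa> * Wr B c w"
        using Wr_change_basis[OF True B0] by blast
      define K where "K = norm \<kappa> * (fact r * (fact (r - 1) * 3 ^ m * 8 ^ (r - 1)) ^ r)"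
      have "norm (Wr B0 c c) \<le> K * (\<Prod>\<beta>\<in>B. y c \<beta>)" for c
      proof -
        have "norm (Wr B0 c c) = norm \<kappa> * norm (Wr B c c)" by (simp add: \<kappa> norm_mult)
        also have "\<dots> \<le> norm \<kappa> * (fact r * (fact (r - 1) * 3 ^ m * 8 ^ (r - 1)) ^ r * (\<Prod>\<beta>\<in>B. y c \<beta>))"
          unfolding y_def e_def using True basisD(1) r rs by (intro mult_left_mono norm_Wr_le) auto
        finally show ?thesis by (simp add: K_def mult.assoc)
      qed
      moreover have "K \<ge> 0" by (simp add: K_def)
      ultimately show ?thesis by blast
    qed (auto intro: exI[of _ 0])
  qed
  from choice[OF this] obtain K where K: "\<And>B. K B \<ge> 0"
    "\<And>B c. basis r B \<Longrightarrow> norm (Wr B0 c c) \<le> K B * (\<Prod>\<beta>\<in>B. y c \<beta>)"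
    by blast
  define K1 where "K1 = (\<Sum>B\<in>UNIV. K B)"
  have K1: "K1 \<ge> 0" unfolding K1_def by (intro sum_nonneg K)
  have est1: "norm (Wr B0 c c) \<le> K1 * (\<Prod>\<beta>\<in>B. y c \<beta>)" if "basis r B" for B c
  proof -
    have "K B \<le> K1" unfolding K1_def by (intro member_le_sum K) auto
    then have "K B * (\<Prod>\<beta>\<in>B. y c \<beta>) \<le> K1 * (\<Prod>\<beta>\<in>B. y c \<beta>)"
      by (intro mult_right_mono prod_nonneg ballI y0)
    then show ?thesis using K(2)[OF that, of c] by linarith
  qed
  define K2 where "K2 = K1 * (2 ^ e) ^ CARD('a)"
  have K2: "K2 \<ge> 0" using K1 by (simp add: K2_def)
  \<comment> \<open>A basis containing \<open>\<alpha>\<close> supplies the factor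
    \<open>y c \<alpha>\<close>; its other factors are bounded because the lifts are.\<close>
  have est2: "norm (Wr B0 c c) \<le> K2 * y c \<alpha>" if "\<alpha> \<notin> zeros" for \<alpha> c
  proof -
    obtain B where B: "\<alpha> \<in> B" "basis r B" using each \<open>\<alpha> \<notin> zeros\<close> by blast
    have "(\<Prod>\<beta>\<in>B. y c \<beta>) = y c \<alpha> * (\<Prod>\<beta>\<in>B - {\<alpha>}. y c \<beta>)"
      using B(1) by (intro prod.remove) auto
    also have "(\<Prod>\<beta>\<in>B - {\<alpha>}. y c \<beta>) \<le> (\<Prod>\<beta>\<in>B - {\<alpha>}. 2 ^ e)"
      by (intro prod_mono conjI y0 y2)
    also have "(\<Prod>\<beta>\<in>B - {\<alpha>}. 2 ^ e) = ((2::real) ^ e) ^ card (B - {\<alpha>})" by simp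
    also have "\<dots> \<le> (2 ^ e) ^ CARD('a)"
      by (intro power_increasing card_mono) auto
    finally have "(\<Prod>\<beta>\<in>B. y c \<beta>) \<le> y c \<alpha> * (2 ^ e) ^ CARD('a)" using y0 by (simp add: mult_left_mono)
    then have "K1 * (\<Prod>\<beta>\<in>B. y c \<beta>) \<le> K1 * (y c \<alpha> * (2 ^ e) ^ CARD('a))" using K1 by (rule mult_left_mono)
    then show ?thesis using est1[OF B(2), of c] by (simp add: K2_def mult_ac)
  qed
  \<comment> \<open>A lower bound for the product over the coordinates outside \<open>S\<close>.
    With \<open>min 1 \<epsilon>\<close> the power for all coordinates is at most that for any
    subset.\<close>
  define \<delta> where "\<delta> = (min 1 \<epsilon> ^ e) ^ CARD('a)"
  have \<delta>: "\<delta> > 0" using \<epsilon> by (simp add: \<delta>_def)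
  define t where "t = n + 1 - r - card zeros"
  have "norm (Wr B0 c c) ^ Suc t \<le> K1 * K2 ^ t / \<delta> * (\<Prod>\<alpha>\<in>- zeros. y c \<alpha>)" for c
  proof -
    obtain S B where SB: "{\<alpha>. norm (G c c $ \<alpha>) < \<epsilon>} \<subseteq> S" "zeros \<subseteq> S" "B \<subseteq> S" "card S = n + 1" "basis r B"
      using split[of c] by blast
    define T where "T = S - B - zeros"
    have cT: "card T = t" using card_split[OF SB(2-5)] by (simp add: T_def t_def)
    \<comment> \<open>One factor is spent on the whole basis \<open>B\<close> inside
      \<open>S\<close>, and one on each of the \<open>t\<close> elements of
      \<open>T\<close>.\<close>
    have "norm (Wr B0 c c) ^ Suc t = norm (Wr B0 c c) * (\<Prod>\<alpha>\<in>T. norm (Wr B0 c c))"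
      by (simp add: cT)
    also have "\<dots> \<le> (K1 * (\<Prod>\<beta>\<in>B. y c \<beta>)) * (\<Prod>\<alpha>\<in>T. K2 * y c \<alpha>)"
      using est1[OF SB(5), of c] est2[of _ c] K1 y0
      by (intro mult_mono prod_mono prod_nonneg mult_nonneg_nonneg) (auto simp: T_def)
    also have "\<dots> = K1 * K2 ^ t * ((\<Prod>\<beta>\<in>B. y c \<beta>) * (\<Prod>\<alpha>\<in>T. y c \<alpha>))"
      by (simp add: prod.distrib cT mult_ac)
    also have "(\<Prod>\<beta>\<in>B. y c \<beta>) * (\<Prod>\<alpha>\<in>T. y c \<alpha>) = (\<Prod>\<alpha>\<in>B \<union> T. y c \<alpha>)"
      by (intro prod.union_disjoint[symmetric]) (auto simp: T_def)
    also have "K1 * K2 ^ t * (\<Prod>\<alpha>\<in>B \<union> T. y c \<alpha>) \<le> K1 * K2 ^ t * ((\<Prod>\<alpha>\<in>- zeros. y c \<alpha>) / \<delta>)"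
    proof (intro mult_left_mono)
      have "- zeros = (B \<union> T) \<union> - S"
        using SB(2,3) basis_disjoint_zeros[OF SB(5)] by (auto simp: T_def)
      then have "(\<Prod>\<alpha>\<in>- zeros. y c \<alpha>) = (\<Prod>\<alpha>\<in>(B \<union> T) \<union> - S. y c \<alpha>)" by simp
      also have "\<dots> = (\<Prod>\<alpha>\<in>B \<union> T. y c \<alpha>) * (\<Prod>\<alpha>\<in>- S. y c \<alpha>)"
        using SB(3) by (intro prod.union_disjoint) (auto simp: T_def)
      finally have eq: "(\<Prod>\<alpha>\<in>- zeros. y c \<alpha>) = (\<Prod>\<alpha>\<in>B \<union> T. y c \<alpha>) * (\<Prod>\<alpha>\<in>- S. y c \<alpha>)" .
      have "\<delta> \<le> (min 1 \<epsilon> ^ e) ^ card (- S)"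
        unfolding \<delta>_def using \<epsilon>(1) by (intro power_decreasing card_mono power_le_one) auto
      also have "\<dots> = (\<Prod>\<alpha>\<in>- S. min 1 \<epsilon> ^ e)" by simp
      also have "\<dots> \<le> (\<Prod>\<alpha>\<in>- S. y c \<alpha>)"
      proof (intro prod_mono conjI)
        fix \<alpha> assume "\<alpha> \<in> - S"
        then have "\<epsilon> \<le> norm (G c c $ \<alpha>)" using SB(1) by force
        then have "min 1 \<epsilon> \<le> norm (G c c $ \<alpha>)" by (rule min.coboundedI2)
        then show "min 1 \<epsilon> ^ e \<le> y c \<alpha>" unfolding y_def using \<epsilon>(1) by (intro power_mono) auto
      qed (use \<epsilon>(1) in auto)
      finally have "(\<Prod>\<alpha>\<in>B \<union> T. y c \<alpha>) * \<delta> \<le> (\<Prod>\<alpha>\<in>- zeros. y c \<alpha>)"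
        unfolding eq by (intro mult_left_mono prod_nonneg ballI y0)
      then show "(\<Prod>\<alpha>\<in>B \<union> T. y c \<alpha>) \<le> (\<Prod>\<alpha>\<in>- zeros. y c \<alpha>) / \<delta>"
        using \<delta> by (simp add: pos_le_divide_eq)
    qed (use K1 K2 in auto)
    finally show ?thesis by simp
  qed
  note main = this
  have st: "n + 2 - r - card zeros = Suc t" using rs by (simp add: t_def)
  show "\<exists>C. \<forall>c. norm (Wr B0 c c) ^ (n + 2 - r - card zeros)
       \<le> C * (\<Prod>\<alpha>\<in>- zeros. norm (G c c $ \<alpha>) ^ (m - (r - 1)))"
    unfolding st e_def[symmetric] y_def[symmetric] using main by (intro exI allI)
qed

text \<open>With \<open>Z = G c\<close> and \<open>k = r - 1\<close>, the function
  \<open>Wr\<^sup>p Z\<^sub>\<beta>\<^sup>q Z\<^sub>\<gamma> / \<Prod> Z\<^sub>\<alpha>\<^bsup>m - k\<^esup>\<close> is homogeneous of degree \<open>0\<close> in the lift, hence globally defined,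
  and it is bounded. So it is constant for every \<open>\<gamma>\<close>.\<close>

theorem curve_constant: "constant_curve G"
proof -
  obtain r where all: "\<And>S. card S = n + 1 \<Longrightarrow> \<exists>B\<subseteq>S. basis r B"
    and each: "\<And>\<alpha>. \<alpha> \<notin> zeros \<Longrightarrow> \<exists>B. \<alpha> \<in> B \<and> basis r B"
    by (rule basis_exists) blast
  obtain \<beta> where "G 0 0 $ \<beta> \<noteq> 0" using G_nonzero[of 0 0] by auto
  then have \<beta>: "\<beta> \<notin> zeros" by (auto simp: zeros_def)
  then obtain B where B: "basis r B" using each by blast
  define p where "p = n + 2 - r - card zeros"
  define e where "e = m - (r - 1)"
  define D where "D = card (- zeros)"
  note est = Wr_power_estimate[OF all each B, folded p_def e_def]
  obtain C where C: "\<And>c. norm (Wr B c c) ^ p \<le> C * (\<Prod>\<alpha>\<in>- zeros. norm (G c c $ \<alpha>) ^ e)"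
    using est(3) by blast
  have "D = CARD('a) - card zeros"
    unfolding D_def Compl_eq_Diff_UNIV by (rule card_Diff_subset) auto
  then have "m * r * p < e * D"
    unfolding p_def e_def using n_pos m_ge card_ge est(1,2) degree_inequality by simp
  \<comment> \<open>The missing degree is written \<open>Suc q\<close>: \<open>q\<close> factors are
    coordinate \<open>\<beta>\<close>, and exactly one is left for the varying coordinate
    \<open>\<gamma>\<close>.\<close>
  then obtain q where q: "m * r * p + Suc q = e * D"
    using less_imp_add_positive[of "m * r * p" "e * D"] gr0_conv_Suc by auto
  define a where "a \<gamma> c w = Wr B c w ^ p * (G c w $ \<beta>) ^ q * G c w $ \<gamma>" for \<gamma> c w
  define b where "b c w = (\<Prod>\<alpha>\<in>- zeros. (G c w $ \<alpha>) ^ e)" for c w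
  have hol_a: "a \<gamma> c holomorphic_on ball c 1" for \<gamma> c
    unfolding a_def[abs_def] by (intro holomorphic_intros hol_Wr hol)
  have hol_b: "b c holomorphic_on ball c 1" for c
    unfolding b_def[abs_def] by (intro holomorphic_intros hol)
  have nz_b: "\<exists>w\<in>ball c 1. b c w \<noteq> 0" for c
    unfolding b_def
  proof (rule holomorphic_prod_nonzero)
    fix \<alpha> assume "\<alpha> \<in> - zeros"
    then show "\<exists>w\<in>ball c 1. (G c w $ \<alpha>) ^ e \<noteq> 0" using zeros_iff[of \<alpha> c] by auto
  qed (auto intro!: holomorphic_intros hol)
  define f where "f c w = Wr B c w ^ p * (G c w $ \<beta>) ^ q" for c w
  have hol_f: "f c holomorphic_on ball c 1" for c
    unfolding f_def[abs_def] by (intro holomorphic_intros hol_Wr hol)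
  have nz_f: "\<exists>w\<in>ball c 1. f c w \<noteq> 0" for c
    unfolding f_def
  proof (rule holomorphic_mult_nonzero)
    show "\<exists>w\<in>ball c 1. Wr B c w ^ p \<noteq> 0" using Wr_nonzero[OF B, of c] by auto
    show "\<exists>w\<in>ball c 1. (G c w $ \<beta>) ^ q \<noteq> 0" using \<beta> zeros_iff[of \<beta> c] by auto
  qed (auto intro!: holomorphic_intros hol hol_Wr)
  \<comment> \<open>Numerator and denominator have equal degree \<open>e * D\<close>, so passing to
    the lift centred at \<open>w\<close> changes neither the quotient nor the bound
    \<open>bd_center\<close>, which is available at centres only.\<close>
  have trans: "\<exists>g. g \<noteq> 0 \<and> b w w = g ^ (e * D) * b c w \<and> (\<forall>\<gamma>. a \<gamma> w w = g ^ (e * D) * a \<gamma> c w)"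
    if w: "w \<in> ball c 1" for c w
  proof -
    have "w \<in> ball w 1" by simp
    with w obtain U g where U: "open U" "w \<in> U" "U \<subseteq> ball c 1" "g holomorphic_on U"
      "\<And>v. v \<in> U \<Longrightarrow> g v \<noteq> 0" "\<And>v \<alpha>. v \<in> U \<Longrightarrow> G w v $ \<alpha> = g v * G c v $ \<alpha>"
      using transition by metis
    have Gw: "G w w $ \<alpha> = g w * G c w $ \<alpha>" for \<alpha> using U(2,6) by blast
    have "Wr B w w = g w ^ (m * r) * Wr B c w"
      using Wr_transition[OF U(1-4,6), of B] basisD(1)[OF B] by simp
    then have "a \<gamma> w w = g w ^ (m * r * p + Suc q) * a \<gamma> c w" for \<gamma>
      by (simp add: a_def Gw power_mult_distrib power_add power_mult[symmetric] mult_ac)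
    moreover have "b w w = g w ^ (e * D) * b c w"
      by (simp add: b_def Gw power_mult_distrib prod.distrib power_mult D_def)
    ultimately show ?thesis using U(2,5) unfolding q by blast
  qed
  have bd_center: "norm (a \<gamma> c c) \<le> C * 2 ^ Suc q * norm (b c c)" for \<gamma> c
  proof -
    have "norm (a \<gamma> c c) = norm (Wr B c c) ^ p * (norm (G c c $ \<beta>) ^ q * norm (G c c $ \<gamma>))"
      by (simp add: a_def norm_mult norm_power)
    also have "\<dots> \<le> norm (Wr B c c) ^ p * (2 ^ q * 2)"
      by (intro mult_left_mono mult_mono power_mono comp_le) auto
    also have "\<dots> \<le> C * (\<Prod>\<alpha>\<in>- zeros. norm (G c c $ \<alpha>) ^ e) * (2 ^ q * 2)"
      by (intro mult_right_mono C) auto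
    finally show ?thesis by (simp add: b_def prod_norm[symmetric] norm_power mult_ac)
  qed
  have "\<exists>K. \<forall>c. \<forall>w\<in>ball c 1. a \<gamma> c w = K * b c w" for \<gamma>
  proof (rule bounded_quotient_constant[of "a \<gamma>" b "C * 2 ^ Suc q" "\<lambda>w. a \<gamma> w w / b w w"])
    fix c w :: complex assume w: "w \<in> ball c 1"
    obtain g where g: "g \<noteq> 0" "b w w = g ^ (e * D) * b c w" "a \<gamma> w w = g ^ (e * D) * a \<gamma> c w"
      using trans[OF w] by blast
    have "norm g ^ (e * D) * norm (a \<gamma> c w) = norm (a \<gamma> w w)"
      by (simp add: g(3) norm_mult norm_power)
    also have "\<dots> \<le> C * 2 ^ Suc q * norm (b w w)" by (rule bd_center)
    also have "\<dots> = norm g ^ (e * D) * (C * 2 ^ Suc q * norm (b c w))"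
      by (simp add: g(2) norm_mult norm_power)
    finally show "norm (a \<gamma> c w) \<le> C * 2 ^ Suc q * norm (b c w)"
      by (rule mult_left_le_imp_le) (use g(1) in simp)
    show "a \<gamma> w w / b w w = a \<gamma> c w / b c w" using g by simp
  qed (auto intro: hol_a hol_b nz_b)
  then have "\<forall>\<gamma>. \<exists>K. \<forall>c. \<forall>w\<in>ball c 1. a \<gamma> c w = K * b c w" by (rule allI)
  from choice[OF this] obtain K where
    K0: "\<forall>\<gamma>. \<forall>c. \<forall>w\<in>ball c 1. a \<gamma> c w = K \<gamma> * b c w"
    by (elim exE)
  have K: "f c w * G c w $ \<gamma> = K \<gamma> * b c w" if "w \<in> ball c 1" for \<gamma> c w
    using K0[rule_format, OF that, of \<gamma>] unfolding a_def f_def .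
  \<comment> \<open>Eliminating \<open>b\<close> from the identities for \<open>\<beta>\<close> and
    \<open>\<gamma>\<close> gives \<open>f\<close> times the difference of the two sides equal to
    \<open>0\<close>, and \<open>f\<close> does not vanish identically.\<close>
  have proportional: "K \<beta> * G c w $ \<gamma> = K \<gamma> * G c w $ \<beta>" if w: "w \<in> ball c 1" for \<gamma> c w
  proof (rule ccontr)
    assume neg: "\<not> ?thesis"
    have "\<exists>w\<in>ball c 1. f c w * (K \<beta> * G c w $ \<gamma> - K \<gamma> * G c w $ \<beta>) \<noteq> 0"
    proof (rule holomorphic_mult_nonzero)
      have "K \<beta> * G c w $ \<gamma> - K \<gamma> * G c w $ \<beta> \<noteq> 0" using neg unfolding right_minus_eq .
      with w show "\<exists>w\<in>ball c 1. K \<beta> * G c w $ \<gamma> - K \<gamma> * G c w $ \<beta> \<noteq> 0" by (rule bexI[rotated])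
    qed (auto intro!: holomorphic_intros hol hol_f nz_f)
    then obtain v where v: "v \<in> ball c 1" "f c v * (K \<beta> * G c v $ \<gamma> - K \<gamma> * G c v $ \<beta>) \<noteq> 0" by blast
    have "f c v * (K \<beta> * G c v $ \<gamma> - K \<gamma> * G c v $ \<beta>)
        = K \<beta> * (f c v * G c v $ \<gamma>) - K \<gamma> * (f c v * G c v $ \<beta>)"
      by (simp add: algebra_simps)
    also have "\<dots> = 0" unfolding K[OF v(1)] by simp
    finally show False using v(2) by simp
  qed
  have "K \<beta> \<noteq> 0"
  proof
    assume "K \<beta> = 0"
    have "\<exists>w\<in>ball 0 1. f 0 w * G 0 w $ \<beta> \<noteq> 0"
    proof (rule holomorphic_mult_nonzero)
      show "\<exists>w\<in>ball 0 1. G 0 w $ \<beta> \<noteq> 0" using \<beta> by (auto simp: zeros_def)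
    qed (auto intro!: hol hol_f nz_f)
    then obtain w where w: "w \<in> ball 0 1" "f 0 w * G 0 w $ \<beta> \<noteq> 0" by blast
    then show False using K[OF w(1), of \<beta>] \<open>K \<beta> = 0\<close> by simp
  qed
  define v where "v = (\<chi> \<gamma>. K \<gamma>)"
  show ?thesis
    unfolding constant_curve_def
  proof (intro exI[of _ v] conjI allI ballI)
    have "v $ \<beta> \<noteq> 0" using \<open>K \<beta> \<noteq> 0\<close> by (simp add: v_def)
    then show "v \<noteq> 0" by auto
    fix c w :: complex and i j assume w: "w \<in> ball c 1"
    have "(K \<beta> * G c w $ i) * K j = (K \<beta> * G c w $ j) * K i"
      unfolding proportional[OF w, of i] proportional[OF w, of j] by simp
    then have "K \<beta> * (G c w $ i * v $ j) = K \<beta> * (G c w $ j * v $ i)"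
      by (simp add: v_def mult.assoc)
    then show "G c w $ i * v $ j = G c w $ j * v $ i" using \<open>K \<beta> \<noteq> 0\<close> by simp
  qed
qed

end

section \<open>Arrangements in general position\<close>

definition coord_form :: "('k \<Rightarrow> complex ^ 'n::finite) \<Rightarrow> 'n + 'k::finite \<Rightarrow> complex ^ 'n" where
  "coord_form a \<alpha> = (case \<alpha> of Inl i \<Rightarrow> axis i 1 | Inr j \<Rightarrow> a j)"

text \<open>The affine cone over the cover, with the origin included so that it is closed and limits
  of lifts remain in it.\<close>

definition fermat_cone :: "nat \<Rightarrow> ('k::finite \<Rightarrow> complex ^ 'n::finite) \<Rightarrow> (complex ^ ('n + 'k)) set" where
  "fermat_cone m a = {Z. \<forall>j. (Z $ Inr j) ^ m = (\<Sum>i\<in>UNIV. a j $ i * (Z $ Inl i) ^ m)}"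

lemma closed_fermat_cone: "closed (fermat_cone m a)"
  unfolding fermat_cone_def by (intro closed_Collect_all closed_Collect_eq continuous_intros)

lemma mem_fermat_complete_intersection:
  assumes "z \<noteq> 0" "proj_pt z \<in> fermat_complete_intersection m a"
  shows "z \<in> fermat_cone m a"
proof -
  obtain Z where Z: "proj_pt z = proj_pt Z" "Z \<in> fermat_cone m a"
    using assms(2) by (auto simp: fermat_complete_intersection_def fermat_cone_def)
  obtain c where "z = c *s Z" using proj_pt_eqD[OF Z(1) assms(1)] by metis
  then show ?thesis using Z(2)
    by (simp add: fermat_cone_def power_mult_distrib sum_distrib_left mult.left_commute)
qed

lemma fermat_cone_power_eq:
  assumes "Z \<in> fermat_cone m a"
  shows "(Z $ \<alpha>) ^ m = lin_form (coord_form a \<alpha>) (\<chi> i. (Z $ Inl i) ^ m)"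
proof (cases \<alpha>)
  case (Inl i)
  then show ?thesis
    using sum_axis_mult[of i "\<lambda>i. (Z $ Inl i) ^ m"] by (simp add: coord_form_def lin_form_def)
next
  case (Inr j)
  then show ?thesis using assms by (simp add: coord_form_def lin_form_def fermat_cone_def)
qed

lemma hyperplane_zero_neq:
  fixes \<xi> :: "complex ^ 'n::finite"
  assumes "\<xi> \<noteq> 0"
  shows "hyperplane \<xi> \<noteq> hyperplane 0"
proof
  assume eq: "hyperplane \<xi> = hyperplane 0"
  obtain i where i: "\<xi> $ i \<noteq> 0" using assms by (auto simp: Finite_Cartesian_Product.vec_eq_iff)
  have "proj_pt (axis i 1) \<in> hyperplane (0 :: complex ^ 'n)"
    by (simp add: proj_pt_in_hyperplane lin_form_def)
  then have "lin_form \<xi> (axis i 1) = 0" unfolding eq[symmetric] proj_pt_in_hyperplane by blast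
  with i show False by (simp add: lin_form_axis)
qed

text \<open>A common zero \<open>u \<noteq> 0\<close>, transported by the inverse of
  \<open>B\<close>, is the coefficient vector of a hyperplane of the dual space through the dual
  points of all \<open>H \<alpha>\<close> with \<open>\<alpha> \<in> S\<close>. As \<open>H\<close>
  is injective these come from \<open>CARD('n)\<close> members of \<open>A\<close>, against general
  position.\<close>

lemma coord_forms_independent:
  fixes A :: "(complex ^ 'n::finite) set set set" and H :: "'n + 'k::finite \<Rightarrow> (complex ^ 'n) set set"
  assumes A: "hyperplane_arrangement A" "general_position_hyperplanes A"
    and H: "bij_betw H UNIV A" "invertible B" "\<And>i. H (Inl i) = hyperplane (B $ i)"
      "\<And>j. H (Inr j) = hyperplane (\<Sum>i\<in>UNIV. a j $ i *s B $ i)"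
    and S: "card S = CARD('n)" and u: "\<And>\<alpha>. \<alpha> \<in> S \<Longrightarrow> lin_form (coord_form a \<alpha>) u = 0"
  shows "u = 0"
proof (rule ccontr)
  assume u0: "u \<noteq> 0"
  define \<xi> where "\<xi> \<alpha> = (\<Sum>i\<in>UNIV. coord_form a \<alpha> $ i *s B $ i)" for \<alpha>
  have H\<xi>: "H \<alpha> = hyperplane (\<xi> \<alpha>)" for \<alpha>
  proof (cases \<alpha>)
    case (Inl i)
    have "\<xi> \<alpha> = B $ i"
      unfolding Finite_Cartesian_Product.vec_eq_iff
      using sum_axis_mult[of i "\<lambda>j. B $ j $ _"] by (simp add: \<xi>_def coord_form_def Inl)
    then show ?thesis using H(3) Inl by simp
  next
    case (Inr j)
    then show ?thesis using H(4) by (simp add: \<xi>_def coord_form_def)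
  qed
  \<comment> \<open>The zero form would give all of projective space, which is not a member of the
    arrangement.\<close>
  have \<xi>0: "\<xi> \<alpha> \<noteq> 0" for \<alpha>
  proof
    assume "\<xi> \<alpha> = 0"
    have "H \<alpha> \<in> A" using H(1) by (auto simp: bij_betw_def)
    then obtain \<xi>' where "\<xi>' \<noteq> 0" "H \<alpha> = hyperplane \<xi>'" using A(1) unfolding hyperplane_arrangement_def by blast
    then show False using hyperplane_zero_neq[of \<xi>'] H\<xi>[of \<alpha>] \<open>\<xi> \<alpha> = 0\<close> by simp
  qed
  obtain B' where B': "B ** B' = Finite_Cartesian_Product.mat 1"
    using H(2) unfolding invertible_def by blast
  define \<eta> where "\<eta> = B' *v u"
  have B\<eta>: "B *v \<eta> = u"
    unfolding \<eta>_def by (simp add: matrix_vector_mul_assoc B')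
  then have "\<eta> \<noteq> 0" using u0 by auto
  have lin: "lin_form \<eta> (\<xi> \<alpha>) = lin_form (coord_form a \<alpha>) u" for \<alpha>
  proof -
    have "lin_form \<eta> (\<xi> \<alpha>) = (\<Sum>k\<in>UNIV. \<Sum>i\<in>UNIV. coord_form a \<alpha> $ i * (B $ i $ k * \<eta> $ k))"
      unfolding lin_form_def \<xi>_def by (simp add: sum_distrib_left mult_ac)
    also have "\<dots> = (\<Sum>i\<in>UNIV. \<Sum>k\<in>UNIV. coord_form a \<alpha> $ i * (B $ i $ k * \<eta> $ k))"
      by (rule sum.swap)
    also have "\<dots> = lin_form (coord_form a \<alpha>) u"
      unfolding lin_form_def B\<eta>[symmetric] by (simp add: matrix_vector_mult_def sum_distrib_left)
    finally show ?thesis .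
  qed
  have dual: "dual_pt ` H ` S \<subseteq> hyperplane \<eta>"
  proof (intro image_subsetI, elim imageE)
    fix L \<alpha> assume \<alpha>: "L = H \<alpha>" "\<alpha> \<in> S"
    show "dual_pt L \<in> hyperplane \<eta>"
      unfolding \<alpha>(1) H\<xi> dual_pt_hyperplane[OF \<xi>0] proj_pt_in_hyperplane using u[OF \<alpha>(2)] lin \<xi>0 by simp
  qed
  have HS: "H ` S \<subseteq> A" "card (H ` S) = CARD('n)"
    using H(1) S card_image[OF inj_on_subset[of H UNIV S]] by (auto simp: bij_betw_def)
  have "\<not> (\<exists>\<eta>. \<eta> \<noteq> 0 \<and> dual_pt ` H ` S \<subseteq> hyperplane \<eta>)"
    by (rule A(2)[unfolded general_position_hyperplanes_def, rule_format, OF HS])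
  moreover have "\<exists>\<eta>. \<eta> \<noteq> 0 \<and> dual_pt ` H ` S \<subseteq> hyperplane \<eta>"
    using \<open>\<eta> \<noteq> 0\<close> dual by (intro exI conjI)
  ultimately show False by (rule notE)
qed

text \<open>The map \<open>f\<close> evaluating the forms in \<open>S\<close>, padded by zeros
  outside \<open>S\<close>, is injective. A linear left inverse recovers \<open>u\<close> from these
  values, and with it the value of any other form.\<close>

lemma forms_span:
  fixes l :: "'a::finite \<Rightarrow> complex ^ 'n::finite"
  assumes "\<And>u. (\<And>\<alpha>. \<alpha> \<in> S \<Longrightarrow> lin_form (l \<alpha>) u = 0) \<Longrightarrow> u = 0"
  shows "\<exists>q. \<forall>\<gamma> u. lin_form (l \<gamma>) u = (\<Sum>\<alpha>\<in>S. q \<gamma> \<alpha> * lin_form (l \<alpha>) u)"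
proof -
  define f :: "complex ^ 'n \<Rightarrow> complex ^ 'a" where
    "f u = (\<chi> \<alpha>. if \<alpha> \<in> S then lin_form (l \<alpha>) u else 0)" for u
  have lf: "lin_form x (y + z) = lin_form x y + lin_form x z" for x y z :: "complex ^ 'n"
    by (simp add: lin_form_def algebra_simps sum.distrib)
  have lf_sum: "lin_form x (sum g T) = (\<Sum>t\<in>T. lin_form x (g t))" if "finite T"
    for x :: "complex ^ 'n" and g and T :: "'a set"
    using that by (induction T rule: finite_induct) (auto simp: lf, simp add: lin_form_def)
  have linf: "Vector_Spaces.linear (*s) (*s) f"
    by unfold_locales
      (auto simp: f_def lf lin_form_scale Finite_Cartesian_Product.vec_eq_iff)
  have "inj f"
  proof (rule injI)
    fix x y assume "f x = f y"
    then have "lin_form (l \<alpha>) x = lin_form (l \<alpha>) y" if "\<alpha> \<in> S" for \<alpha>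
      using that by (auto simp: f_def Finite_Cartesian_Product.vec_eq_iff split: if_splits)
    then have "x - y = 0" by (intro assms) (simp add: lin_form_diff)
    then show "x = y" by simp
  qed
  then obtain g where g: "Vector_Spaces.linear (*s) (*s) g" "g \<circ> f = id"
    using vec.linear_injective_left_inverse[OF linf] by blast
  interpret g: Vector_Spaces.linear "(*s)" "(*s)" g by (rule g(1))
  have "lin_form (l \<gamma>) u = (\<Sum>\<alpha>\<in>S. lin_form (l \<gamma>) (g (axis \<alpha> 1)) * lin_form (l \<alpha>) u)" for \<gamma> u
  proof -
    have "f u = (\<Sum>\<alpha>\<in>S. lin_form (l \<alpha>) u *s axis \<alpha> 1)"
      by (simp add: f_def Finite_Cartesian_Product.vec_eq_iff axis_def if_distrib cong: if_cong)
    then have "u = (\<Sum>\<alpha>\<in>S. lin_form (l \<alpha>) u *s g (axis \<alpha> 1))"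
      using fun_cong[OF g(2), of u] by (simp add: g.sum g.scale)
    then have "lin_form (l \<gamma>) u = lin_form (l \<gamma>) (\<Sum>\<alpha>\<in>S. lin_form (l \<alpha>) u *s g (axis \<alpha> 1))"
      by (rule arg_cong)
    also have "\<dots> = (\<Sum>\<alpha>\<in>S. lin_form (l \<gamma>) (g (axis \<alpha> 1)) * lin_form (l \<alpha>) u)"
      by (simp add: lf_sum lin_form_scale mult.commute)
    finally show ?thesis .
  qed
  then show ?thesis by (intro exI[of _ "\<lambda>\<gamma> \<alpha>. lin_form (l \<gamma>) (g (axis \<alpha> 1))"] allI)
qed

theorem theoremD:
  fixes A :: "(complex ^ 'n::finite) set set set"
    and Y :: "(complex ^ ('n + 'k::finite)) set set"
    and n d m :: nat
  assumes "CARD('n) = n + 1" and "n \<ge> 1"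
    and "hyperplane_arrangement A" and "card A = d"
    and "d \<ge> (n + 2) choose 2"
    and "general_position_hyperplanes A"
    and "general_position_quadrics A"
    and "m \<ge> 2 * n + 2"
    and "is_fermat_cover A m Y"
  shows "kobayashi_hyperbolic Y"
proof (rule ccontr)
  assume neg: "\<not> kobayashi_hyperbolic Y"
  obtain H :: "'n + 'k \<Rightarrow> (complex ^ 'n) set set" and B :: "complex ^ 'n ^ 'n" and a :: "'k \<Rightarrow> complex ^ 'n"
    where H: "bij_betw H UNIV A" "invertible B" "\<forall>i. H (Inl i) = hyperplane (B $ i)"
      "\<forall>j. H (Inr j) = hyperplane (\<Sum>i\<in>UNIV. a j $ i *s B $ i)"
      and Y: "Y = fermat_complete_intersection m a"
    using assms(9) unfolding is_fermat_cover_def by (elim exE conjE)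
  have cards: "CARD('n + 'k) = d" using bij_betw_same_card[OF H(1)] assms(4) by simp
  have Ypt: "\<exists>z. z \<noteq> 0 \<and> p = proj_pt z" if "p \<in> Y" for p
    using that unfolding Y fermat_complete_intersection_def by blast
  \<comment> \<open>Failure of hyperbolicity rules out every uniform radius, which is what the
    rescaling starts from.\<close>
  have "\<exists>f. holomorphic_disc Y f \<and> \<not> has_balanced_lift f 0 \<rho>" if "\<rho> > 0" for \<rho>
    using neg kobayashi_hyperbolic_if_uniform_balanced_lift[OF Ypt that] by blast
  then have "\<exists>G. brody_curve G \<and> \<not> constant_curve G \<and> (\<forall>c. \<forall>w\<in>ball c 1. G c w \<in> fermat_cone m a)"
    by (rule brody_curve_exists[OF _ closed_fermat_cone])
      (auto simp: Y intro: mem_fermat_complete_intersection)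
  then obtain G where G: "brody_curve G" "\<not> constant_curve G"
    "\<And>c w. w \<in> ball c 1 \<Longrightarrow> G c w \<in> fermat_cone m a"
    by blast
  interpret fermat_curve G m n
  proof
    show "brody_curve G" "n \<ge> 1" "m \<ge> 2 * n + 2" by (rule G assms)+
    have "(n + 1) * (n + 2) = 2 * ((n + 2) choose 2)"
      using choose_two[of "n + 2"] by simp
    then show "(n + 1) * (n + 2) \<le> 2 * CARD('n + 'k)" unfolding cards using assms(5) by linarith
    fix S :: "('n + 'k) set" assume "card S = n + 1"
    then have S: "card S = CARD('n)" using assms(1) by simp
    \<comment> \<open>The relation is obtained for linear forms first. Evaluated at the vector of
      \<open>m\<close>-th powers of the first coordinates it yields coefficients that do not depend
      on the point.\<close>
    have "\<exists>q. \<forall>\<gamma> u. lin_form (coord_form a \<gamma>) u = (\<Sum>\<alpha>\<in>S. q \<gamma> \<alpha> * lin_form (coord_form a \<alpha>) u)"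
    proof (rule forms_span)
      fix u assume "\<And>\<alpha>. \<alpha> \<in> S \<Longrightarrow> lin_form (coord_form a \<alpha>) u = 0"
      then show "u = 0"
        using coord_forms_independent[OF assms(3,6) H(1,2) H(3)[rule_format] H(4)[rule_format] S] by blast
    qed
    then obtain q where q: "\<forall>\<gamma> u. lin_form (coord_form a \<gamma>) u = (\<Sum>\<alpha>\<in>S. q \<gamma> \<alpha> * lin_form (coord_form a \<alpha>) u)"
      by (elim exE)
    have "(G c w $ \<alpha>) ^ m = (\<Sum>\<beta>\<in>S. q \<alpha> \<beta> * (G c w $ \<beta>) ^ m)" if w: "w \<in> ball c 1" for \<alpha> c w
    proof -
      let ?u = "\<chi> i. (G c w $ Inl i) ^ m"
      have "(G c w $ \<alpha>) ^ m = lin_form (coord_form a \<alpha>) ?u"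
        by (rule fermat_cone_power_eq[OF G(3)[OF w]])
      also have "\<dots> = (\<Sum>\<beta>\<in>S. q \<alpha> \<beta> * lin_form (coord_form a \<beta>) ?u)"
        by (rule q[rule_format])
      also have "\<dots> = (\<Sum>\<beta>\<in>S. q \<alpha> \<beta> * (G c w $ \<beta>) ^ m)"
        by (rule sum.cong[OF refl])
          (rule arg_cong[OF fermat_cone_power_eq[OF G(3)[OF w], symmetric]])
      finally show ?thesis .
    qed
    then show "\<exists>q. \<forall>\<alpha> c. \<forall>w\<in>ball c 1. (G c w $ \<alpha>) ^ m = (\<Sum>\<beta>\<in>S. q \<alpha> \<beta> * (G c w $ \<beta>) ^ m)"
      by (intro exI[of _ q] allI ballI)
  qed
  show False using curve_constant G(2) by blast
qed

end
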